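(* The following holds for any fixed constants $C,c>0$. Let $G$ be an $n$-vertex $C$-Ramsey graph, let $k$ be an integer with $cn\le k\le(1-c)n$, and let $X$ be the number of edges of $G$ induced by a uniformly random subset of $k$ vertices of $G$. Then for any $x\in\mathbb{Z}$, \[\Pr(X=x)\le n^{o(1)-1}.\] Here $o(1)$ denotes a quantity tending to $0$ as $n\to\infty$ at a rate depending only on $C$ and $c$; that is, for every $\eta>0$ there is $n_0=n_0(C,c,\eta)$ such that $\Pr(X=x)\le n^{-1+\eta}$ for all $n\ge n_0$, all $n$-vertex $C$-Ramsey graphs $G$, all integers $k$ with $cn\le k\le(1-c)n$, and all $x\in\mathbb{Z}$, where $X$ is the number of edges of $G$ induced by a uniformly random subset of $k$ vertices of $G$.
   Context: A (finite simple) graph on $n$ vertices is $C$-Ramsey if it has no homogeneous induced subgraph of size $C\log_2 n$, i.e. no clique and no independent set on at least $C\log_2 n$ vertices. *)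

theory Defs
  imports "HOL-Probability.Probability" "HOL-Library.Ramsey"
begin

text \<open>
  Graphs are given by a vertex set \<open>V\<close> and a set \<open>E\<close> of edges, which are two-element subsets of \<open>V\<close>;
  \<open>[V]\<^bsup>k\<^esup>\<close> is the library's notation for the set of \<open>k\<close>-element subsets of \<open>V\<close>. The library
  predicates \<open>clique U E\<close> and \<open>indep U E\<close> do not require \<open>U \<subseteq> V\<close>, hence this condition below.
\<close>

definition finite_simple_graph :: "'a set \<Rightarrow> 'a set set \<Rightarrow> bool" where
  "finite_simple_graph V E \<longleftrightarrow> finite V \<and> E \<subseteq> [V]\<^bsup>2\<^esup>"

definition Ramsey_graph :: "real \<Rightarrow> 'a set \<Rightarrow> 'a set set \<Rightarrow> bool" where
  "Ramsey_graph C V E \<longleftrightarrow> finite_simple_graph V E \<and>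
     \<not> (\<exists>U\<subseteq>V. real (card U) \<ge> C * log 2 (real (card V)) \<and> (clique U E \<or> indep U E))"

definition induced_edges :: "'a set set \<Rightarrow> 'a set \<Rightarrow> 'a set set" where
  "induced_edges E U = {e \<in> E. e \<subseteq> U}"

text \<open>
  The law of the number of induced edges in a uniformly random \<open>k\<close>-element vertex set; meaningful for
  finite \<open>V\<close> and \<open>k \<le> card V\<close>, where \<open>[V]\<^bsup>k\<^esup>\<close> is finite and nonempty.
\<close>

definition induced_edge_count_pmf :: "'a set \<Rightarrow> 'a set set \<Rightarrow> nat \<Rightarrow> int pmf" where
  "induced_edge_count_pmf V E k =
     map_pmf (\<lambda>U. int (card (induced_edges E U))) (pmf_of_set ([V]\<^bsup>k\<^esup>))"

end

theory Submission
  imports Defs "HOL-Real_Asymp.Real_Asymp"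
begin

text \<open>
  Let \<open>X\<close> be the number of edges inside a uniformly random \<open>k\<close>-set of vertices. If \<open>k \<le> n/2\<close>, the random
  \<open>k\<close>-set can be chosen inside a random set of \<open>2k\<close> vertices; if \<open>k > n/2\<close>, one first chooses \<open>2k - n\<close> of its
  members, which only adds linear weights to the other vertices. Either way it is enough to choose
  \<open>m\<close> out of \<open>2m\<close> vertices. For a uniformly random subset \<open>U\<close> of these \<open>N = 2m\<close> vertices the event
  \<open>card U = m\<close> has probability of order \<open>N\<^sup>-\<^sup>1\<^sup>/\<^sup>2\<close>, so the aim is the bound \<open>N\<^sup>-\<^sup>3\<^sup>/\<^sup>2\<close>, up to a factor \<open>N\<^sup>\<eta>\<close>, for
  the event that \<open>card U = m\<close> and the weighted number of edges in \<open>U\<close> equals \<open>x\<close> (\<open>slice_point_prob\<close>).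

  The Ramsey property enters through \<open>extend_robust\<close> alone. If every row of the adjacency matrix
  agreed, up to few errors, with a combination of a bounded number of rows, then the matrix would be
  close to a block matrix with boundedly many blocks, and a diagonal block would contain a
  homogeneous set of size \<open>N\<^sup>\<gamma>\<close>. Hence half of the vertices can be arranged into disjoint tuples of
  bounded length whose rows are linearly independent, even after deleting a set of almost linear size
  (\<open>robust\<close>). Such independence yields joint anticoncentration of several sums: many columns carry
  the same vector, there are enough such vectors to span, and the number of chosen columns of each
  kind is binomial (\<open>joint_point_prob\<close>).

  The vertices are split into a very small set \<open>B\<close> (of size at most \<open>q\<^sup>4\<close>, where \<open>q\<close> is a small power of
  \<open>N\<close>), a set \<open>C\<close> smaller than \<open>N\<close> by a few powers of \<open>q\<close>, and the bulk \<open>A\<close>; the random set is revealed in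
  the order \<open>A\<close>, \<open>C\<close>, \<open>B\<close>.

  In the first stage, the weight of \<open>U \<inter> (A \<union> C)\<close> is shown to lie in a given interval of length
  about \<open>N\<^sup>1\<^sup>/\<^sup>2\<close>, with prescribed cardinality, with probability about \<open>N\<^sup>-\<^sup>1\<close>
  (\<open>coarse_anticoncentration\<close>). Once \<open>U \<inter> A\<close> is known, \<open>C\<close> contains many disjoint pairs of vertices
  whose degrees into \<open>U \<inter> A\<close> differ by almost \<open>N\<^sup>1\<^sup>/\<^sup>2\<close>. Replacing one vertex of a pair by the other
  preserves the cardinality and increases the weight by nearly this amount, since degrees inside \<open>C\<close>
  fluctuate much less. The weights thus increase along chains, and Sperner's theorem applies.

  In the second stage, the weight hits the exact value \<open>x\<close> through the choice of \<open>U \<inter> B\<close> with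
  conditional probability about \<open>N\<^sup>-\<^sup>1\<^sup>/\<^sup>2\<close>, apart from very unlikely outcomes on \<open>A \<union> C\<close>. For this, the
  moment of order \<open>d + 1\<close> of the conditional probability is estimated (\<open>moment_bound\<close>): it is the
  probability that \<open>d + 1\<close> independent copies of \<open>U \<inter> B\<close> all produce the value \<open>x\<close>. Subtracting, the
  quadratic terms inside \<open>A \<union> C\<close> cancel and \<open>d\<close> linear equations in \<open>U \<inter> A\<close> remain, which for almost
  all copies are robustly independent and hold with probability about \<open>N\<^sup>-\<^sup>d\<^sup>/\<^sup>2\<close>. Letting \<open>d\<close> grow makes
  the resulting loss an arbitrarily small power of \<open>N\<close>.
\<close>

section \<open>Uniformly random subsets\<close>

text \<open>
  Probabilities over a uniformly random subset are finite means. A random subset of \<open>A \<union> B\<close> with \<open>A\<close> and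
  \<open>B\<close> disjoint is a pair of independent random subsets, so conditioning becomes the iterated mean of \<open>avg_Un\<close>.
\<close>

definition avg :: "'a set \<Rightarrow> ('a set \<Rightarrow> real) \<Rightarrow> real" where
  "avg S f = (\<Sum>U\<in>Pow S. f U) / 2 ^ card S"

definition pr :: "'a set \<Rightarrow> ('a set \<Rightarrow> bool) \<Rightarrow> real" where
  "pr S P = avg S (\<lambda>U. of_bool (P U))"

lemma avg_cong: "S = S' \<Longrightarrow> (\<And>U. U \<subseteq> S' \<Longrightarrow> f U = h U) \<Longrightarrow> avg S f = avg S' h"
  unfolding avg_def by (auto intro!: arg_cong2[where f="(/)"] sum.cong)

lemma avg_mono: "(\<And>U. U \<subseteq> S \<Longrightarrow> f U \<le> h U) \<Longrightarrow> avg S f \<le> avg S h"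
  unfolding avg_def by (auto intro!: divide_right_mono sum_mono)

lemma avg_const [simp]: "finite S \<Longrightarrow> avg S (\<lambda>_. c) = c"
  unfolding avg_def by (simp add: card_Pow)

lemma avg_empty [simp]: "avg {} f = f {}"
  unfolding avg_def by simp

lemma avg_add: "avg S (\<lambda>U. f U + h U) = avg S f + avg S h"
  unfolding avg_def by (simp add: sum.distrib add_divide_distrib)

lemma avg_cmult: "avg S (\<lambda>U. c * f U) = c * avg S f"
  unfolding avg_def by (simp add: sum_distrib_left)

lemma avg_cmult_right: "avg S (\<lambda>U. f U * c) = avg S f * c"
  unfolding avg_def by (simp add: sum_distrib_right)

lemma avg_sum: "avg S (\<lambda>U. \<Sum>i\<in>I. f i U) = (\<Sum>i\<in>I. avg S (f i))"
  unfolding avg_def by (subst sum.swap) (simp add: sum_divide_distrib)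

lemma avg_nonneg: "(\<And>U. U \<subseteq> S \<Longrightarrow> 0 \<le> f U) \<Longrightarrow> 0 \<le> avg S f"
  unfolding avg_def by (auto intro!: divide_nonneg_nonneg sum_nonneg)

lemma avg_le_const: "finite S \<Longrightarrow> (\<And>U. U \<subseteq> S \<Longrightarrow> f U \<le> c) \<Longrightarrow> avg S f \<le> c"
  using avg_mono[of S f "\<lambda>_. c"] by simp

lemma avg_swap: "avg S (\<lambda>X. avg T (\<lambda>Y. f X Y)) = avg T (\<lambda>Y. avg S (\<lambda>X. f X Y))"
  unfolding avg_def by (simp add: sum_divide_distrib, subst sum.swap) (simp add: mult.commute)

lemma sum_Pow_Un:
  fixes f :: "'a set \<Rightarrow> real"
  assumes "A \<inter> B = {}"
  shows "(\<Sum>U\<in>Pow (A \<union> B). f U) = (\<Sum>X\<in>Pow A. \<Sum>Y\<in>Pow B. f (X \<union> Y))"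
proof -
  have "(\<Sum>X\<in>Pow A. \<Sum>Y\<in>Pow B. f (X \<union> Y)) = (\<Sum>(X,Y)\<in>Pow A \<times> Pow B. f (X \<union> Y))"
    by (simp add: sum.cartesian_product)
  also have "\<dots> = (\<Sum>U\<in>Pow (A \<union> B). f U)"
    using assms
    by (intro sum.reindex_bij_witness[where j="\<lambda>(X,Y). X \<union> Y" and i="\<lambda>U. (U \<inter> A, U \<inter> B)"]) auto
  finally show ?thesis by simp
qed

lemma avg_Un:
  assumes "finite A" "finite B" "A \<inter> B = {}"
  shows "avg (A \<union> B) f = avg A (\<lambda>X. avg B (\<lambda>Y. f (X \<union> Y)))"
  using assms unfolding avg_def
  by (simp add: sum_Pow_Un card_Un_disjoint power_add sum_divide_distrib mult.commute)

lemma avg_image: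
  assumes "inj_on p I"
  shows "avg (p ` I) f = avg I (\<lambda>Z. f (p ` Z))"
proof -
  have "(\<Sum>U\<in>Pow (p ` I). f U) = (\<Sum>Z\<in>Pow I. f (p ` Z))"
    using bij_betw_Pow[OF inj_on_imp_bij_betw[OF assms]]
    by (intro sum.reindex_bij_betw[symmetric]) auto
  then show ?thesis using assms by (simp add: avg_def card_image)
qed

text \<open>
  Symmetric difference with a fixed set is a bijection of the cube.
\<close>

lemma avg_symm_diff:
  assumes "Z \<subseteq> I"
  shows "avg I (\<lambda>Y. f Y) = avg I (\<lambda>T. f ((Z - T) \<union> (T - Z)))"
proof -
  have "(\<Sum>Y\<in>Pow I. f Y) = (\<Sum>T\<in>Pow I. f ((Z - T) \<union> (T - Z)))"
    using assms
    by (intro sum.reindex_bij_witness[where i="\<lambda>T. (Z - T) \<union> (T - Z)" and j="\<lambda>T. (Z - T) \<union> (T - Z)"])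
       (auto intro!: arg_cong[where f=f])
  then show ?thesis by (simp add: avg_def)
qed

lemma avg_insert:
  assumes "finite S" "x \<notin> S"
  shows "avg (insert x S) f = (avg S f + avg S (\<lambda>U. f (insert x U))) / 2"
proof -
  have "avg ({x} \<union> S) f = avg {x} (\<lambda>X. avg S (\<lambda>Y. f (X \<union> Y)))"
    using assms by (intro avg_Un) auto
  also have "\<dots> = (avg S f + avg S (\<lambda>U. f (insert x U))) / 2"
    by (simp add: avg_def[of "{x}"] Pow_insert)
  finally show ?thesis by simp
qed

lemma pr_nonneg [simp]: "0 \<le> pr S P"
  unfolding pr_def by (rule avg_nonneg) auto

lemma pr_le_1: "finite S \<Longrightarrow> pr S P \<le> 1"
  unfolding pr_def by (rule avg_le_const) auto

lemma pr_mono: "(\<And>U. U \<subseteq> S \<Longrightarrow> P U \<Longrightarrow> Q U) \<Longrightarrow> pr S P \<le> pr S Q"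
  unfolding pr_def by (rule avg_mono) auto

lemma pr_cong: "(\<And>U. U \<subseteq> S \<Longrightarrow> P U = Q U) \<Longrightarrow> pr S P = pr S Q"
  unfolding pr_def by (rule avg_cong) auto

lemma pr_disj: "pr S (\<lambda>U. P U \<or> Q U) \<le> pr S P + pr S Q"
  unfolding pr_def avg_add[symmetric] by (rule avg_mono) auto

lemma pr_Bex:
  fixes b :: real
  assumes "finite I" "\<And>i. i \<in> I \<Longrightarrow> pr S (P i) \<le> b"
  shows "pr S (\<lambda>U. \<exists>i\<in>I. P i U) \<le> card I * b"
proof -
  have "pr S (\<lambda>U. \<exists>i\<in>I. P i U) \<le> (\<Sum>i\<in>I. pr S (P i))"
    unfolding pr_def avg_sum[symmetric]
  proof (rule avg_mono)
    fix U
    show "of_bool (\<exists>i\<in>I. P i U) \<le> (\<Sum>i\<in>I. of_bool (P i U) :: real)"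
    proof (cases "\<exists>i\<in>I. P i U")
      case True
      then obtain i where "i \<in> I" "P i U" by auto
      then have "(1::real) \<le> (\<Sum>i\<in>I. of_bool (P i U))"
        using member_le_sum[of i I "\<lambda>i. of_bool (P i U) :: real"] assms(1) by auto
      then show ?thesis by simp
    qed (auto intro: sum_nonneg)
  qed
  also have "\<dots> \<le> card I * b" using sum_bounded_above[of I "\<lambda>i. pr S (P i)" b] assms by simp
  finally show ?thesis .
qed

lemma pr_card: "finite S \<Longrightarrow> pr S P = card {U. U \<subseteq> S \<and> P U} / 2 ^ card S"
  unfolding pr_def avg_def of_bool_def
  by (simp add: sum.If_cases Int_def Pow_def)

text \<open>
  Conditional form of the product rule: \<open>Q\<close> records which outcomes on \<open>A\<close> leave the event possible, and
  each of them leaves at most the probability \<open>b\<close> on \<open>B\<close>.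
\<close>

lemma pr_Un_le:
  assumes "finite A" "finite B" "A \<inter> B = {}"
    and "\<And>X. X \<subseteq> A \<Longrightarrow> pr B (\<lambda>Y. P (X \<union> Y)) \<le> b * of_bool (Q X)"
  shows "pr (A \<union> B) P \<le> b * pr A Q"
  using assms unfolding pr_def avg_Un[OF assms(1-3)] avg_cmult[symmetric]
  by (intro avg_mono) auto

section \<open>Central binomial coefficients\<close>

lemma central_binomial_Suc:
  "real ((2 * Suc m) choose Suc m) * (m + 1) = real ((2*m) choose m) * (2 * (2 * m + 1))"
proof -
  have "Suc m * ((2 * Suc m) choose Suc m) = (2 * Suc m) * ((2*m+1) choose m)"
    using Suc_times_binomial_eq[of "2*m+1" m] by simp
  moreover have "Suc m * ((2*m+1) choose m) = (2*m+1) * ((2*m) choose m)"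
    using Suc_times_binomial_eq[of "2*m" m] binomial_symmetric[of m "2*m+1"] 
    by (simp add: binomial_absorb_comp)
  ultimately have "Suc m * (Suc m * ((2 * Suc m) choose Suc m)) = Suc m * (2 * (2*m+1) * ((2*m) choose m))"
    by (metis (no_types, opaque_lifting) mult.assoc mult.commute)
  then have "Suc m * ((2 * Suc m) choose Suc m) = 2 * (2*m+1) * ((2*m) choose m)"
    by (simp only: mult_cancel1) simp
  then show ?thesis
    by (metis (mono_tags, opaque_lifting) Suc_eq_plus1 mult.commute of_nat_mult)
qed

text \<open>
  The factor \<open>sqrt (2 m + 1)\<close> is the one for which the induction closes, because
  \<open>(2 m + 1) (2 m + 3) \<le> (2 m + 2)\<^sup>2\<close>. The companion lower bound uses \<open>m (m + 1) \<le> (m + 1/2)\<^sup>2\<close> in the same way.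
\<close>

lemma central_binomial_upper: "real ((2*m) choose m) * sqrt (2 * real m + 1) \<le> 4 ^ m"
proof (induction m)
  case (Suc m)
  note rec = central_binomial_Suc[of m]
  define b where "b = real ((2*m) choose m)"
  have b: "b * sqrt (2 * m + 1) \<le> 4 ^ m" using Suc by (simp add: b_def add.commute)
  have "sqrt (2*m+1) * sqrt (2*m+3) = sqrt ((2 * real m+1) * (2 * real m+3))"
    by (simp only: real_sqrt_mult) simp
  also have "\<dots> \<le> 2*m+2"
    by (rule real_le_lsqrt) (auto simp: power2_eq_square algebra_simps)
  finally have s: "sqrt (2*m+1) * sqrt (2*m+3) \<le> 2*m+2" .
  have "real ((2 * Suc m) choose Suc m) * sqrt (2 * Suc m + 1) * (m+1) 
      = (real ((2 * Suc m) choose Suc m) * (m + 1)) * sqrt (2*m+3)"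
    by (simp add: mult_ac add_ac del: binomial_Suc_Suc)
  also have "\<dots> = b * (2 * (2*m+1)) * sqrt (2*m+3)"
    unfolding rec by (simp add: b_def)
  also have "\<dots> = b * (2 * (sqrt (2*m+1) * sqrt (2*m+1))) * sqrt (2*m+3)" by simp
  also have "\<dots> = 2 * (b * sqrt (2*m+1)) * (sqrt (2*m+1) * sqrt (2*m+3))"
    by (simp only: mult_ac)
  also have "\<dots> \<le> 2 * 4^m * (2 * real m+2)"
    using b s by (intro mult_mono) (auto simp: b_def)
  also have "\<dots> = 4 ^ Suc m * (real m+1)" by (simp add: algebra_simps)
  finally have "(real ((2 * Suc m) choose Suc m) * sqrt (2 * real (Suc m) + 1)) * (real m + 1)
      \<le> 4 ^ Suc m * (real m + 1)"
    by (simp add: add_ac mult_ac del: binomial_Suc_Suc)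
  then show ?case by (rule mult_right_le_imp_le) simp
qed simp

lemma central_binomial_lower: "m > 0 \<Longrightarrow> 4 ^ m \<le> real ((2*m) choose m) * (2 * sqrt (real m))"
proof (induction m rule: nat_induct_non_zero)
  case (Suc m)
  note rec = central_binomial_Suc[of m]
  define b where "b = real ((2*m) choose m)"
  have b: "4 ^ m \<le> b * (2 * sqrt m)" using Suc by (simp add: b_def)
  have "sqrt m * sqrt (m+1) = sqrt (real m * (real m+1))" by (simp only: real_sqrt_mult) simp
  also have "\<dots> \<le> m + 1/2"
    by (rule real_le_lsqrt) (auto simp: power2_eq_square algebra_simps)
  finally have s: "2 * (sqrt m * sqrt (m+1)) \<le> 2*m+1" by simp
  have "(4::real) ^ Suc m * (real m+1) = 4 * (4^m) * (real m+1)" by simp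
  also have "\<dots> \<le> 4 * (b * (2 * sqrt m)) * (m + 1)" using b by (intro mult_mono) (auto simp: b_def)
  also have "\<dots> = 4 * b * sqrt (m+1) * (2 * (sqrt m * sqrt (m+1)))"
    by (simp add: algebra_simps)
  also have "\<dots> \<le> 4 * b * sqrt (m+1) * (2*m+1)"
    using s by (intro mult_left_mono) (auto simp: b_def)
  also have "\<dots> = real ((2 * Suc m) choose Suc m) * (m + 1) * (2 * sqrt (m+1))"
    unfolding rec by (simp add: b_def)
  finally have "4 ^ Suc m * (real m+1) \<le> (real ((2 * Suc m) choose Suc m) * (2 * sqrt (Suc m))) * (real m + 1)"
    by (simp add: algebra_simps)
  then show ?case by (rule mult_right_le_imp_le) simp
qed simp

text \<open>
  The middle coefficient is the largest one; an odd row is reduced to the next even row, whose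
  middle coefficient is twice as large.
\<close>

lemma binomial_le_2_power_div_sqrt:
  assumes "n > 0"
  shows "real (n choose k) \<le> 2 ^ n / sqrt (real n)"
proof -
  have "real (n choose k) * sqrt n \<le> real (n choose (n div 2)) * sqrt n"
    by (intro mult_right_mono) (auto simp: binomial_maximum)
  also have "\<dots> \<le> 2 ^ n"
  proof (cases "even n")
    case True
    then obtain m where m: "n = 2 * m" by auto
    have "real (n choose (n div 2)) * sqrt n \<le> real ((2*m) choose m) * sqrt (2 * real m + 1)"
      by (intro mult_mono) (auto simp: m)
    also note central_binomial_upper[of m]
    finally show ?thesis by (simp add: m power_mult)
  next
    case False
    then obtain m where m: "n = 2 * m + 1" by (elim oddE)
    have "2 * ((2 * m + 1) choose m) = (2 * Suc m) choose Suc m"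
      using binomial_symmetric[of m "2*m+1"] by simp
    then have "2 * (real (n choose (n div 2)) * sqrt n) = real ((2 * Suc m) choose Suc m) * sqrt n"
      by (metis (no_types, lifting) False m add_diff_cancel_right' mult.assoc nonzero_mult_div_cancel_left
          odd_two_times_div_two_nat of_nat_mult of_nat_numeral zero_neq_numeral)
    also have "\<dots> \<le> real ((2 * Suc m) choose Suc m) * sqrt (2 * real (Suc m) + 1)"
      by (intro mult_left_mono) (auto simp: m)
    also have "\<dots> \<le> 4 ^ Suc m" by (rule central_binomial_upper)
    also have "\<dots> = 2 * 2 ^ n" by (simp add: m power_mult)
    finally show ?thesis by simp
  qed
  finally show ?thesis using assms by (simp add: field_simps)
qed

lemma pr_card_eq:
  assumes "finite S" "S \<noteq> {}"
  shows "pr S (\<lambda>U. card U = k) \<le> 1 / sqrt (card S)"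
proof -
  have "card S > 0" using assms by (simp add: card_gt_0_iff)
  then have "real (card S choose k) / 2 ^ card S \<le> 1 / sqrt (card S)"
    using binomial_le_2_power_div_sqrt[of "card S" k] by (simp add: field_simps)
  then show ?thesis using assms by (simp add: pr_card n_subsets)
qed

section \<open>A Hoeffding bound\<close>

text \<open>
  Comparison of the two power series term by term: \<open>2\<^sup>n n! \<le> (2n)!\<close>.
\<close>

lemma cosh_le_exp_half_square: "cosh (x::real) \<le> exp (x\<^sup>2 / 2)"
proof -
  have "(\<lambda>n. if even n then x ^ n / fact n else 0) sums cosh x" 
    using cosh_converges[of x] by (simp add: scaleR_conv_of_real field_simps cong: if_cong)
  then have c: "(\<lambda>n. x ^ (2*n) / fact (2*n)) sums cosh x"
  proof -
    have "(\<lambda>n. (\<lambda>n. if even n then x ^ n / fact n else 0) (2*n)) sums cosh x"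
      by (subst sums_mono_reindex) (use \<open>(\<lambda>n. if even n then x ^ n / fact n else 0) sums cosh x\<close> in \<open>auto simp: strict_mono_def elim!: evenE\<close>)
    then show ?thesis by simp
  qed
  have e: "(\<lambda>n. (x\<^sup>2/2) ^ n / fact n) sums exp (x\<^sup>2/2)"
    using exp_converges[of "x\<^sup>2/2"] by (simp add: scaleR_conv_of_real field_simps)
  have "x ^ (2*n) / fact (2*n) \<le> (x\<^sup>2/2) ^ n / fact n" for n
  proof -
    have "2 ^ n * fact n \<le> (fact (2*n) :: real)"
    proof (induction n)
      case (Suc n)
      have "2 ^ Suc n * fact (Suc n) = (2 * (real n+1)) * (2 ^ n * fact n :: real)" by (simp add: algebra_simps)
      also have "\<dots> \<le> (2 * (real n+1)) * fact (2*n)" using Suc by (intro mult_left_mono) auto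
      also have "\<dots> \<le> (2 * real n+1) * (2 * (real n+1)) * fact (2*n)" by (auto intro!: mult_right_mono)
      also have "\<dots> = fact (2 * Suc n)" by (simp add: algebra_simps)
      finally show ?case .
    qed simp
    then have "x ^ (2*n) / fact (2*n) \<le> x ^ (2*n) / (2 ^ n * fact n)"
      by (intro divide_left_mono) auto
    then show ?thesis by (simp add: power_mult power_divide)
  qed
  then show ?thesis using sums_le[OF _ c e] by blast
qed

text \<open>
  Centring at half the total sum turns each coordinate into a fair sign times \<open>c i / 2\<close>.
\<close>

lemma avg_exp_sum:
  assumes "finite S"
  shows "avg S (\<lambda>U. exp (\<theta> * ((\<Sum>i\<in>U. c i) - (\<Sum>i\<in>S. c i) / 2))) = (\<Prod>i\<in>S. cosh (\<theta> * c i / 2))"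
  using assms
proof (induction S)
  case (insert x S)
  define h where "h U = exp (\<theta> * ((\<Sum>i\<in>U. c i) - (\<Sum>i\<in>S. c i) / 2))" for U
  have 1: "avg S (\<lambda>U. exp (\<theta> * ((\<Sum>i\<in>U. c i) - (\<Sum>i\<in>insert x S. c i) / 2)))
         = exp (- (\<theta> * c x / 2)) * avg S h"
    unfolding avg_cmult[symmetric] using insert
    by (intro avg_cong) (auto simp: h_def algebra_simps add_divide_distrib simp flip: exp_add)
  have 2: "avg S (\<lambda>U. exp (\<theta> * ((\<Sum>i\<in>insert x U. c i) - (\<Sum>i\<in>insert x S. c i) / 2)))
         = exp (\<theta> * c x / 2) * avg S h"
    unfolding avg_cmult[symmetric]
  proof (intro avg_cong refl)
    fix U assume U: "U \<subseteq> S"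
    then have "finite U" "x \<notin> U" using insert finite_subset by auto
    then have "sum c (insert x U) = c x + sum c U" by simp
    moreover have "sum c (insert x S) = c x + sum c S" using insert by simp
    ultimately have "\<theta> * (sum c (insert x U) - sum c (insert x S) / 2)
        = \<theta> * c x / 2 + \<theta> * (sum c U - sum c S / 2)" by (simp add: field_simps)
    then show "exp (\<theta> * (sum c (insert x U) - sum c (insert x S) / 2)) = exp (\<theta> * c x / 2) * h U"
      by (simp add: h_def exp_add)
  qed
  have 3: "cosh (\<theta> * c x / 2) * K = (exp (- (\<theta> * c x / 2)) * K + exp (\<theta> * c x / 2) * K) / 2" for K
    by (simp add: cosh_def algebra_simps)
  show ?case
    using insert unfolding avg_insert[OF insert(1,2)] 1 2 by (simp add: 3 flip: h_def)
qed simp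

text \<open>
  The exponential moment method. The parameter \<open>n\<close> is an upper bound for the number of coordinates
  rather than this number itself, so that the estimate can be used with round values.
\<close>

lemma pr_Hoeffding:
  assumes "finite S" "real (card S) \<le> n" "n > 0" "\<And>i. i \<in> S \<Longrightarrow> \<bar>c i\<bar> \<le> 1" "t \<ge> 0"
  shows "pr S (\<lambda>U. t < \<bar>(\<Sum>i\<in>U. c i) - (\<Sum>i\<in>S. c i) / 2\<bar>) \<le> 2 * exp (- 2 * t\<^sup>2 / n)"
proof -
  have one: "pr S (\<lambda>U. t < (\<Sum>i\<in>U. c i) - (\<Sum>i\<in>S. c i) / 2) \<le> exp (- 2 * t\<^sup>2 / n)"
    if c: "\<And>i. i \<in> S \<Longrightarrow> \<bar>c i\<bar> \<le> 1" for c :: "'a \<Rightarrow> real"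
  proof -
    \<comment> \<open>The value of \<open>\<theta>\<close> minimising \<open>n * \<theta>\<^sup>2 / 8 - \<theta> * t\<close>.\<close>
    define \<theta> where "\<theta> = 4 * t / n"
    have th: "\<theta> \<ge> 0" using assms by (simp add: \<theta>_def)
    have "pr S (\<lambda>U. t < (\<Sum>i\<in>U. c i) - (\<Sum>i\<in>S. c i) / 2)
        \<le> avg S (\<lambda>U. exp (\<theta> * ((\<Sum>i\<in>U. c i) - (\<Sum>i\<in>S. c i) / 2)) * exp (- \<theta> * t))"
      unfolding pr_def
    proof (rule avg_mono)
      fix U
      show "of_bool (t < (\<Sum>i\<in>U. c i) - (\<Sum>i\<in>S. c i) / 2)
         \<le> exp (\<theta> * ((\<Sum>i\<in>U. c i) - (\<Sum>i\<in>S. c i) / 2)) * exp (- \<theta> * t)"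
      proof (cases "t < (\<Sum>i\<in>U. c i) - (\<Sum>i\<in>S. c i) / 2")
        case True
        then have "0 \<le> \<theta> * (((\<Sum>i\<in>U. c i) - (\<Sum>i\<in>S. c i) / 2) - t)" using th by (intro mult_nonneg_nonneg) auto
        then show ?thesis using True by (simp add: algebra_simps flip: exp_add)
      qed auto
    qed
    also have "\<dots> = (\<Prod>i\<in>S. cosh (\<theta> * c i / 2)) * exp (- \<theta> * t)"
      by (simp only: avg_cmult_right avg_exp_sum[OF assms(1)])
    also have "(\<Prod>i\<in>S. cosh (\<theta> * c i / 2)) \<le> (\<Prod>i\<in>S. exp (\<theta>\<^sup>2 / 8))"
    proof (rule prod_mono, safe)
      fix i assume i: "i \<in> S"
      have "(c i)\<^sup>2 \<le> 1" using c[OF i] by (simp add: abs_square_le_1)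
      then have "\<theta>\<^sup>2 * (c i)\<^sup>2 \<le> \<theta>\<^sup>2" by (simp add: mult_left_le)
      then have "(\<theta> * c i / 2)\<^sup>2 / 2 \<le> \<theta>\<^sup>2 / 8" by (simp add: power_mult_distrib power_divide)
      then show "cosh (\<theta> * c i / 2) \<le> exp (\<theta>\<^sup>2 / 8)"
        using cosh_le_exp_half_square[of "\<theta> * c i / 2"] by (smt (verit) exp_le_cancel_iff)
    qed (auto simp: cosh_real_nonneg)
    also have "\<dots> = exp (real (card S) * (\<theta>\<^sup>2 / 8))" by (simp flip: exp_of_nat_mult)
    also have "\<dots> \<le> exp (n * (\<theta>\<^sup>2 / 8))" using assms by (auto intro!: mult_right_mono)
    also have "n * (\<theta>\<^sup>2 / 8) = 2 * t\<^sup>2 / n" using assms by (simp add: \<theta>_def power2_eq_square)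
    also have "exp (2 * t\<^sup>2 / n) * exp (- \<theta> * t) = exp (- 2 * t\<^sup>2 / n)"
      by (simp add: \<theta>_def power2_eq_square field_simps flip: exp_add)
    finally show ?thesis by simp
  qed
  have "pr S (\<lambda>U. t < \<bar>(\<Sum>i\<in>U. c i) - (\<Sum>i\<in>S. c i) / 2\<bar>)
     \<le> pr S (\<lambda>U. t < (\<Sum>i\<in>U. c i) - (\<Sum>i\<in>S. c i) / 2 \<or> t < (\<Sum>i\<in>U. - c i) - (\<Sum>i\<in>S. - c i) / 2)"
    by (rule pr_mono) (auto simp: sum_negf abs_if split: if_splits)
  also have "\<dots> \<le> exp (- 2 * t\<^sup>2 / n) + exp (- 2 * t\<^sup>2 / n)"
    using assms by (intro order_trans[OF pr_disj] add_mono one) auto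
  finally show ?thesis by simp
qed

section \<open>Sperner's theorem\<close>

definition antichain :: "'a set set \<Rightarrow> bool" where
  "antichain F \<longleftrightarrow> (\<forall>A\<in>F. \<forall>B\<in>F. A \<subseteq> B \<longrightarrow> A = B)"

lemma antichainD: "antichain F \<Longrightarrow> A \<in> F \<Longrightarrow> B \<in> F \<Longrightarrow> A \<subseteq> B \<Longrightarrow> A = B"
  unfolding antichain_def by blast

lemma antichain_subset: "antichain F \<Longrightarrow> F' \<subseteq> F \<Longrightarrow> antichain F'"
  unfolding antichain_def by blast

text \<open>
  Induction on the ground set. If \<open>T\<close> itself is not a member, every member avoids some point; the
  inequality for the members avoiding \<open>x\<close>, summed over all \<open>x\<close>, counts a member \<open>A\<close> exactly
  \<open>card (T - A)\<close> times, and \<open>card (T - A) / (card T - 1 choose card A) = card T / (card T choose card A)\<close>.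
\<close>

lemma LYM_inequality:
  assumes "finite T" "F \<subseteq> Pow T" "antichain F"
  shows "(\<Sum>A\<in>F. 1 / real (card T choose card A)) \<le> 1"
  using assms
proof (induction "card T" arbitrary: T F)
  case 0
  then have "F \<subseteq> {{}}" by auto
  then have "F = {} \<or> F = {{}}" by auto
  then show ?case by auto
next
  case (Suc n T F)
  have finF: "finite F" using Suc.prems finite_subset by blast
  have sub: "finite A" "A \<subseteq> T" "card A \<le> Suc n" if "A \<in> F" for A
  proof -
    show AT: "A \<subseteq> T" using that Suc.prems by auto
    then show "finite A" "card A \<le> Suc n"
      using Suc.prems(1) Suc.hyps(2) by (auto intro: finite_subset card_mono)
  qed
  show ?case
  proof (cases "T \<in> F")
    case True
    have "F \<subseteq> {T}"
    proof
      fix A assume "A \<in> F"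
      from antichainD[OF Suc.prems(3) this True sub(2)[OF this]] show "A \<in> {T}"
        by (rule ssubst) (rule singletonI)
    qed
    then have "F = {T}" using True by (simp add: subset_antisym)
    then show ?thesis by simp
  next
    case False
    define F' where "F' x = {A\<in>F. x \<notin> A}" for x
    have IH: "(\<Sum>A\<in>F' x. 1 / real (n choose card A)) \<le> 1" if "x \<in> T" for x
    proof -
      have "(\<Sum>A\<in>F' x. 1 / real (card (T - {x}) choose card A)) \<le> 1"
      proof (rule Suc.hyps(1))
        show "n = card (T - {x})" using card_Diff_singleton[OF that] Suc.hyps(2) by linarith
        show "finite (T - {x})" using Suc.prems(1) by simp
        show "F' x \<subseteq> Pow (T - {x})" using Suc.prems(2) by (auto simp: F'_def)
        show "antichain (F' x)" by (rule antichain_subset[OF Suc.prems(3)]) (auto simp: F'_def)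
      qed
      moreover have "card (T - {x}) = n" using card_Diff_singleton[OF that] Suc.hyps(2) by linarith
      ultimately show ?thesis by (simp only:)
    qed
    have weight: "(\<Sum>x\<in>T - A. 1 / real (n choose card A)) = real (Suc n) * (1 / real (Suc n choose card A))"
      if "A \<in> F" for A
    proof -
      have "A \<noteq> T" using that False by auto
      then have lt: "card A < Suc n" using sub[OF that] Suc.hyps(2) Suc.prems(1) psubset_card_mono[of T A] by auto
      have "card (T - A) = Suc n - card A" using sub[OF that] Suc.hyps(2) by (simp add: card_Diff_subset)
      moreover have "(Suc n - card A) * (Suc n choose card A) = Suc n * (n choose card A)"
        using binomial_absorb_comp[of "Suc n" "card A"] by simp
      then have "real (Suc n - card A) * real (Suc n choose card A) = real (Suc n) * real (n choose card A)"
        by (metis of_nat_mult)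
      moreover have "real (n choose card A) > 0" "real (Suc n choose card A) > 0" using lt by auto
      ultimately show ?thesis by (simp add: field_simps del: of_nat_Suc binomial_Suc_Suc)
    qed
    have "real (Suc n) * (\<Sum>A\<in>F. 1 / real (Suc n choose card A)) = (\<Sum>A\<in>F. \<Sum>x\<in>T - A. 1 / real (n choose card A))"
      unfolding sum_distrib_left by (intro sum.cong refl weight[symmetric])
    also have "\<dots> = (\<Sum>A\<in>F. \<Sum>x | x \<in> T \<and> x \<notin> A. 1 / real (n choose card A))"
      by (intro sum.cong) auto
    also have "\<dots> = (\<Sum>x\<in>T. \<Sum>A\<in>F' x. 1 / real (n choose card A))"
      unfolding F'_def by (rule sum.swap_restrict) (use finF Suc.prems in auto)
    also have "\<dots> \<le> (\<Sum>x\<in>T. 1)" by (intro sum_mono IH)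
    also have "\<dots> = real (Suc n)" using Suc.hyps(2) by simp
    finally have "(\<Sum>A\<in>F. 1 / real (Suc n choose card A)) \<le> 1" 
      by (simp del: of_nat_Suc binomial_Suc_Suc)
    then show ?thesis using Suc.hyps(2) by simp
  qed
qed

lemma Sperner:
  assumes "finite T" "F \<subseteq> Pow T" "antichain F"
  shows "card F \<le> card T choose (card T div 2)"
proof -
  have finF: "finite F" using assms finite_subset by blast
  define b where "b = real (card T choose (card T div 2))"
  have "b > 0" by (simp add: b_def)
  have "real (card F) * (1 / b) = (\<Sum>A\<in>F. 1 / b)" by simp
  also have "\<dots> \<le> (\<Sum>A\<in>F. 1 / real (card T choose card A))"
  proof (rule sum_mono)
    fix A assume "A \<in> F"
    then have "card A \<le> card T" using assms by (auto intro: card_mono)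
    then show "1 / b \<le> 1 / real (card T choose card A)"
      unfolding b_def by (intro divide_left_mono) (auto simp: binomial_maximum)
  qed
  also have "\<dots> \<le> 1" by (rule LYM_inequality[OF assms])
  finally show ?thesis using \<open>b > 0\<close> by (simp add: b_def)
qed

text \<open>
  The Littlewood--Offord argument of Erdos for a function that need only grow between nested sets
  satisfying \<open>P\<close>: each subinterval of length \<open>w\<close> catches an antichain. In the application \<open>P\<close> includes a
  condition that holds for typical sets only, so monotonicity on the whole cube is not available.
\<close>

lemma pr_window_le:
  fixes \<phi> :: "'a set \<Rightarrow> real"
  assumes T: "finite T" "T \<noteq> {}" and w: "w > 0" "r \<ge> 0"
    and gap: "\<And>Z Z'. Z' \<subseteq> T \<Longrightarrow> Z \<subset> Z' \<Longrightarrow> P Z \<Longrightarrow> P Z' \<Longrightarrow> \<phi> Z + w \<le> \<phi> Z'"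
    and win: "\<And>Z. Z \<subseteq> T \<Longrightarrow> P Z \<Longrightarrow> y \<le> \<phi> Z \<and> \<phi> Z \<le> y + r * w"
  shows "pr T P \<le> (r + 1) / sqrt (card T)"
proof -
  define F where "F k = {Z. Z \<subseteq> T \<and> P Z \<and> \<lfloor>(\<phi> Z - y) / w\<rfloor> = int k}" for k :: nat
  have FT: "F k \<subseteq> Pow T" for k by (auto simp: F_def)
  have ac: "antichain (F k)" for k unfolding antichain_def
  proof (intro ballI impI)
    fix A B assume AB: "A \<in> F k" "B \<in> F k" "A \<subseteq> B"
    show "A = B"
    proof (rule ccontr)
      assume "A \<noteq> B"
      then have "\<phi> A + w \<le> \<phi> B" using AB by (intro gap) (auto simp: F_def)
      then have "((\<phi> A - y) + w) / w \<le> (\<phi> B - y) / w" using w by (intro divide_right_mono) auto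
      moreover have "((\<phi> A - y) + w) / w = (\<phi> A - y) / w + 1" using w by (simp only: add_divide_distrib) simp
      ultimately have "(\<phi> A - y) / w + 1 \<le> (\<phi> B - y) / w" by linarith
      then have "\<lfloor>(\<phi> A - y) / w\<rfloor> + 1 \<le> \<lfloor>(\<phi> B - y) / w\<rfloor>" by linarith
      then show False using AB by (auto simp: F_def)
    qed
  qed
  have cF: "real (card (F k)) \<le> 2 ^ card T / sqrt (card T)" for k
  proof -
    have "real (card (F k)) \<le> real (card T choose (card T div 2))"
      using Sperner[OF T(1) FT ac] by simp
    also have "\<dots> \<le> 2 ^ card T / sqrt (card T)"
      using T by (intro binomial_le_2_power_div_sqrt) (simp add: card_gt_0_iff)
    finally show ?thesis .
  qed
  define K where "K = nat \<lfloor>r\<rfloor>"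
  have "{Z. Z \<subseteq> T \<and> P Z} \<subseteq> (\<Union>k\<in>{..K}. F k)"
  proof
    fix Z assume Z: "Z \<in> {Z. Z \<subseteq> T \<and> P Z}"
    then have b: "0 \<le> (\<phi> Z - y) / w" "(\<phi> Z - y) / w \<le> r" using win[of Z] w by (auto simp: field_simps)
    then have "0 \<le> \<lfloor>(\<phi> Z - y) / w\<rfloor>" "\<lfloor>(\<phi> Z - y) / w\<rfloor> \<le> \<lfloor>r\<rfloor>" by (auto intro: floor_mono)
    then have "Z \<in> F (nat \<lfloor>(\<phi> Z - y) / w\<rfloor>)" "nat \<lfloor>(\<phi> Z - y) / w\<rfloor> \<le> K"
      using Z by (auto simp: F_def K_def)
    then show "Z \<in> (\<Union>k\<in>{..K}. F k)" by blast
  qed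
  moreover have "finite (\<Union>k\<in>{..K}. F k)" 
    using T by (intro finite_UN_I) (auto intro: finite_subset[OF FT])
  ultimately have "card {Z. Z \<subseteq> T \<and> P Z} \<le> card (\<Union>k\<in>{..K}. F k)" by (rule card_mono[rotated])
  also have "\<dots> \<le> (\<Sum>k\<le>K. card (F k))" by (rule card_UN_le) simp
  finally have "real (card {Z. Z \<subseteq> T \<and> P Z}) \<le> (\<Sum>k\<le>K. real (card (F k)))"
    by (metis of_nat_le_iff of_nat_sum)
  also have "\<dots> \<le> real (card {..K}) * (2 ^ card T / sqrt (card T))"
    by (rule sum_bounded_above) (use cF in auto)
  also have "\<dots> \<le> (r + 1) * (2 ^ card T / sqrt (card T))"
    using w by (intro mult_right_mono) (auto simp: K_def)
  finally have le: "real (card {Z. Z \<subseteq> T \<and> P Z}) \<le> (r + 1) * (2 ^ card T / sqrt (card T))" .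
  have "pr T P \<le> (r + 1) * (2 ^ card T / sqrt (card T)) / 2 ^ card T"
    unfolding pr_card[OF T(1)] by (intro divide_right_mono le) simp
  then show ?thesis by simp
qed

section \<open>Several linear equations at once\<close>

definition dot :: "nat \<Rightarrow> (nat \<Rightarrow> real) \<Rightarrow> (nat \<Rightarrow> real) \<Rightarrow> real" where
  "dot d l w = (\<Sum>u<d. l u * w u)"

text \<open>
  Gaussian elimination, by induction on the number of equations: an unknown \<open>v\<close> with \<open>w v \<noteq> 0\<close> is
  eliminated from the other equations.
\<close>

lemma nontrivial_solution:
  fixes ws :: "('b \<Rightarrow> real) list"
  assumes "finite J" "length ws < card J"
  shows "\<exists>l. (\<exists>u\<in>J. l u \<noteq> 0) \<and> (\<forall>w\<in>set ws. (\<Sum>u\<in>J. l u * w u) = 0)"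
  using assms
proof (induction "length ws" arbitrary: ws J)
  case 0
  then have "ws = []" "J \<noteq> {}" by auto
  then show ?case by (intro exI[of _ "\<lambda>_. 1"]) auto
next
  case (Suc n)
  then obtain w ws' where ws: "ws = w # ws'" by (cases ws) auto
  show ?case
  proof (cases "\<exists>u\<in>J. w u \<noteq> 0")
    case False
    have "\<exists>l. (\<exists>u\<in>J. l u \<noteq> 0) \<and> (\<forall>w\<in>set ws'. (\<Sum>u\<in>J. l u * w u) = 0)"
      using Suc.prems Suc.hyps(2) ws by (intro Suc.hyps(1)) auto
    moreover have "(\<Sum>u\<in>J. l u * w u) = 0" for l using False by (intro sum.neutral) auto
    ultimately show ?thesis unfolding ws by (simp only: list.set insert_iff ball_simps simp_thms Set.ball_simps(7))
  next
    case True
    then obtain v where v: "v \<in> J" "w v \<noteq> 0" by auto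
    \<comment> \<open>Subtracting a multiple of the equation \<open>w\<close> removes the unknown \<open>v\<close>.\<close>
    define red where "red x = (\<lambda>u. x u - x v / w v * w u)" for x
    have "\<exists>l. (\<exists>u\<in>J - {v}. l u \<noteq> 0) \<and> (\<forall>x\<in>set (map red ws'). (\<Sum>u\<in>J - {v}. l u * x u) = 0)"
      using Suc.prems Suc.hyps(2) ws v by (intro Suc.hyps(1)) auto
    then obtain l where l: "\<exists>u\<in>J - {v}. l u \<noteq> 0"
      and l0': "\<forall>x\<in>set (map red ws'). (\<Sum>u\<in>J - {v}. l u * x u) = 0" by blast
    have l0: "(\<Sum>u\<in>J - {v}. l u * red x u) = 0" if "x \<in> set ws'" for x
      using l0'[rule_format, of "red x"] that by simp
    define s where "s = (\<Sum>u\<in>J - {v}. l u * w u)"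
    define l' where "l' = l(v := - s / w v)"
    have sum': "(\<Sum>u\<in>J. l' u * x u) = - s / w v * x v + (\<Sum>u\<in>J - {v}. l u * x u)" for x
    proof -
      have "(\<Sum>u\<in>J. l' u * x u) = l' v * x v + (\<Sum>u\<in>J - {v}. l' u * x u)"
        using v Suc.prems by (simp add: sum.remove)
      also have "(\<Sum>u\<in>J - {v}. l' u * x u) = (\<Sum>u\<in>J - {v}. l u * x u)"
        by (intro sum.cong) (auto simp: l'_def)
      finally show ?thesis by (simp add: l'_def)
    qed
    have "(\<Sum>u\<in>J. l' u * x u) = 0" if "x \<in> set ws'" for x
    proof -
      have "0 = (\<Sum>u\<in>J - {v}. l u * x u) - x v / w v * s"
        using l0[OF that] unfolding red_def s_def
        by (simp add: algebra_simps sum_subtractf sum_distrib_left)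
      then show ?thesis by (simp add: sum')
    qed
    moreover have "(\<Sum>u\<in>J. l' u * w u) = 0" using v by (simp add: sum' s_def)
    moreover have "\<exists>u\<in>J. l' u \<noteq> 0" using l by (auto simp: l'_def)
    ultimately show ?thesis using ws by (intro exI[of _ l']) auto
  qed
qed

text \<open>
  A fixed choice of the functional makes it depend on \<open>ws\<close> only. Later, only finitely many such
  functionals arise, which allows a union bound over them.
\<close>

definition annihilator :: "nat \<Rightarrow> (nat \<Rightarrow> real) list \<Rightarrow> nat \<Rightarrow> real" where
  "annihilator d ws = (SOME l. (\<exists>u<d. l u \<noteq> 0) \<and> (\<forall>w\<in>set ws. dot d l w = 0))"

lemma annihilator:
  assumes "length ws < d"
  shows "\<exists>u<d. annihilator d ws u \<noteq> 0" "\<And>w. w \<in> set ws \<Longrightarrow> dot d (annihilator d ws) w = 0"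
proof -
  have "\<exists>l. (\<exists>u<d. l u \<noteq> 0) \<and> (\<forall>w\<in>set ws. dot d l w = 0)"
    using nontrivial_solution[of "{..<d}" ws] assms by (auto simp: dot_def)
  then have "(\<exists>u<d. annihilator d ws u \<noteq> 0) \<and> (\<forall>w\<in>set ws. dot d (annihilator d ws) w = 0)"
    unfolding annihilator_def by (rule someI_ex)
  then show "\<exists>u<d. annihilator d ws u \<noteq> 0" "\<And>w. w \<in> set ws \<Longrightarrow> dot d (annihilator d ws) w = 0" by auto
qed

lemma dot_sum: "dot d l (\<lambda>u. \<Sum>i\<in>I. v i u) = (\<Sum>i\<in>I. dot d l (v i))"
  unfolding dot_def by (simp add: sum_distrib_left) (rule sum.swap)

lemma dot_cong: "(\<And>u. u < d \<Longrightarrow> l u = l' u) \<Longrightarrow> (\<And>u. u < d \<Longrightarrow> w u = w' u) \<Longrightarrow> dot d l w = dot d l' w'"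
  unfolding dot_def by (auto intro!: sum.cong)

text \<open>
  Greedily, one picks values \<open>w\<close> of \<open>v\<close>, each taken at least \<open>M / T\<close> times and not killed by some functional
  that kills the values picked before. If the indices outside the picked classes are revealed first,
  followed by the classes in reverse order, then each functional in turn determines the number of
  chosen elements of one class; this number takes a given value with probability at most \<open>sqrt (T / M)\<close>.
  The functionals used are of the form \<open>annihilator d ws\<close> with \<open>ws\<close> a list of values of \<open>v\<close>, so the
  hypothesis concerns finitely many functionals.
\<close>

lemma joint_point_prob:
  fixes v :: "'a \<Rightarrow> nat \<Rightarrow> real" and M T :: real
  assumes S: "finite S" and T: "real (card (v ` S)) \<le> T" and M: "M > 0"
    and rob: "\<And>ws. set ws \<subseteq> v ` S \<Longrightarrow> length ws < d \<Longrightarrow> M \<le> card {i\<in>S. dot d (annihilator d ws) (v i) \<noteq> 0}"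
  shows "pr S (\<lambda>U. \<forall>u<d. (\<Sum>i\<in>U. v i u) = y u) \<le> sqrt (T / M) ^ d"
proof -
  define P where "P U \<longleftrightarrow> (\<forall>u<d. (\<Sum>i\<in>U. v i u) = y u)" for U
  \<comment> \<open>The classes picked so far; the event on the rest only asks for some completion on them.\<close>
  define cl where "cl ws = {i\<in>S. v i \<in> set ws}" for ws
  have "\<exists>ws. length ws = t \<and> set ws \<subseteq> v ` S \<and>
    pr S P \<le> sqrt (T / M) ^ t * pr (S - cl ws) (\<lambda>X. \<exists>Y\<subseteq>cl ws. P (X \<union> Y))" if "t \<le> d" for t
    using that
  proof (induction t)
    case 0
    have "pr S P = pr (S - cl []) (\<lambda>X. \<exists>Y\<subseteq>cl []. P (X \<union> Y))"
      by (simp add: cl_def)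
    then show ?case by (intro exI[of _ "[]"]) auto
  next
    case (Suc t)
    from Suc.IH[OF Suc_leD[OF Suc.prems]]
    obtain ws where ws: "length ws = t" "set ws \<subseteq> v ` S"
      and le: "pr S P \<le> sqrt (T / M) ^ t * pr (S - cl ws) (\<lambda>X. \<exists>Y\<subseteq>cl ws. P (X \<union> Y))" by blast
    define l where "l = annihilator d ws"
    define S' where "S' = {i\<in>S. dot d l (v i) \<noteq> 0}"
    have M': "M \<le> card S'" unfolding S'_def l_def using ws Suc.prems by (intro rob) auto
    then have ne: "S' \<noteq> {}" using M by auto
    have finS': "finite S'" using S by (simp add: S'_def)
    obtain w where w: "w \<in> v ` S'" "M / T \<le> card {i\<in>S. v i = w}"
    proof (rule ccontr)
      assume "\<not> thesis"
      then have small: "card {i\<in>S. v i = w} < M / T" if "w \<in> v ` S'" for w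
        using \<open>\<And>w. w \<in> v ` S' \<Longrightarrow> M / T \<le> card {i\<in>S. v i = w} \<Longrightarrow> thesis\<close>[OF that]
        by (meson not_le)
      have "real (card S') \<le> (\<Sum>w\<in>v ` S'. real (card {i\<in>S. v i = w}))"
      proof -
        have "card S' \<le> card (\<Union>w\<in>v ` S'. {i\<in>S. v i = w})"
          using S by (intro card_mono) (auto simp: S'_def)
        also have "\<dots> \<le> (\<Sum>w\<in>v ` S'. card {i\<in>S. v i = w})" using finS' by (intro card_UN_le) auto
        finally show ?thesis by (metis of_nat_le_iff of_nat_sum)
      qed
      also have "\<dots> < (\<Sum>w\<in>v ` S'. M / T)" 
        using small ne finS' by (intro sum_strict_mono) auto
      also have "\<dots> = card (v ` S') * (M / T)" by simp
      also have "\<dots> \<le> T * (M / T)"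
      proof (intro mult_right_mono)
        have "card (v ` S') \<le> card (v ` S)" using S by (intro card_mono) (auto simp: S'_def)
        then show "real (card (v ` S')) \<le> T" using T by linarith
        show "0 \<le> M / T" using M T by (smt (verit) divide_nonneg_nonneg of_nat_0_le_iff)
      qed
      also have "\<dots> \<le> M" using M by (cases "T = 0") auto
      finally show False using M' by simp
    qed
    define S1 where "S1 = {i\<in>S. v i = w}"
    have wnz: "dot d l w \<noteq> 0" using w(1) by (auto simp: S'_def)
    have wws: "dot d l x = 0" if "x \<in> set ws" for x
      unfolding l_def using that ws Suc.prems by (intro annihilator) auto
    have disj: "S1 \<inter> cl ws = {}" using wnz wws by (auto simp: S1_def cl_def)
    have cl': "cl (w # ws) = cl ws \<union> S1" by (auto simp: cl_def S1_def)
    have split: "S - cl ws = (S - cl (w # ws)) \<union> S1" using disj by (auto simp: cl' S1_def)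
    have finS1: "finite S1" using S by (simp add: S1_def)
    have S1ne: "S1 \<noteq> {}" using w(1) by (auto simp: S1_def S'_def)
    have Tpos: "T > 0"
    proof -
      have "v ` S \<noteq> {}" using S1ne by (auto simp: S1_def)
      then have "card (v ` S) > 0" using S by (simp add: card_gt_0_iff)
      then show ?thesis using T by linarith
    qed
    have step: "pr S1 (\<lambda>Z. \<exists>Y\<subseteq>cl ws. P ((X \<union> Z) \<union> Y)) \<le> sqrt (T / M) * of_bool (\<exists>Y\<subseteq>cl (w # ws). P (X \<union> Y))"
      if X: "X \<subseteq> S - cl (w # ws)" for X
    proof (cases "\<exists>Z\<subseteq>S1. \<exists>Y\<subseteq>cl ws. P ((X \<union> Z) \<union> Y)")
      case False
      then have "pr S1 (\<lambda>Z. \<exists>Y\<subseteq>cl ws. P ((X \<union> Z) \<union> Y)) = pr S1 (\<lambda>_. False)"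
        by (intro pr_cong) auto
      also have "\<dots> = 0" by (simp add: pr_def finS1)
      finally show ?thesis using M Tpos by simp
    next
      case True
      then obtain Z Y where ZY: "Z \<subseteq> S1" "Y \<subseteq> cl ws" "P ((X \<union> Z) \<union> Y)" by auto
      have "P (X \<union> (Z \<union> Y))" "Z \<union> Y \<subseteq> cl (w # ws)" using ZY by (auto simp: Un_assoc cl')
      then have one: "\<exists>Y\<subseteq>cl (w # ws). P (X \<union> Y)" by blast
      have val: "dot d l y = (\<Sum>i\<in>X. dot d l (v i)) + card Z' * dot d l w"
        if "Z' \<subseteq> S1" "Y' \<subseteq> cl ws" "P ((X \<union> Z') \<union> Y')" for Z' Y'
      proof -
        have fin: "finite X" "finite Z'" "finite Y'"
          using that X S by (auto intro: finite_subset simp: cl_def S1_def)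
        have "dot d l y = dot d l (\<lambda>u. \<Sum>i\<in>(X \<union> Z') \<union> Y'. v i u)"
          using that(3) by (intro dot_cong) (auto simp: P_def)
        also have "\<dots> = (\<Sum>i\<in>(X \<union> Z') \<union> Y'. dot d l (v i))" by (rule dot_sum)
        also have "\<dots> = (\<Sum>i\<in>X. dot d l (v i)) + (\<Sum>i\<in>Z'. dot d l (v i)) + (\<Sum>i\<in>Y'. dot d l (v i))"
        proof -
          have "X \<inter> Z' = {}" "(X \<union> Z') \<inter> Y' = {}" using X that disj by (auto simp: cl')
          then show ?thesis using fin by (simp add: sum.union_disjoint)
        qed
        also have "(\<Sum>i\<in>Y'. dot d l (v i)) = 0" using that wws by (intro sum.neutral) (auto simp: cl_def)
        also have "(\<Sum>i\<in>Z'. dot d l (v i)) = (\<Sum>i\<in>Z'. dot d l w)"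
          using that by (intro sum.cong) (auto simp: S1_def)
        finally show ?thesis by simp
      qed
      have "pr S1 (\<lambda>Z. \<exists>Y\<subseteq>cl ws. P ((X \<union> Z) \<union> Y)) \<le> pr S1 (\<lambda>Z'. card Z' = card Z)"
        using val val[OF ZY] wnz by (intro pr_mono) auto
      also have "\<dots> \<le> 1 / sqrt (card S1)" by (rule pr_card_eq[OF finS1 S1ne])
      also have "\<dots> \<le> 1 / sqrt (M / T)"
      proof -
        have "real (card S1) > 0" using finS1 S1ne by (simp add: card_gt_0_iff)
        then show ?thesis
          using w(2) M Tpos by (intro divide_left_mono) (auto simp: S1_def intro!: mult_pos_pos)
      qed
      also have "\<dots> = sqrt (T / M)" by (simp add: real_sqrt_divide)
      finally show ?thesis using one by simp
    qed
    have "pr (S - cl ws) (\<lambda>X. \<exists>Y\<subseteq>cl ws. P (X \<union> Y)) 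
        \<le> sqrt (T / M) * pr (S - cl (w # ws)) (\<lambda>X. \<exists>Y\<subseteq>cl (w # ws). P (X \<union> Y))"
      unfolding split using S step by (intro pr_Un_le) (auto simp: cl' S1_def)
    then have "sqrt (T / M) ^ t * pr (S - cl ws) (\<lambda>X. \<exists>Y\<subseteq>cl ws. P (X \<union> Y)) 
        \<le> sqrt (T / M) ^ t * (sqrt (T / M) * pr (S - cl (w # ws)) (\<lambda>X. \<exists>Y\<subseteq>cl (w # ws). P (X \<union> Y)))"
      using M Tpos by (intro mult_left_mono) auto
    then show ?case using le ws w(1)
      by (intro exI[of _ "w # ws"]) (auto simp: S'_def mult_ac)
  qed
  from this[of d] obtain ws where
    "pr S P \<le> sqrt (T / M) ^ d * pr (S - cl ws) (\<lambda>X. \<exists>Y\<subseteq>cl ws. P (X \<union> Y))" by blast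
  also have "\<dots> \<le> sqrt (T / M) ^ d * 1"
    using S M T by (intro mult_left_mono pr_le_1) (auto intro!: divide_nonneg_nonneg order_trans[OF _ T])
  finally show ?thesis by (simp add: P_def[abs_def])
qed

section \<open>Robustly independent rows of an adjacency matrix\<close>

lemma pigeonhole_fibre:
  assumes "finite A" "finite B" "f ` A \<subseteq> B" "B \<noteq> {}"
  shows "\<exists>y\<in>B. real (card A) \<le> real (card B) * real (card {x\<in>A. f x = y})"
proof (rule ccontr)
  assume "\<not> ?thesis"
  then have less: "real (card B) * real (card {x\<in>A. f x = y}) < real (card A)" if "y \<in> B" for y
    using that by force
  have "card A \<le> card (\<Union>y\<in>B. {x\<in>A. f x = y})" using assms by (intro card_mono) auto
  also have "\<dots> \<le> (\<Sum>y\<in>B. card {x\<in>A. f x = y})" using assms by (intro card_UN_le)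
  finally have "real (card A) \<le> (\<Sum>y\<in>B. real (card {x\<in>A. f x = y}))"
    by (metis of_nat_le_iff of_nat_sum)
  then have "real (card B) * real (card A) \<le> (\<Sum>y\<in>B. real (card B) * real (card {x\<in>A. f x = y}))"
    by (simp add: mult_left_mono flip: sum_distrib_left)
  also have "\<dots> < (\<Sum>y\<in>B. real (card A))" using less assms by (intro sum_strict_mono)
  finally show False by simp
qed

text \<open>
  Turan's bound by the greedy algorithm: pick a vertex and discard its neighbours.
\<close>

lemma greedy_independent:
  assumes "finite Q" and sym: "\<And>i j. R i j \<Longrightarrow> R j i"
    and deg: "\<And>i. i \<in> Q \<Longrightarrow> real (card {j\<in>Q. j \<noteq> i \<and> R i j}) \<le> M"
  shows "\<exists>U\<subseteq>Q. (\<forall>i\<in>U. \<forall>j\<in>U. i \<noteq> j \<longrightarrow> \<not> R i j) \<and> real (card Q) \<le> real (card U) * (M + 1)"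
  using assms(1) deg
proof (induction "card Q" arbitrary: Q rule: less_induct)
  case less
  show ?case
  proof (cases "Q = {}")
    case False
    then obtain i where i: "i \<in> Q" by auto
    define D where "D = {j\<in>Q. j \<noteq> i \<and> R i j}"
    define Q' where "Q' = Q - insert i D"
    have fin: "finite D" "finite Q'" using less.prems by (auto simp: D_def Q'_def)
    have "\<exists>U\<subseteq>Q'. (\<forall>i\<in>U. \<forall>j\<in>U. i \<noteq> j \<longrightarrow> \<not> R i j) \<and> real (card Q') \<le> real (card U) * (M + 1)"
    proof (rule less.hyps)
      show "card Q' < card Q" unfolding Q'_def using i less.prems(1) by (intro psubset_card_mono) auto
      show "finite Q'" by fact
      fix k assume k: "k \<in> Q'"
      then have "card {j\<in>Q'. j \<noteq> k \<and> R k j} \<le> card {j\<in>Q. j \<noteq> k \<and> R k j}"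
        using less.prems(1) by (intro card_mono) (auto simp: Q'_def)
      then show "real (card {j\<in>Q'. j \<noteq> k \<and> R k j}) \<le> M"
        using less.prems(2)[of k] k by (auto simp: Q'_def)
    qed
    then obtain U where U: "U \<subseteq> Q'" "\<forall>i\<in>U. \<forall>j\<in>U. i \<noteq> j \<longrightarrow> \<not> R i j"
      "real (card Q') \<le> real (card U) * (M + 1)" by auto
    have "Q = Q' \<union> insert i D" using i by (auto simp: Q'_def D_def)
    moreover have "card (Q' \<union> insert i D) = card Q' + card (insert i D)"
      using fin by (intro card_Un_disjoint) (auto simp: Q'_def)
    ultimately have "card Q = card Q' + card (insert i D)" by simp
    moreover have "card (insert i D) = Suc (card D)" using fin by (simp add: D_def)
    moreover have "real (card D) \<le> M" using less.prems(2)[OF i] by (simp add: D_def)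
    moreover have "card (insert i U) = Suc (card U)"
    proof -
      have "i \<notin> U" using U(1) by (auto simp: Q'_def)
      then show ?thesis using finite_subset[OF U(1) fin(2)] by simp
    qed
    ultimately have "real (card Q) \<le> real (card (insert i U)) * (M + 1)"
      using U(3) by (simp add: algebra_simps)
    moreover have "\<forall>x\<in>insert i U. \<forall>y\<in>insert i U. x \<noteq> y \<longrightarrow> \<not> R x y"
    proof (intro ballI impI)
      fix x y assume xy: "x \<in> insert i U" "y \<in> insert i U" "x \<noteq> y"
      have iU: "\<not> R i u" if "u \<in> U" for u using that U(1) by (auto simp: Q'_def D_def)
      show "\<not> R x y" using xy iU U(2) sym by (metis insertE)
    qed
    moreover have "insert i U \<subseteq> Q" using U i by (auto simp: Q'_def)
    ultimately show ?thesis by blast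
  qed auto
qed

locale adjacency =
  fixes a :: "'a \<Rightarrow> 'a \<Rightarrow> real"
  assumes sym: "a i j = a j i" and irrefl: "a i i = 0" and zero_one: "a i j = 0 \<or> a i j = 1"
begin

definition homogeneous :: "'a set \<Rightarrow> bool" where
  "homogeneous U \<longleftrightarrow> (\<exists>c. \<forall>i\<in>U. \<forall>j\<in>U. i \<noteq> j \<longrightarrow> a i j = c)"

text \<open>
  Linear independence of the rows \<open>xs\<close> that survives the deletion of fewer than \<open>M\<close> of the columns \<open>S\<close>.
\<close>

definition robust :: "real \<Rightarrow> 'a list \<Rightarrow> 'a set \<Rightarrow> bool" where
  "robust M xs S \<longleftrightarrow> (\<forall>l. (\<exists>u<length xs. l u \<noteq> 0) \<longrightarrow>
     M \<le> card {j\<in>S. dot (length xs) l (\<lambda>u. a (xs ! u) j) \<noteq> 0})"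

text \<open>
  Any combination of the rows \<open>xs\<close> is constant on the columns with a given trace, and there are at most
  \<open>2 ^ length xs\<close> traces.
\<close>

definition trace :: "'a list \<Rightarrow> 'a \<Rightarrow> nat set" where
  "trace xs j = {u. u < length xs \<and> a (xs ! u) j = 1}"

lemma trace_subset: "trace xs j \<subseteq> {..<length xs}"
  by (auto simp: trace_def)

lemma dot_trace: "dot (length xs) l (\<lambda>u. a (xs ! u) j) = (\<Sum>u\<in>trace xs j. l u)"
proof -
  have "dot (length xs) l (\<lambda>u. a (xs ! u) j) = (\<Sum>u<length xs. if u \<in> trace xs j then l u else 0)"
    unfolding dot_def using zero_one by (intro sum.cong) (auto simp: trace_def)
  also have "\<dots> = (\<Sum>u\<in>{..<length xs} \<inter> trace xs j. l u)" by (simp add: sum.inter_restrict)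
  also have "{..<length xs} \<inter> trace xs j = trace xs j" using trace_subset by blast
  finally show ?thesis .
qed

text \<open>
  If \<open>xs @ [i]\<close> is never robust, then up to \<open>M\<close> errors each row \<open>i\<close> is a combination of the rows \<open>xs\<close>,
  hence a function of the trace of the column. Rounding this function to the values 0 and 1 leaves at
  most \<open>2 ^ 2 ^ s\<close> possibilities. Consider a class of vertices \<open>i\<close> with the same function and the same
  trace: either all of them are adjacent to almost all others of the class, or all of them to almost
  none. The greedy bound then produces a homogeneous set of size \<open>h\<close>.
\<close>

lemma extend_robust:
  assumes V: "finite V" "P \<subseteq> V" and M: "M \<ge> 0"
    and rob: "robust M xs V" and xs: "length xs < s"
    and hom: "\<And>U. U \<subseteq> V \<Longrightarrow> homogeneous U \<Longrightarrow> real (card U) < h"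
    and big: "h * (M + 1) * (2 ^ s * 2 ^ 2 ^ s) \<le> real (card (P - set xs))" and h: "h > 0"
  shows "\<exists>i\<in>P - set xs. robust M (xs @ [i]) V"
proof (rule ccontr)
  assume neg: "\<not> ?thesis"
  define t where "t = length xs"
  define P' where "P' = P - set xs"
  have finP': "finite P'" using V by (auto simp: P'_def intro: finite_subset)
  have dot_app: "dot (Suc t) l (\<lambda>u. a ((xs @ [i]) ! u) j) = dot t l (\<lambda>u. a (xs ! u) j) + l t * a i j" for l i j
  proof -
    have "(\<Sum>u<t. l u * a ((xs @ [i]) ! u) j) = (\<Sum>u<t. l u * a (xs ! u) j)"
      by (intro sum.cong) (auto simp: nth_append t_def)
    then show ?thesis by (simp add: dot_def t_def)
  qed
  have "\<exists>l. (\<exists>u<Suc t. l u \<noteq> 0) \<and> real (card {j\<in>V. dot (Suc t) l (\<lambda>u. a ((xs @ [i]) ! u) j) \<noteq> 0}) < M"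
    if "i \<in> P'" for i
  proof -
    have "\<not> robust M (xs @ [i]) V" using neg that unfolding P'_def by blast
    moreover have "length (xs @ [i]) = Suc t" by (simp add: t_def)
    ultimately show ?thesis unfolding robust_def by (simp only: not_all not_imp not_le)
  qed
  then have "\<forall>i\<in>P'. \<exists>l. (\<exists>u<Suc t. l u \<noteq> 0) \<and> 
      real (card {j\<in>V. dot t l (\<lambda>u. a (xs ! u) j) + l t * a i j \<noteq> 0}) < M"
    unfolding dot_app by blast
  from bchoice[OF this] obtain l where l: "\<forall>i\<in>P'. (\<exists>u<Suc t. l i u \<noteq> 0) \<and> 
      real (card {j\<in>V. dot t (l i) (\<lambda>u. a (xs ! u) j) + l i t * a i j \<noteq> 0}) < M" ..
  have lnz: "\<exists>u<Suc t. l i u \<noteq> 0" if "i \<in> P'" for i using l that by blast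
  have lM: "real (card {j\<in>V. dot t (l i) (\<lambda>u. a (xs ! u) j) + l i t * a i j \<noteq> 0}) < M" if "i \<in> P'" for i
    using l that by blast
  have lt: "l i t \<noteq> 0" if "i \<in> P'" for i
  proof
    assume 0: "l i t = 0"
    then have "\<exists>u<t. l i u \<noteq> 0" using lnz[OF that] less_Suc_eq by auto
    then have "M \<le> card {j\<in>V. dot t (l i) (\<lambda>u. a (xs ! u) j) \<noteq> 0}"
      using rob unfolding robust_def t_def by blast
    then show False using lM[OF that] 0 by simp
  qed
  \<comment> \<open>The rounded functions of the trace, coded by the set where they equal \<open>1\<close>. Where the unrounded
  function is neither \<open>0\<close> nor \<open>1\<close>, it already differs from the row, so rounding adds no errors.\<close>
  define g where "g i = {\<theta>\<in>Pow {..<t}. - (\<Sum>u\<in>\<theta>. l i u) / l i t = 1}" for i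
  define label where "label i = (g i, trace xs i)" for i
  define L where "L = Pow (Pow {..<t}) \<times> Pow {..<t}"
  have "finite L" "L \<noteq> {}" "label ` P' \<subseteq> L" using trace_subset by (auto simp: L_def label_def g_def t_def)
  then obtain y where y: "real (card P') \<le> real (card L) * real (card {i\<in>P'. label i = y})"
    using pigeonhole_fibre[of P' L label] finP' by auto
  define Q where "Q = {i\<in>P'. label i = y}"
  define b where "b \<longleftrightarrow> snd y \<in> fst y"
  have bad: "real (card {j\<in>Q. j \<noteq> i \<and> (a i j = 1) \<noteq> b}) \<le> M" if i: "i \<in> Q" for i
  proof -
    have i': "i \<in> P'" using i by (simp add: Q_def)
    have "{j\<in>Q. j \<noteq> i \<and> (a i j = 1) \<noteq> b} \<subseteq> {j\<in>V. dot t (l i) (\<lambda>u. a (xs ! u) j) + l i t * a i j \<noteq> 0}"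
    proof (intro subsetI CollectI conjI notI)
      fix j assume "j \<in> {j\<in>Q. j \<noteq> i \<and> (a i j = 1) \<noteq> b}"
      then have j: "j \<in> Q" "(a i j = 1) \<noteq> b" by auto
      then show "j \<in> V" using V by (auto simp: Q_def P'_def)
      assume 0: "dot t (l i) (\<lambda>u. a (xs ! u) j) + l i t * a i j = 0"
      have eq: "fst y = g i" "snd y = trace xs j" using i j by (auto simp: Q_def label_def)
      have "a i j = - (\<Sum>u\<in>trace xs j. l i u) / l i t"
        using 0 lt[OF i'] dot_trace[of xs "l i" j] unfolding t_def by (simp add: field_simps)
      then have "(a i j = 1) = b"
        using trace_subset[of xs j] by (simp add: b_def eq g_def t_def)
      then show False using j by simp
    qed
    then have "card {j\<in>Q. j \<noteq> i \<and> (a i j = 1) \<noteq> b} \<le> card {j\<in>V. dot t (l i) (\<lambda>u. a (xs ! u) j) + l i t * a i j \<noteq> 0}"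
      using V by (intro card_mono) auto
    then show ?thesis using lM[OF i'] by linarith
  qed
  have "\<exists>U\<subseteq>Q. (\<forall>i\<in>U. \<forall>j\<in>U. i \<noteq> j \<longrightarrow> \<not> ((a i j = 1) \<noteq> b)) \<and> real (card Q) \<le> real (card U) * (M + 1)"
    using finP' bad sym by (intro greedy_independent) (auto simp: Q_def)
  then obtain U where U: "U \<subseteq> Q" "\<forall>i\<in>U. \<forall>j\<in>U. i \<noteq> j \<longrightarrow> (a i j = 1) = b"
      "real (card Q) \<le> real (card U) * (M + 1)" by auto
  have "homogeneous U" unfolding homogeneous_def using U(2) zero_one
    by (intro exI[of _ "if b then 1 else 0"]) (metis (full_types))
  then have cU: "real (card U) < h" using U(1) V by (intro hom) (auto simp: Q_def P'_def)
  have "card L = 2 ^ 2 ^ t * 2 ^ t" by (simp add: L_def card_cartesian_product card_Pow)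
  also have "\<dots> \<le> 2 ^ 2 ^ s * 2 ^ s" using xs by (intro mult_mono power_increasing) (auto simp: t_def)
  finally have cL: "card L \<le> 2 ^ 2 ^ s * 2 ^ s" .
  have "real (card P') \<le> real (card L) * (real (card U) * (M + 1))"
    using y U(3) unfolding Q_def by (smt (verit, best) mult_left_mono of_nat_0_le_iff)
  also have "\<dots> \<le> real (2 ^ 2 ^ s * 2 ^ s) * (real (card U) * (M + 1))"
    using M by (intro mult_right_mono of_nat_mono[OF cL]) simp
  also have "\<dots> < real (2 ^ 2 ^ s * 2 ^ s) * (h * (M + 1))"
    using cU M by (intro mult_strict_left_mono mult_strict_right_mono) auto
  also have "\<dots> = h * (M + 1) * (2 ^ s * 2 ^ 2 ^ s)" by simp
  finally show False using big unfolding P'_def by simp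
qed

lemma exists_robust:
  assumes V: "finite V" "P \<subseteq> V" and M: "M \<ge> 0" and h: "h > 0"
    and hom: "\<And>U. U \<subseteq> V \<Longrightarrow> homogeneous U \<Longrightarrow> real (card U) < h"
    and big: "h * (M + 1) * (2 ^ s * 2 ^ 2 ^ s) + real s \<le> real (card P)"
  shows "\<exists>xs. length xs = s \<and> distinct xs \<and> set xs \<subseteq> P \<and> robust M xs V"
proof -
  have "\<exists>xs. length xs = t \<and> distinct xs \<and> set xs \<subseteq> P \<and> robust M xs V" if "t \<le> s" for t
    using that
  proof (induction t)
    case 0
    then show ?case by (intro exI[of _ "[]"]) (auto simp: robust_def)
  next
    case (Suc t)
    then obtain xs where xs: "length xs = t" "distinct xs" "set xs \<subseteq> P" "robust M xs V" by auto
    have "card (P - set xs) = card P - t"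
      using xs by (simp add: card_Diff_subset distinct_card)
    then have big': "h * (M + 1) * (2 ^ s * 2 ^ 2 ^ s) \<le> real (card (P - set xs))"
      using big Suc.prems by linarith
    have "length xs < s" using xs Suc.prems by simp
    from extend_robust[OF V M xs(4) this hom big' h]
    obtain i where "i \<in> P - set xs" "robust M (xs @ [i]) V" ..
    then show ?case using xs by (intro exI[of _ "xs @ [i]"]) auto
  qed
  then show ?thesis by blast
qed

text \<open>
  Tuples are removed one after the other as long as half of the vertices remain.
\<close>

lemma disjoint_robust_tuples:
  assumes V: "finite V" and M: "M \<ge> 0" and h: "h > 0" and s: "s > 0"
    and hom: "\<And>U. U \<subseteq> V \<Longrightarrow> homogeneous U \<Longrightarrow> real (card U) < h"
    and big: "h * (M + 1) * (2 ^ s * 2 ^ 2 ^ s) + real s \<le> real (card V) / 2"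
  shows "\<exists>F. finite F \<and> real (card V) / (2 * real s) \<le> real (card F) \<and>
     (\<forall>xs\<in>F. length xs = s \<and> distinct xs \<and> set xs \<subseteq> V \<and> robust M xs V) \<and>
     (\<forall>xs\<in>F. \<forall>ys\<in>F. xs \<noteq> ys \<longrightarrow> set xs \<inter> set ys = {})"
proof -
  have family: "\<exists>F. finite F \<and> card F = k \<and>
     (\<forall>xs\<in>F. length xs = s \<and> distinct xs \<and> set xs \<subseteq> V \<and> robust M xs V) \<and>
     (\<forall>xs\<in>F. \<forall>ys\<in>F. xs \<noteq> ys \<longrightarrow> set xs \<inter> set ys = {})"
    if "real s * (real k - 1) \<le> real (card V) / 2" for k
    using that
  proof (induction k)
    case 0
    show ?case by (intro exI[of _ "{}"]) auto
  next
    case (Suc k)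
    then have "real s * (real k - 1) \<le> real (card V) / 2"
      using s by (smt (verit) mult_left_mono of_nat_0_le_iff of_nat_Suc)
    from Suc.IH[OF this] obtain F where F: "finite F" "card F = k"
      "\<And>xs. xs \<in> F \<Longrightarrow> length xs = s \<and> distinct xs \<and> set xs \<subseteq> V \<and> robust M xs V"
      "\<And>xs ys. xs \<in> F \<Longrightarrow> ys \<in> F \<Longrightarrow> xs \<noteq> ys \<Longrightarrow> set xs \<inter> set ys = {}" by metis
    define D where "D = (\<Union>xs\<in>F. set xs)"
    have "card D \<le> (\<Sum>xs\<in>F. card (set xs))" unfolding D_def using F by (intro card_UN_le)
    also have "\<dots> = (\<Sum>xs\<in>F. s)" using F(3) by (intro sum.cong) (auto simp: distinct_card)
    finally have cD: "card D \<le> s * k" using F by (simp add: mult.commute)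
    have finD: "finite D" "D \<subseteq> V" using F by (auto simp: D_def)
    have "real (card (V - D)) = real (card V) - real (card D)"
      using finD V by (simp add: card_Diff_subset card_mono of_nat_diff)
    moreover have "real (card D) \<le> real s * real k" using cD by (metis of_nat_le_iff of_nat_mult)
    ultimately have "real (card V) / 2 \<le> real (card (V - D))" using Suc.prems by simp
    then have "h * (M + 1) * (2 ^ s * 2 ^ 2 ^ s) + real s \<le> real (card (V - D))"
      using big by linarith
    from exists_robust[OF V Diff_subset M h hom this]
    obtain xs where xs: "length xs = s" "distinct xs" "set xs \<subseteq> V - D" "robust M xs V" by blast
    have "xs \<notin> F"
    proof
      assume "xs \<in> F"
      then have "set xs \<subseteq> D" unfolding D_def by (rule UN_upper)
      with xs(3) have "set xs \<subseteq> D \<inter> (V - D)" by (simp only: Int_subset_iff simp_thms)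
      then have "set xs \<subseteq> {}" by (simp only: Diff_disjoint)
      then have "xs = []" by simp
      then show False using xs(1) s by simp
    qed
    have disj: "set xs \<inter> set ys = {}" if "ys \<in> F" for ys
      using that xs(3) by (auto simp: D_def)
    show ?case
    proof (intro exI[of _ "insert xs F"] conjI)
      show "finite (insert xs F)" "card (insert xs F) = Suc k" using F(1,2) \<open>xs \<notin> F\<close> by auto
      show "\<forall>ys\<in>insert xs F. length ys = s \<and> distinct ys \<and> set ys \<subseteq> V \<and> robust M ys V"
        using F(3) xs by blast
      show "\<forall>ys\<in>insert xs F. \<forall>zs\<in>insert xs F. ys \<noteq> zs \<longrightarrow> set ys \<inter> set zs = {}"
        using F(4) disj by (metis Int_commute insertE)
    qed
  qed
  define k where "k = Suc (nat \<lfloor>real (card V) / (2 * real s)\<rfloor>)"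
  have "real s * (real k - 1) \<le> real (card V) / 2"
  proof -
    have "real k - 1 \<le> real (card V) / (2 * real s)" by (simp add: k_def)
    then have "real s * (real k - 1) \<le> real s * (real (card V) / (2 * real s))" by (intro mult_left_mono) auto
    then show ?thesis using s by simp
  qed
  from family[OF this] obtain F where F: "finite F" "card F = k"
     "\<forall>xs\<in>F. length xs = s \<and> distinct xs \<and> set xs \<subseteq> V \<and> robust M xs V"
     "\<forall>xs\<in>F. \<forall>ys\<in>F. xs \<noteq> ys \<longrightarrow> set xs \<inter> set ys = {}" by (elim exE conjE)
  have kF: "real (card V) / (2 * real s) \<le> real (card F)" unfolding F(2) k_def by linarith
  show ?thesis
    by (rule exI[where x=F], rule conjI[OF F(1) conjI[OF kF conjI[OF F(3) F(4)]]])
qed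

lemma robust_Diff:
  fixes M M' :: real
  assumes "robust M xs V" "finite V" "D \<subseteq> V" "M' + card D \<le> M"
  shows "robust M' xs (V - D)"
  unfolding robust_def
proof (intro allI impI)
  fix l :: "nat \<Rightarrow> real" assume l: "\<exists>u<length xs. l u \<noteq> 0"
  define W where "W S = {j\<in>S. dot (length xs) l (\<lambda>u. a (xs ! u) j) \<noteq> 0}" for S
  have "M \<le> card (W V)" using assms(1)[unfolded robust_def, rule_format, OF l] unfolding W_def .
  moreover have "card (W V) \<le> card (W (V - D) \<union> D)"
    using assms finite_subset by (intro card_mono) (auto simp: W_def)
  moreover have "\<dots> \<le> card (W (V - D)) + card D" by (rule card_Un_le)
  ultimately have "M' \<le> card (W (V - D))" using assms(4) by linarith
  then show "M' \<le> card {j\<in>V - D. dot (length xs) l (\<lambda>u. a (xs ! u) j) \<noteq> 0}" by (simp add: W_def)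
qed

text \<open>
  Of the columns where a given combination is nonzero, at least a fraction \<open>2 ^ - length xs\<close> shares a
  single trace. So robustness passes to every \<open>B\<close> that meets each popular trace class often enough.
\<close>

lemma robust_sample:
  fixes m M :: real
  assumes rob: "robust M xs V" and "finite V" "B \<subseteq> V" "M > 0"
    and B: "\<And>\<theta>. \<theta> \<subseteq> {..<length xs} \<Longrightarrow> M / 2 ^ length xs \<le> card {j\<in>V. trace xs j = \<theta>} \<Longrightarrow>
               m \<le> card {j\<in>B. trace xs j = \<theta>}"
  shows "robust m xs B"
  unfolding robust_def
proof (intro allI impI)
  fix l :: "nat \<Rightarrow> real" assume l: "\<exists>u<length xs. l u \<noteq> 0"
  define W where "W S = {j\<in>S. dot (length xs) l (\<lambda>u. a (xs ! u) j) \<noteq> 0}" for S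
  have MW: "M \<le> card (W V)" using rob[unfolded robust_def, rule_format, OF l] unfolding W_def .
  have "\<exists>\<theta>\<in>Pow {..<length xs}. real (card (W V)) \<le> real (card (Pow {..<length xs})) * real (card {j\<in>W V. trace xs j = \<theta>})"
    using assms(2) trace_subset by (intro pigeonhole_fibre) (auto simp: W_def)
  then obtain \<theta> where th: "\<theta> \<subseteq> {..<length xs}"
    "real (card (W V)) \<le> 2 ^ length xs * real (card {j\<in>W V. trace xs j = \<theta>})" by (auto simp: card_Pow)
  then have 1: "M / 2 ^ length xs \<le> card {j\<in>W V. trace xs j = \<theta>}" using MW by (simp add: field_simps)
  moreover have "M / 2 ^ length xs > 0" using \<open>M > 0\<close> by simp
  ultimately have "card {j\<in>W V. trace xs j = \<theta>} > 0" by linarith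
  then obtain j0 where j0: "j0 \<in> W V" "trace xs j0 = \<theta>" by (fastforce simp: card_gt_0_iff)
  then have nz: "(\<Sum>u\<in>\<theta>. l u) \<noteq> 0" by (auto simp: W_def dot_trace)
  have "card {j\<in>W V. trace xs j = \<theta>} \<le> card {j\<in>V. trace xs j = \<theta>}"
    using assms(2) by (intro card_mono) (auto simp: W_def)
  then have "m \<le> card {j\<in>B. trace xs j = \<theta>}" using 1 th(1) by (intro B) auto
  also have "card {j\<in>B. trace xs j = \<theta>} \<le> card (W B)"
    using nz finite_subset[OF assms(3,2)] by (intro card_mono) (auto simp: W_def dot_trace)
  finally show "m \<le> card {j\<in>B. dot (length xs) l (\<lambda>u. a (xs ! u) j) \<noteq> 0}" by (simp add: W_def)
qed

end

section \<open>Sampling a small vertex set\<close>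

text \<open>
  The generating function of the size of the colour class \<open>0\<close> within \<open>S\<close> for a uniformly random
  \<open>r\<close>-colouring of \<open>V\<close>: the sum over colourings factorises over the points of \<open>V\<close>.
\<close>

lemma sum_colourings_power:
  fixes w :: real
  assumes "finite V" "S \<subseteq> V" "r > 0"
  shows "(\<Sum>g\<in>V \<rightarrow>\<^sub>E {..<r}. w ^ card {v\<in>S. g v = 0}) = real r ^ card V * (1 + (w - 1) / real r) ^ card S"
proof -
  define f where "f v c = (if v \<in> S \<and> c = 0 then w else 1)" for v and c :: nat
  have "w ^ card {v\<in>S. g v = 0} = (\<Prod>v\<in>V. f v (g v))" for g :: "'a \<Rightarrow> nat"
  proof -
    have "(\<Prod>v\<in>V. f v (g v)) = (\<Prod>v\<in>{v\<in>S. g v = 0}. f v (g v))"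
      using assms by (intro prod.mono_neutral_right) (auto simp: f_def)
    also have "\<dots> = (\<Prod>v\<in>{v\<in>S. g v = 0}. w)" by (intro prod.cong) (auto simp: f_def)
    finally show ?thesis by simp
  qed
  then have "(\<Sum>g\<in>V \<rightarrow>\<^sub>E {..<r}. w ^ card {v\<in>S. g v = 0}) = (\<Sum>g\<in>V \<rightarrow>\<^sub>E {..<r}. \<Prod>v\<in>V. f v (g v))" by simp
  also have "\<dots> = (\<Prod>v\<in>V. \<Sum>c<r. f v c)"
    using assms by (intro prod_sum_PiE[symmetric]) auto
  also have "\<dots> = (\<Prod>v\<in>V. real r * (if v \<in> S then 1 + (w - 1) / real r else 1))"
  proof (intro prod.cong refl)
    fix v assume "v \<in> V"
    have "(\<Sum>c<r. f v c) = f v 0 + (\<Sum>c\<in>{..<r} - {0}. f v c)" using assms by (intro sum.remove) auto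
    also have "(\<Sum>c\<in>{..<r} - {0}. f v c) = (\<Sum>c\<in>{..<r} - {0}. 1)" by (intro sum.cong) (auto simp: f_def)
    also have "\<dots> = real r - 1" using assms by (simp add: card_Diff_subset of_nat_diff)
    finally have "(\<Sum>c<r. f v c) = f v 0 + (real r - 1)" .
    moreover have "real r * (1 + (w - 1) / real r) = w + (real r - 1)" using assms by (simp add: field_simps)
    moreover have "f v 0 = (if v \<in> S then w else 1)" by (simp add: f_def)
    ultimately show "(\<Sum>c<r. f v c) = real r * (if v \<in> S then 1 + (w - 1) / real r else 1)" by simp
  qed
  also have "\<dots> = real r ^ card V * (\<Prod>v\<in>V. if v \<in> S then 1 + (w - 1) / real r else 1)"
    by (simp add: prod.distrib)
  also have "(\<Prod>v\<in>V. if v \<in> S then 1 + (w - 1) / real r else 1) = (1 + (w - 1) / real r) ^ card S"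
    using assms by (simp add: prod.If_cases Int_absorb1)
  finally show ?thesis .
qed

text \<open>
  The sample is one colour class of a random \<open>r\<close>-colouring. The generating function at \<open>w = 1/2\<close> bounds
  the probability of meeting some \<open>S\<close> too rarely, at \<open>w = 2\<close> that of being too large.
\<close>

lemma exists_sample:
  assumes V: "finite V" and r: "r > 0" and FS: "finite \<F>" "\<And>S. S \<in> \<F> \<Longrightarrow> S \<subseteq> V \<and> \<sigma> \<le> real (card S)"
    and lt: "real (card \<F>) * (2 ^ m * exp (- \<sigma> / (2 * real r))) + exp (real (card V) / real r) / 2 ^ \<beta> < 1"
  shows "\<exists>B\<subseteq>V. card B \<le> \<beta> \<and> (\<forall>S\<in>\<F>. m \<le> card (B \<inter> S))"
proof (rule ccontr)
  assume neg: "\<not> ?thesis"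
  define G where "G = V \<rightarrow>\<^sub>E {..<r}"
  have finG: "finite G" unfolding G_def using V by (intro finite_PiE) auto
  have cG: "real (card G) = real r ^ card V" using V by (simp add: G_def card_PiE)
  define Z where "Z S g = card {v\<in>S. g v = 0}" for S and g :: "'a \<Rightarrow> nat"
  have cover: "1 \<le> (\<Sum>S\<in>\<F>. 2 ^ m * (1/2) ^ Z S g) + 2 ^ Z V g / (2::real) ^ \<beta>" for g
  proof -
    define B where "B = {v\<in>V. g v = 0}"
    have "B \<subseteq> V" by (auto simp: B_def)
    then have "\<not> (card B \<le> \<beta> \<and> (\<forall>S\<in>\<F>. m \<le> card (B \<inter> S)))" using neg by blast
    then consider "card B > \<beta>" | S where "S \<in> \<F>" "card (B \<inter> S) < m" using not_le by blast
    then show ?thesis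
    proof cases
      case 1
      then have "(2::real) ^ \<beta> \<le> 2 ^ Z V g" by (intro power_increasing) (auto simp: B_def Z_def)
      then have "1 \<le> 2 ^ Z V g / (2::real) ^ \<beta>" by simp
      moreover have "0 \<le> (\<Sum>S\<in>\<F>. 2 ^ m * (1/2::real) ^ Z S g)" by (intro sum_nonneg) auto
      ultimately show ?thesis by linarith
    next
      case 2
      have "B \<inter> S = {v\<in>S. g v = 0}" using FS(2)[OF 2(1)] by (auto simp: B_def)
      then have "Z S g \<le> m" using 2 by (simp add: Z_def)
      then have "(2::real) ^ Z S g \<le> 2 ^ m" by (intro power_increasing) auto
      then have "1 \<le> 2 ^ m * (1/2::real) ^ Z S g" by (simp add: power_divide)
      also have "\<dots> \<le> (\<Sum>S\<in>\<F>. 2 ^ m * (1/2::real) ^ Z S g)"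
        using 2(1) FS(1) by (intro member_le_sum) auto
      finally show ?thesis by (smt (verit) divide_nonneg_nonneg zero_le_power)
    qed
  qed
  have "real (card G) \<le> (\<Sum>g\<in>G. (\<Sum>S\<in>\<F>. 2 ^ m * (1/2) ^ Z S g) + 2 ^ Z V g / (2::real) ^ \<beta>)"
    using sum_mono[of G "\<lambda>_. 1", OF cover] by simp
  also have "\<dots> = (\<Sum>S\<in>\<F>. 2 ^ m * (\<Sum>g\<in>G. (1/2) ^ Z S g)) + (\<Sum>g\<in>G. 2 ^ Z V g) / (2::real) ^ \<beta>"
    unfolding sum.distrib sum_distrib_left sum_divide_distrib by (subst sum.swap) simp
  also have "\<dots> \<le> (\<Sum>S\<in>\<F>. 2 ^ m * (real (card G) * exp (- \<sigma> / (2 * real r)))) + real (card G) * exp (real (card V) / real r) / 2 ^ \<beta>"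
  proof (intro add_mono sum_mono mult_left_mono divide_right_mono)
    fix S assume S: "S \<in> \<F>"
    have "(\<Sum>g\<in>G. (1/2) ^ Z S g) = real (card G) * (1 + (1/2 - 1) / real r) ^ card S"
      unfolding G_def Z_def cG[unfolded G_def] using FS(2)[OF S] V r by (intro sum_colourings_power) auto
    also have "\<dots> \<le> real (card G) * exp (- \<sigma> / (2 * real r))"
    proof (intro mult_left_mono)
      have r1: "real r \<ge> 1" using r by simp
      have "(1 + (1/2 - 1) / real r) ^ card S \<le> exp ((1/2 - 1) / real r) ^ card S"
        using r1 by (intro power_mono exp_ge_add_one_self) (auto simp: field_simps)
      also have "\<dots> = exp (real (card S) * ((1/2 - 1) / real r))" by (simp only: exp_of_nat_mult)
      also have "\<dots> \<le> exp (- \<sigma> / (2 * real r))"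
        using FS(2)[OF S] r1 by (simp add: field_simps)
      finally show "(1 + (1/2 - 1) / real r) ^ card S \<le> exp (- \<sigma> / (2 * real r))" .
    qed auto
    finally show "(\<Sum>g\<in>G. (1/2) ^ Z S g) \<le> real (card G) * exp (- \<sigma> / (2 * real r))" .
  next
    have "(\<Sum>g\<in>G. 2 ^ Z V g) = real (card G) * (1 + (2 - 1) / real r) ^ card V"
      unfolding G_def Z_def cG[unfolded G_def] using V r by (intro sum_colourings_power) auto
    also have "\<dots> \<le> real (card G) * exp (real (card V) / real r)"
    proof (intro mult_left_mono)
      have "(1 + (2 - 1) / real r) ^ card V \<le> exp ((2 - 1) / real r) ^ card V"
        by (intro power_mono exp_ge_add_one_self) auto
      then show "(1 + (2 - 1) / real r) ^ card V \<le> exp (real (card V) / real r)"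
        by (simp flip: exp_of_nat_mult)
    qed auto
    finally show "(\<Sum>g\<in>G. 2 ^ Z V g) \<le> real (card G) * exp (real (card V) / real r)" .
  qed auto
  also have "\<dots> = real (card G) * (real (card \<F>) * (2 ^ m * exp (- \<sigma> / (2 * real r))) + exp (real (card V) / real r) / 2 ^ \<beta>)"
    by (simp add: algebra_simps)
  also have "\<dots> < real (card G) * 1"
    using lt r cG by (intro mult_strict_left_mono) auto
  finally show False by simp
qed

section \<open>Anticoncentration in short intervals\<close>

lemma card_Ints_interval:
  fixes e L :: real
  assumes "L \<ge> 0"
  shows "finite {y\<in>\<int>. \<bar>y + e\<bar> \<le> L}" "real (card {y\<in>\<int>. \<bar>y + e\<bar> \<le> L}) \<le> 2 * L + 1"
proof -
  have sub: "{y\<in>\<int>. \<bar>y + e\<bar> \<le> L} \<subseteq> of_int ` {\<lceil>- L - e\<rceil>..\<lfloor>L - e\<rfloor>}"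
  proof
    fix y assume "y \<in> {y\<in>\<int>. \<bar>y + e\<bar> \<le> L}"
    then obtain k where k: "y = of_int k" "\<bar>of_int k + e\<bar> \<le> L" by (auto elim: Ints_cases)
    then have "k \<in> {\<lceil>- L - e\<rceil>..\<lfloor>L - e\<rfloor>}" by (auto simp: ceiling_le_iff le_floor_iff)
    then show "y \<in> of_int ` {\<lceil>- L - e\<rceil>..\<lfloor>L - e\<rfloor>}" using k by blast
  qed
  then show "finite {y\<in>\<int>. \<bar>y + e\<bar> \<le> L}" by (rule finite_subset) simp
  have "card {y\<in>\<int>. \<bar>y + e\<bar> \<le> L} \<le> card (of_int ` {\<lceil>- L - e\<rceil>..\<lfloor>L - e\<rfloor>} :: real set)"
    by (rule card_mono[OF _ sub]) simp
  also have "\<dots> \<le> card {\<lceil>- L - e\<rceil>..\<lfloor>L - e\<rfloor>}" by (rule card_image_le) simp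
  also have "\<dots> = nat (\<lfloor>L - e\<rfloor> - \<lceil>- L - e\<rceil> + 1)" by simp
  finally have "real (card {y\<in>\<int>. \<bar>y + e\<bar> \<le> L}) \<le> real (nat (\<lfloor>L - e\<rfloor> - \<lceil>- L - e\<rceil> + 1))" by simp
  also have "\<dots> \<le> 2 * L + 1"
  proof (cases "0 \<le> \<lfloor>L - e\<rfloor> - \<lceil>- L - e\<rceil> + 1")
    case True
    have "of_int \<lfloor>L - e\<rfloor> \<le> L - e" "- L - e \<le> of_int \<lceil>- L - e\<rceil>" by linarith+
    then have "real_of_int (\<lfloor>L - e\<rfloor> - \<lceil>- L - e\<rceil> + 1) \<le> 2 * L + 1"
      unfolding of_int_add of_int_diff of_int_1 by linarith
    then show ?thesis using True by (simp only: of_nat_nat)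
  next
    case False
    then show ?thesis using assms by simp
  qed
  finally show "real (card {y\<in>\<int>. \<bar>y + e\<bar> \<le> L}) \<le> 2 * L + 1" .
qed

text \<open>
  Random subsets of a union of disjoint pairs \<open>{p i, q i}\<close> in new coordinates: \<open>T\<close> is the set of pairs
  of which exactly one vertex is chosen, and \<open>Z\<close> the set of pairs whose vertex \<open>p i\<close> is chosen. Given
  \<open>T\<close>, changing \<open>Z\<close> within \<open>T\<close> swaps vertices and preserves the cardinality.
\<close>

lemma avg_pairs:
  assumes "finite C0" "finite I" "inj_on p I" "inj_on q I" "p ` I \<inter> q ` I = {}" "C0 \<inter> (p ` I \<union> q ` I) = {}"
  shows "avg (C0 \<union> (p ` I \<union> q ` I)) f =
    avg C0 (\<lambda>U. avg I (\<lambda>T. avg I (\<lambda>Z. f (U \<union> (p ` Z \<union> q ` ((Z - T) \<union> (T - Z)))))))"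
proof -
  have "avg (C0 \<union> (p ` I \<union> q ` I)) f = avg C0 (\<lambda>U. avg (p ` I \<union> q ` I) (\<lambda>X. f (U \<union> X)))"
    using assms by (intro avg_Un) auto
  also have "\<dots> = avg C0 (\<lambda>U. avg (p ` I) (\<lambda>X. avg (q ` I) (\<lambda>Y. f (U \<union> (X \<union> Y)))))"
    by (intro avg_cong[OF refl] avg_Un finite_imageI assms)
  also have "\<dots> = avg C0 (\<lambda>U. avg I (\<lambda>Z. avg I (\<lambda>Y. f (U \<union> (p ` Z \<union> q ` Y)))))"
    unfolding avg_image[OF assms(3)] avg_image[OF assms(4)] ..
  also have "\<dots> = avg C0 (\<lambda>U. avg I (\<lambda>Z. avg I (\<lambda>T. f (U \<union> (p ` Z \<union> q ` ((Z - T) \<union> (T - Z)))))))"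
    by (intro avg_cong refl avg_symm_diff)
  also have "\<dots> = avg C0 (\<lambda>U. avg I (\<lambda>T. avg I (\<lambda>Z. f (U \<union> (p ` Z \<union> q ` ((Z - T) \<union> (T - Z)))))))"
    by (intro avg_cong refl avg_swap)
  finally show ?thesis .
qed

lemma image_disjoint: "inj_on f T \<Longrightarrow> A \<subseteq> T \<Longrightarrow> B \<subseteq> T \<Longrightarrow> A \<inter> B = {} \<Longrightarrow> f ` A \<inter> f ` B = {}"
  by (metis image_empty inj_on_image_Int)

lemma images_disjoint: "f ` T \<inter> g ` T = {} \<Longrightarrow> A \<subseteq> T \<Longrightarrow> B \<subseteq> T \<Longrightarrow> f ` A \<inter> g ` B = {}"
  by blast

lemma pr_card_less_quarter: 
  assumes "finite I" "I \<noteq> {}"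
  shows "pr I (\<lambda>T. real (card T) < real (card I) / 4) \<le> 2 * exp (- (real (card I) / 8))"
proof -
  have cI: "real (card I) > 0" using assms by (simp add: card_gt_0_iff)
  have "pr I (\<lambda>T. real (card T) < real (card I) / 4)
     \<le> pr I (\<lambda>T. real (card I) / 4 < \<bar>(\<Sum>i\<in>T. 1) - (\<Sum>i\<in>I. 1) / 2\<bar>)"
    by (rule pr_mono) auto
  also have "\<dots> \<le> 2 * exp (- 2 * (real (card I) / 4)\<^sup>2 / real (card I))"
    using assms cI by (intro pr_Hoeffding) auto
  also have "- 2 * (real (card I) / 4)\<^sup>2 / real (card I) = - (real (card I) / 8)"
    using cI by (simp add: power2_eq_square)
  finally show ?thesis .
qed

context adjacency
begin

definition deg :: "'a set \<Rightarrow> 'a \<Rightarrow> real" where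
  "deg U j = (\<Sum>i\<in>U. a i j)"

text \<open>
  For \<open>l = 0\<close> this is the number of edges inside \<open>U\<close>; the linear weights \<open>l\<close> make the notion
  stable under conditioning on vertices outside (\<open>edge_weight_Un\<close>).
\<close>

definition edge_weight :: "('a \<Rightarrow> real) \<Rightarrow> 'a set \<Rightarrow> real" where
  "edge_weight l U = (\<Sum>j\<in>U. l j + deg U j / 2)"

lemma abs_a_le_1: "\<bar>a i j\<bar> \<le> 1"
  using zero_one[of i j] by auto

lemma deg_Un: "finite X \<Longrightarrow> finite Y \<Longrightarrow> X \<inter> Y = {} \<Longrightarrow> deg (X \<union> Y) j = deg X j + deg Y j"
  unfolding deg_def by (rule sum.union_disjoint)

lemma sum_deg_swap: "(\<Sum>j\<in>X. deg Y j) = (\<Sum>j\<in>Y. deg X j)"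
  unfolding deg_def by (subst sum.swap) (simp add: sym)

lemma edge_weight_Un:
  assumes "finite X" "finite Y" "X \<inter> Y = {}"
  shows "edge_weight l (X \<union> Y) = edge_weight l X + edge_weight (\<lambda>j. l j + deg X j) Y"
proof -
  have "edge_weight l (X \<union> Y) = (\<Sum>j\<in>X. l j + deg (X \<union> Y) j / 2) + (\<Sum>j\<in>Y. l j + deg (X \<union> Y) j / 2)"
    unfolding edge_weight_def by (rule sum.union_disjoint) fact+
  also have "\<dots> = (\<Sum>j\<in>X. l j + deg X j / 2) + (\<Sum>j\<in>X. deg Y j) / 2 
      + ((\<Sum>j\<in>Y. l j + deg Y j / 2) + (\<Sum>j\<in>Y. deg X j) / 2)"
    unfolding deg_Un[OF assms] by (simp add: sum.distrib add_divide_distrib sum_divide_distrib)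
  also have "\<dots> = (\<Sum>j\<in>X. l j + deg X j / 2) + ((\<Sum>j\<in>Y. l j + deg Y j / 2) + (\<Sum>j\<in>Y. deg X j))"
    unfolding sum_deg_swap[of X Y] by simp
  finally show ?thesis by (simp add: edge_weight_def sum.distrib)
qed

text \<open>
  A trapezoidal rule, exact for quadratic functions: the change under the replacement of \<open>Y'\<close> by \<open>Y\<close> is a
  sum over the exchanged vertices in which every degree is averaged over the two end sets. Only the
  degrees at the end sets need to be under control, not those along a path between them.
\<close>

lemma edge_weight_swap:
  assumes "finite K" "finite Y" "finite Y'" "K \<inter> Y = {}" "K \<inter> Y' = {}" "Y \<inter> Y' = {}"
  shows "edge_weight l (K \<union> Y) - edge_weight l (K \<union> Y') =
    (\<Sum>j\<in>Y. l j + (deg (K \<union> Y) j + deg (K \<union> Y') j) / 2) - (\<Sum>j\<in>Y'. l j + (deg (K \<union> Y) j + deg (K \<union> Y') j) / 2)"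
proof -
  have 1: "edge_weight l (K \<union> Y) = edge_weight l K + ((\<Sum>j\<in>Y. l j) + (\<Sum>j\<in>Y. deg K j) + (\<Sum>j\<in>Y. deg Y j) / 2)"
    using edge_weight_Un[of K Y] assms by (simp add: edge_weight_def[of _ Y] sum.distrib sum_divide_distrib)
  have 2: "edge_weight l (K \<union> Y') = edge_weight l K + ((\<Sum>j\<in>Y'. l j) + (\<Sum>j\<in>Y'. deg K j) + (\<Sum>j\<in>Y'. deg Y' j) / 2)"
    using edge_weight_Un[of K Y'] assms by (simp add: edge_weight_def[of _ Y'] sum.distrib sum_divide_distrib)
  have 3: "(\<Sum>j\<in>S. l j + (deg (K \<union> Y) j + deg (K \<union> Y') j) / 2)
      = (\<Sum>j\<in>S. l j) + (\<Sum>j\<in>S. deg K j) + (\<Sum>j\<in>S. deg Y j) / 2 + (\<Sum>j\<in>S. deg Y' j) / 2" for S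
    unfolding deg_Un[OF assms(1,2,4)] deg_Un[OF assms(1,3,5)]
    by (simp add: sum.distrib sum_divide_distrib add_divide_distrib)
  show ?thesis unfolding 1 2 3 using sum_deg_swap[of Y Y'] by simp
qed

text \<open>
  The value \<open>deg C j / 2\<close> is the expected degree of \<open>j\<close> into a random subset of \<open>C\<close>.
\<close>

definition balanced :: "'a set \<Rightarrow> 'a set \<Rightarrow> real \<Rightarrow> 'a set \<Rightarrow> bool" where
  "balanced J C R U \<longleftrightarrow> (\<forall>j\<in>J. \<bar>deg U j - deg C j / 2\<bar> \<le> R)"

lemma pr_not_balanced:
  assumes "finite J" "finite C" "real (card C) \<le> n" "n > 0" "R \<ge> 0"
  shows "pr C (\<lambda>U. \<not> balanced J C R U) \<le> real (card J) * (2 * exp (- 2 * R\<^sup>2 / n))"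
proof -
  have "pr C (\<lambda>U. \<not> balanced J C R U) = pr C (\<lambda>U. \<exists>j\<in>J. R < \<bar>(\<Sum>i\<in>U. a i j) - (\<Sum>i\<in>C. a i j) / 2\<bar>)"
    by (intro pr_cong) (auto simp: balanced_def deg_def not_le)
  also have "\<dots> \<le> real (card J) * (2 * exp (- 2 * R\<^sup>2 / n))"
  proof (rule pr_Bex[OF assms(1)])
    fix j
    show "pr C (\<lambda>U. R < \<bar>(\<Sum>i\<in>U. a i j) - (\<Sum>i\<in>C. a i j) / 2\<bar>) \<le> 2 * exp (- 2 * R\<^sup>2 / n)"
      by (rule pr_Hoeffding[OF assms(2-4) abs_a_le_1 assms(5)])
  qed
  finally show ?thesis .
qed

text \<open>
  Swapping a set of pairs in the direction from \<open>q\<close> to \<open>p\<close> raises the weight by at least \<open>L - 2 R \<ge> L / 2\<close>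
  per pair, provided that both end sets are balanced.
\<close>

lemma swap_window:
  fixes p q :: "'i \<Rightarrow> 'a"
  assumes T: "finite T" "T \<noteq> {}" and inj: "inj_on p T" "inj_on q T" "p ` T \<inter> q ` T = {}"
    and F0: "finite F0" "F0 \<inter> p ` T = {}" "F0 \<inter> q ` T = {}" and sub: "p ` T \<subseteq> C" "q ` T \<subseteq> C"
    and gap: "\<And>i. i \<in> T \<Longrightarrow> L \<le> (l (p i) + deg C (p i) / 2) - (l (q i) + deg C (q i) / 2)"
    and LR: "L > 0" "4 * R \<le> L" "W \<ge> 0"
  shows "pr T (\<lambda>Z. balanced C C R (F0 \<union> (p ` Z \<union> q ` (T - Z))) \<and> \<bar>edge_weight l (F0 \<union> (p ` Z \<union> q ` (T - Z))) - y\<bar> \<le> W)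
    \<le> (4 * W / L + 1) / sqrt (real (card T))"
proof -
  \<comment> \<open>\<open>F0\<close> is the part of the random set outside the split pairs.\<close>
  define U where "U Z = F0 \<union> (p ` Z \<union> q ` (T - Z))" for Z
  have incr: "edge_weight l (U Z) + L / 2 \<le> edge_weight l (U Z')"
    if Z: "Z' \<subseteq> T" "Z \<subset> Z'" "balanced C C R (U Z)" "balanced C C R (U Z')" for Z Z'
  proof -
    define D where "D = Z' - Z"
    define K where "K = F0 \<union> (p ` Z \<union> q ` (T - Z'))"
    have DT: "D \<subseteq> T" "D \<noteq> {}" using Z(1,2) by (auto simp: D_def)
    then have "finite D" using T(1) finite_subset by blast
    note DT = DT this
    have fin: "finite K" "finite (p ` D)" "finite (q ` D)"
    proof -
      have "finite Z" "finite (T - Z')" using Z(1,2) T(1) by (auto dest: finite_subset)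
      then show "finite K" "finite (p ` D)" "finite (q ` D)" using DT(3) F0(1) by (auto simp: K_def)
    qed
    have injD: "inj_on p D" "inj_on q D" using inj DT by (auto intro: inj_on_subset)
    have UZ: "U Z = K \<union> q ` D" using Z by (auto simp: U_def K_def D_def)
    have UZ': "U Z' = K \<union> p ` D" using Z by (auto simp: U_def K_def D_def)
    have dpq: "p ` D \<inter> q ` D = {}" using inj(3) DT by blast
    have dK: "K \<inter> p ` D = {}" "K \<inter> q ` D = {}"
    proof -
      have ZD: "Z \<subseteq> T" "T - Z' \<subseteq> T" "Z \<inter> D = {}" "(T - Z') \<inter> D = {}" "D \<inter> (T - Z') = {}"
        using Z(1,2) by (auto simp: D_def)
      have "p ` Z \<inter> p ` D = {}" by (rule image_disjoint[OF inj(1) ZD(1) DT(1) ZD(3)])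
      moreover have "p ` D \<inter> q ` (T - Z') = {}" by (rule images_disjoint[OF inj(3) DT(1) ZD(2)])
      moreover have "F0 \<inter> p ` D = {}" using F0(2) DT(1) by blast
      ultimately show "K \<inter> p ` D = {}" unfolding K_def by (simp add: Int_Un_distrib Int_Un_distrib2 Int_commute)
      have "q ` (T - Z') \<inter> q ` D = {}" by (rule image_disjoint[OF inj(2) ZD(2) DT(1) ZD(4)])
      moreover have "p ` Z \<inter> q ` D = {}" by (rule images_disjoint[OF inj(3) ZD(1) DT(1)])
      moreover have "F0 \<inter> q ` D = {}" using F0(3) DT(1) by blast
      ultimately show "K \<inter> q ` D = {}" unfolding K_def by (simp add: Int_Un_distrib Int_Un_distrib2 Int_commute)
    qed
    define h where "h j = l j + (deg (U Z') j + deg (U Z) j) / 2" for j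
    have "edge_weight l (U Z') - edge_weight l (U Z) = (\<Sum>j\<in>p ` D. h j) - (\<Sum>j\<in>q ` D. h j)"
      unfolding h_def UZ UZ' using fin dK dpq by (intro edge_weight_swap)
    also have "\<dots> = (\<Sum>i\<in>D. h (p i) - h (q i))"
      using injD by (simp add: sum.reindex sum_subtractf)
    finally have eq: "edge_weight l (U Z') - edge_weight l (U Z) = (\<Sum>i\<in>D. h (p i) - h (q i))" .
    have hb: "\<bar>h j - (l j + deg C j / 2)\<bar> \<le> R" if "j \<in> C" for j
    proof -
      have "\<bar>deg (U Z) j - deg C j / 2\<bar> \<le> R" "\<bar>deg (U Z') j - deg C j / 2\<bar> \<le> R"
        using Z that unfolding balanced_def by blast+
      then show ?thesis unfolding h_def by (simp add: abs_le_iff field_simps)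
    qed
    have "L / 2 \<le> h (p i) - h (q i)" if "i \<in> D" for i
    proof -
      have iT: "i \<in> T" using that DT by blast
      then have "p i \<in> C" "q i \<in> C" using sub by auto
      from hb[OF this(1)] hb[OF this(2)] gap[OF iT] show ?thesis using LR by linarith
    qed
    then have "(\<Sum>i\<in>D. L / 2) \<le> (\<Sum>i\<in>D. h (p i) - h (q i))" by (intro sum_mono)
    moreover have "1 * (L / 2) \<le> real (card D) * (L / 2)"
    proof (rule mult_right_mono)
      have "card D \<noteq> 0" using DT by simp
      then show "1 \<le> real (card D)" by linarith
    qed (use LR in simp)
    ultimately show ?thesis using eq by simp
  qed
  show ?thesis unfolding U_def[symmetric]
  proof (rule pr_window_le[where \<phi> = "\<lambda>Z. edge_weight l (U Z)" and w = "L / 2" and y = "y - W"])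
    show "finite T" "T \<noteq> {}" "0 < L / 2" "0 \<le> 4 * W / L" using T LR by auto
  next
    fix Z Z' assume "Z' \<subseteq> T" "Z \<subset> Z'" "balanced C C R (U Z) \<and> \<bar>edge_weight l (U Z) - y\<bar> \<le> W"
      "balanced C C R (U Z') \<and> \<bar>edge_weight l (U Z') - y\<bar> \<le> W"
    then show "edge_weight l (U Z) + L / 2 \<le> edge_weight l (U Z')" using incr by blast
  next
    fix Z assume "balanced C C R (U Z) \<and> \<bar>edge_weight l (U Z) - y\<bar> \<le> W"
    then have "\<bar>edge_weight l (U Z) - y\<bar> \<le> W" by blast
    moreover have eq: "4 * W / L * (L / 2) = 2 * W" using LR by simp
    ultimately show "y - W \<le> edge_weight l (U Z) \<and> edge_weight l (U Z) \<le> y - W + 4 * W / L * (L / 2)"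
      unfolding eq by (simp add: abs_le_iff)
  qed
qed

text \<open>
  Given the set \<open>T\<close> of split pairs and everything outside them, the cardinality of \<open>U\<close> is constant and
  \<open>swap_window\<close> applies. So the window costs a factor in addition to the condition \<open>\<kappa>\<close> on the cardinality;
  the last summand accounts for a small \<open>T\<close>.
\<close>

lemma paired_window:
  fixes p q :: "'i \<Rightarrow> 'a"
  assumes C: "finite C" and I: "finite I" "I \<noteq> {}" and inj: "inj_on p I" "inj_on q I" "p ` I \<inter> q ` I = {}"
    and sub: "p ` I \<subseteq> C" "q ` I \<subseteq> C"
    and gap: "\<And>i. i \<in> I \<Longrightarrow> L \<le> (l (p i) + deg C (p i) / 2) - (l (q i) + deg C (q i) / 2)"
    and LR: "L > 0" "4 * R \<le> L" "W \<ge> 0"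
  shows "pr C (\<lambda>U. \<kappa> (card U) \<and> balanced C C R U \<and> \<bar>edge_weight l U - y\<bar> \<le> W)
    \<le> (4 * W / L + 1) / sqrt (real (card I) / 4) * pr C (\<lambda>U. \<kappa> (card U)) + 2 * exp (- (real (card I) / 8))"
proof -
  define \<beta> where "\<beta> = (4 * W / L + 1) / sqrt (real (card I) / 4)"
  define E where "E U \<longleftrightarrow> balanced C C R U \<and> \<bar>edge_weight l U - y\<bar> \<le> W" for U
  define C0 where "C0 = C - (p ` I \<union> q ` I)"
  define S where "S U T Z = U \<union> (p ` Z \<union> q ` ((Z - T) \<union> (T - Z)))" for U T Z
  have Ceq: "C = C0 \<union> (p ` I \<union> q ` I)" using sub by (auto simp: C0_def)
  have av: "avg C f = avg C0 (\<lambda>U. avg I (\<lambda>T. avg I (\<lambda>Z. f (S U T Z))))" for f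
    unfolding S_def by (subst Ceq, rule avg_pairs) (use C I inj in \<open>auto simp: C0_def\<close>)
  have cI: "real (card I) > 0" using I by (simp add: card_gt_0_iff)
  have \<beta>0: "\<beta> \<ge> 0" using LR by (simp add: \<beta>_def)
  have inner: "avg I (\<lambda>Z. of_bool (\<kappa> (card (S U T Z)) \<and> E (S U T Z)))
     \<le> \<beta> * avg I (\<lambda>Z. of_bool (\<kappa> (card (S U T Z)))) + of_bool (real (card T) < real (card I) / 4)"
    if U: "U \<subseteq> C0" and T: "T \<subseteq> I" for U T
  proof (cases "real (card T) < real (card I) / 4")
    case True
    have "avg I (\<lambda>Z. of_bool (\<kappa> (card (S U T Z)) \<and> E (S U T Z))) \<le> 1"
      using I by (intro avg_le_const) auto
    moreover have "0 \<le> \<beta> * avg I (\<lambda>Z. of_bool (\<kappa> (card (S U T Z))))"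
      using \<beta>0 by (intro mult_nonneg_nonneg avg_nonneg) auto
    ultimately show ?thesis using True by simp
  next
    case False
    have Tfin: "finite T" using T I finite_subset by blast
    have Tne: "T \<noteq> {}" using False cI by auto
    have Ufin: "finite U" using finite_subset[OF U] C by (auto simp: C0_def)
    have dU: "U \<inter> p ` I = {}" "U \<inter> q ` I = {}" using U by (auto simp: C0_def)
    have split: "avg I f = avg (I - T) (\<lambda>Z0. avg T (\<lambda>Z. f (Z0 \<union> Z)))" for f
    proof -
      have "I = (I - T) \<union> T" using T by blast
      then have "avg I f = avg ((I - T) \<union> T) f" by simp
      also have "\<dots> = avg (I - T) (\<lambda>Z0. avg T (\<lambda>Z. f (Z0 \<union> Z)))"
        using I Tfin by (intro avg_Un) auto
      finally show ?thesis .
    qed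
    have "avg T (\<lambda>Z. of_bool (\<kappa> (card (S U T (Z0 \<union> Z))) \<and> E (S U T (Z0 \<union> Z))))
       \<le> \<beta> * avg T (\<lambda>Z. of_bool (\<kappa> (card (S U T (Z0 \<union> Z)))))" if Z0: "Z0 \<subseteq> I - T" for Z0
    proof -
      define F0 where "F0 = U \<union> (p ` Z0 \<union> q ` Z0)"
      have F0fin: "finite F0" using Ufin Z0 I by (auto simp: F0_def intro: finite_subset)
      have SF: "S U T (Z0 \<union> Z) = F0 \<union> (p ` Z \<union> q ` (T - Z))" if "Z \<subseteq> T" for Z
      proof -
        have "((Z0 \<union> Z) - T) \<union> (T - (Z0 \<union> Z)) = Z0 \<union> (T - Z)" using that Z0 by blast
        then show ?thesis unfolding S_def F0_def by auto
      qed
      have ZT: "Z0 \<subseteq> I" "Z0 \<inter> T = {}" using Z0 by auto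
      have F0p: "F0 \<inter> p ` T = {}"
      proof -
        have "p ` Z0 \<inter> p ` T = {}" by (rule image_disjoint[OF inj(1) ZT(1) T ZT(2)])
        moreover have "p ` T \<inter> q ` Z0 = {}" by (rule images_disjoint[OF inj(3) T ZT(1)])
        moreover have "U \<inter> p ` T = {}" using dU(1) T by blast
        ultimately show ?thesis unfolding F0_def by (simp add: Int_Un_distrib Int_Un_distrib2 Int_commute)
      qed
      have F0q: "F0 \<inter> q ` T = {}"
      proof -
        have "q ` Z0 \<inter> q ` T = {}" by (rule image_disjoint[OF inj(2) ZT(1) T ZT(2)])
        moreover have "p ` Z0 \<inter> q ` T = {}" by (rule images_disjoint[OF inj(3) ZT(1) T])
        moreover have "U \<inter> q ` T = {}" using dU(2) T by blast
        ultimately show ?thesis unfolding F0_def by (simp add: Int_Un_distrib Int_Un_distrib2 Int_commute)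
      qed
      have injT: "inj_on p T" "inj_on q T" using inj T by (auto intro: inj_on_subset)
      have cardS: "card (F0 \<union> (p ` Z \<union> q ` (T - Z))) = card F0 + card T" if Z: "Z \<subseteq> T" for Z
      proof -
        have fin: "finite (p ` Z)" "finite (q ` (T - Z))" using Z Tfin finite_subset by auto
        have "card (p ` Z) = card Z" "card (q ` (T - Z)) = card (T - Z)"
          using injT Z by (auto intro!: card_image intro: inj_on_subset)
        moreover have "card (T - Z) = card T - card Z" "card Z \<le> card T"
          using Z Tfin by (auto intro: card_Diff_subset finite_subset card_mono)
        moreover have "p ` Z \<inter> q ` (T - Z) = {}" 
          by (rule images_disjoint[OF inj(3)]) (use Z T in blast)+
        then have "card (p ` Z \<union> q ` (T - Z)) = card (p ` Z) + card (q ` (T - Z))"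
          using fin by (intro card_Un_disjoint)
        moreover have "F0 \<inter> (p ` Z \<union> q ` (T - Z)) = {}"
        proof -
          have "p ` Z \<subseteq> p ` T" "q ` (T - Z) \<subseteq> q ` T" using Z by auto
          then show ?thesis using F0p F0q by blast
        qed
        then have "card (F0 \<union> (p ` Z \<union> q ` (T - Z))) = card F0 + card (p ` Z \<union> q ` (T - Z))"
          using fin F0fin by (intro card_Un_disjoint) auto
        ultimately show ?thesis by simp
      qed
      have "pr T (\<lambda>Z. E (F0 \<union> (p ` Z \<union> q ` (T - Z)))) \<le> (4 * W / L + 1) / sqrt (real (card T))"
        unfolding E_def
      proof (rule swap_window)
        show "finite T" "T \<noteq> {}" "inj_on p T" "inj_on q T" "finite F0" "F0 \<inter> p ` T = {}" "F0 \<inter> q ` T = {}"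
          "L > 0" "4 * R \<le> L" "W \<ge> 0" by fact+
        show "p ` T \<inter> q ` T = {}" by (rule images_disjoint[OF inj(3) T T])
        show "p ` T \<subseteq> C" "q ` T \<subseteq> C" using sub T by (auto simp: image_subset_iff)
        show "L \<le> (l (p i) + deg C (p i) / 2) - (l (q i) + deg C (q i) / 2)" if "i \<in> T" for i
          using gap that T by blast
      qed
      also have "\<dots> \<le> \<beta>" unfolding \<beta>_def using False LR cI
        by (intro divide_left_mono) (auto intro!: mult_pos_pos)
      finally have E\<beta>: "pr T (\<lambda>Z. E (F0 \<union> (p ` Z \<union> q ` (T - Z)))) \<le> \<beta>" .
      have "avg T (\<lambda>Z. of_bool (\<kappa> (card (S U T (Z0 \<union> Z))) \<and> E (S U T (Z0 \<union> Z))))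
         = avg T (\<lambda>Z. of_bool (\<kappa> (card F0 + card T)) * of_bool (E (F0 \<union> (p ` Z \<union> q ` (T - Z)))))"
        by (intro avg_cong refl) (simp add: SF cardS)
      also have "\<dots> = of_bool (\<kappa> (card F0 + card T)) * pr T (\<lambda>Z. E (F0 \<union> (p ` Z \<union> q ` (T - Z))))"
        by (simp only: avg_cmult pr_def)
      also have "\<dots> \<le> of_bool (\<kappa> (card F0 + card T)) * \<beta>" by (intro mult_left_mono E\<beta>) simp
      also have "of_bool (\<kappa> (card F0 + card T)) = avg T (\<lambda>Z. of_bool (\<kappa> (card (S U T (Z0 \<union> Z)))))"
        using Tfin by (subst avg_cong[OF refl, of T _ "\<lambda>_. of_bool (\<kappa> (card F0 + card T))"]) (auto simp: SF cardS)
      finally show ?thesis by (simp add: mult.commute)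
    qed
    then have "avg I (\<lambda>Z. of_bool (\<kappa> (card (S U T Z)) \<and> E (S U T Z)))
       \<le> \<beta> * avg I (\<lambda>Z. of_bool (\<kappa> (card (S U T Z))))"
      unfolding split avg_cmult[symmetric] by (rule avg_mono)
    then show ?thesis by simp
  qed
  have "pr C (\<lambda>U. \<kappa> (card U) \<and> E U)
    \<le> avg C0 (\<lambda>U. avg I (\<lambda>T. \<beta> * avg I (\<lambda>Z. of_bool (\<kappa> (card (S U T Z)))) + of_bool (real (card T) < real (card I) / 4)))"
    unfolding pr_def av by (intro avg_mono inner)
  also have "\<dots> = \<beta> * pr C (\<lambda>U. \<kappa> (card U)) + pr I (\<lambda>T. real (card T) < real (card I) / 4)"
    using C by (simp only: pr_def av avg_add avg_cmult) (simp add: C0_def)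
  also have "\<dots> \<le> \<beta> * pr C (\<lambda>U. \<kappa> (card U)) + 2 * exp (- (real (card I) / 8))"
    using pr_card_less_quarter[OF I] by simp
  finally show ?thesis by (simp add: E_def \<beta>_def)
qed

lemma Ints_a: "a i j \<in> \<int>"
  using zero_one[of i j] by auto

text \<open>
  There are at most \<open>(2 L + 1) ^ s\<close> possible integer vectors for the differences of degrees, and each of
  them is hit with the probability given by \<open>joint_point_prob\<close>. Differences of the first row from the
  others are combinations of the rows with coefficient sum \<open>0\<close>.
\<close>

lemma pr_all_close:
  assumes A: "finite A" and rob: "robust M xs A" and len: "length xs = Suc s" and M: "M > 0" and L: "L \<ge> 0"
  shows "pr A (\<lambda>X. \<forall>u<s. \<bar>(\<Sum>i\<in>X. a (xs ! Suc u) i - a (xs ! 0) i) + e u\<bar> \<le> L) \<le> ((2 * L + 1) * sqrt (3 ^ s / M)) ^ s"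
proof -
  define v where "v i = (\<lambda>u\<in>{..<s}. a (xs ! Suc u) i - a (xs ! 0) i)" for i
  define Y where "Y u = {y\<in>\<int>. \<bar>y + e u\<bar> \<le> L}" for u
  define YY where "YY = (\<Pi>\<^sub>E u\<in>{..<s}. Y u)"
  have Yfin: "finite (Y u)" and Ycard: "real (card (Y u)) \<le> 2 * L + 1" for u
    using card_Ints_interval[OF L, of "e u"] unfolding Y_def by blast+
  have YYfin: "finite YY" unfolding YY_def using Yfin by (intro finite_PiE) auto
  have "real (card YY) = (\<Prod>u<s. real (card (Y u)))" by (simp add: YY_def card_PiE)
  also have "\<dots> \<le> (\<Prod>u<s. 2 * L + 1)" using Ycard by (intro prod_mono) auto
  finally have YYcard: "real (card YY) \<le> (2 * L + 1) ^ s" by simp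
  have "v ` A \<subseteq> (\<Pi>\<^sub>E u\<in>{..<s}. {-1, 0, 1})"
  proof (intro image_subsetI)
    fix i
    have "a (xs ! Suc u) i - a (xs ! 0) i \<in> {-1, 0, 1}" for u
      using zero_one[of "xs ! Suc u" i] zero_one[of "xs ! 0" i] by auto
    then show "v i \<in> (\<Pi>\<^sub>E u\<in>{..<s}. {-1, 0, 1})" by (simp add: v_def PiE_def)
  qed
  then have "card (v ` A) \<le> card (\<Pi>\<^sub>E u\<in>{..<s}. {-1, 0, 1::real})" by (intro card_mono finite_PiE) auto
  also have "\<dots> = 3 ^ s" by (simp add: card_PiE numeral_3_eq_3)
  finally have vcard: "real (card (v ` A)) \<le> 3 ^ s" by (metis of_nat_le_iff of_nat_numeral of_nat_power)
  have dotv: "dot (Suc s) (\<lambda>u. case u of 0 \<Rightarrow> - (\<Sum>u<s. l u) | Suc u \<Rightarrow> l u) (\<lambda>u. a (xs ! u) i) = dot s l (v i)" for l i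
    unfolding dot_def sum.lessThan_Suc_shift
    by (simp add: v_def algebra_simps sum_subtractf sum_distrib_right)
  have robv: "M \<le> card {i\<in>A. dot s (annihilator s ws) (v i) \<noteq> 0}" if ws: "length ws < s" for ws
  proof -
    define l where "l = (\<lambda>u. case u of 0 \<Rightarrow> - (\<Sum>u<s. annihilator s ws u) | Suc u \<Rightarrow> annihilator s ws u)"
    obtain u where "u < s" "annihilator s ws u \<noteq> 0" using annihilator(1)[OF ws] by blast
    then have "Suc u < length xs" "l (Suc u) \<noteq> 0" by (simp_all add: l_def len)
    then have "\<exists>u<length xs. l u \<noteq> 0" by blast
    from rob[unfolded robust_def, rule_format, OF this] show ?thesis
      unfolding len l_def dotv .
  qed
  have point: "pr A (\<lambda>X. \<forall>u<s. (\<Sum>i\<in>X. v i u) = y u) \<le> sqrt (3 ^ s / M) ^ s" for y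
    by (rule joint_point_prob[OF A vcard M robv])
  have "pr A (\<lambda>X. \<forall>u<s. \<bar>(\<Sum>i\<in>X. a (xs ! Suc u) i - a (xs ! 0) i) + e u\<bar> \<le> L)
     \<le> pr A (\<lambda>X. \<exists>y\<in>YY. \<forall>u<s. (\<Sum>i\<in>X. v i u) = y u)"
  proof (rule pr_mono)
    fix X assume close: "\<forall>u<s. \<bar>(\<Sum>i\<in>X. a (xs ! Suc u) i - a (xs ! 0) i) + e u\<bar> \<le> L"
    define y where "y = (\<lambda>u\<in>{..<s}. \<Sum>i\<in>X. v i u)"
    have "y u \<in> Y u" if "u < s" for u
      using close that by (auto simp: y_def Y_def v_def intro!: Ints_sum Ints_diff Ints_a)
    then have "y \<in> YY" by (simp add: YY_def y_def PiE_def)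
    moreover have "\<forall>u<s. (\<Sum>i\<in>X. v i u) = y u" by (simp add: y_def)
    ultimately show "\<exists>y\<in>YY. \<forall>u<s. (\<Sum>i\<in>X. v i u) = y u" by blast
  qed
  also have "\<dots> \<le> real (card YY) * sqrt (3 ^ s / M) ^ s" using YYfin point by (intro pr_Bex)
  also have "\<dots> \<le> (2 * L + 1) ^ s * sqrt (3 ^ s / M) ^ s"
    using M by (intro mult_right_mono YYcard) simp
  finally show ?thesis by (simp add: power_mult_distrib)
qed

text \<open>
  After \<open>U \<inter> A\<close> is revealed, each tuple in \<open>F\<close> very likely contains two vertices whose effective linear
  weights \<open>c X\<close> differ by more than \<open>L\<close>. These are the pairs for \<open>paired_window\<close>. The prescribed cardinality
  costs the further factor \<open>1 / sqrt (card (A \<union> C))\<close>.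
\<close>

lemma coarse_anticoncentration:
  assumes A: "finite A" and C: "finite C" "C \<noteq> {}" "A \<inter> C = {}" "real (card C) \<le> n"
    and F: "finite F" "F \<noteq> {}"
    and tup: "\<And>xs. xs \<in> F \<Longrightarrow> length xs = Suc s" "\<And>xs. xs \<in> F \<Longrightarrow> set xs \<subseteq> C" "\<And>xs. xs \<in> F \<Longrightarrow> robust M xs A"
    and disj: "\<And>xs ys. xs \<in> F \<Longrightarrow> ys \<in> F \<Longrightarrow> xs \<noteq> ys \<Longrightarrow> set xs \<inter> set ys = {}"
    and LR: "L > 0" "R \<ge> 0" "4 * R \<le> L" "W \<ge> 0" "M > 0"
  shows "pr (A \<union> C) (\<lambda>U. card U = k \<and> \<bar>edge_weight l U - y\<bar> \<le> W)
    \<le> (4 * W / L + 1) / sqrt (real (card F) / 4) / sqrt (real (card (A \<union> C)))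
      + 2 * exp (- (real (card F) / 8)) + real (card C) * (2 * exp (- 2 * R\<^sup>2 / n))
      + real (card F) * ((2 * L + 1) * sqrt (3 ^ s / M)) ^ s"
proof -
  define \<beta> where "\<beta> = (4 * W / L + 1) / sqrt (real (card F) / 4)"
  have \<beta>0: "\<beta> \<ge> 0" using LR by (simp add: \<beta>_def)
  have cC: "real (card C) > 0" using C by (simp add: card_gt_0_iff)
  then have n: "n > 0" using C(4) by linarith
  define c where "c X j = l j + deg X j + deg C j / 2" for X j
  \<comment> \<open>Outcomes on \<open>A\<close> for which some tuple offers no pair with a large gap.\<close>
  define bad where "bad X \<longleftrightarrow> (\<exists>xs\<in>F. \<forall>u<s. \<bar>c X (xs ! Suc u) - c X (xs ! 0)\<bar> \<le> L)" for X
  define E where "E U \<longleftrightarrow> card U = k \<and> \<bar>edge_weight l U - y\<bar> \<le> W" for U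
  have good: "pr C (\<lambda>Y. balanced C C R Y \<and> E (X \<union> Y)) \<le> \<beta> * pr C (\<lambda>Y. card (X \<union> Y) = k) + 2 * exp (- (real (card F) / 8))"
    if X: "X \<subseteq> A" and nb: "\<not> bad X" for X
  proof -
    have Xfin: "finite X" using X A finite_subset by blast
    have "\<forall>xs\<in>F. \<exists>u<s. \<not> \<bar>c X (xs ! Suc u) - c X (xs ! 0)\<bar> \<le> L" using nb unfolding bad_def by blast
    then have "\<forall>xs\<in>F. \<exists>u. u < s \<and> \<not> \<bar>c X (xs ! Suc u) - c X (xs ! 0)\<bar> \<le> L" by blast
    from bchoice[OF this] obtain \<upsilon> where \<upsilon>: "\<forall>xs\<in>F. \<upsilon> xs < s \<and> \<not> \<bar>c X (xs ! Suc (\<upsilon> xs)) - c X (xs ! 0)\<bar> \<le> L" ..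
    define up where "up xs \<longleftrightarrow> c X (xs ! Suc (\<upsilon> xs)) - c X (xs ! 0) > L" for xs
    define p where "p xs = (if up xs then xs ! Suc (\<upsilon> xs) else xs ! 0)" for xs
    define q where "q xs = (if up xs then xs ! 0 else xs ! Suc (\<upsilon> xs))" for xs
    have gap: "L < c X (p xs) - c X (q xs)" if "xs \<in> F" for xs
      using \<upsilon>[rule_format, OF that] LR by (auto simp: p_def q_def up_def)
    have mem: "p xs \<in> set xs" "q xs \<in> set xs" if "xs \<in> F" for xs
    proof -
      have "Suc (\<upsilon> xs) < length xs" "0 < length xs" using \<upsilon>[rule_format, OF that] tup(1)[OF that] by auto
      then show "p xs \<in> set xs" "q xs \<in> set xs" unfolding p_def q_def by (auto intro: nth_mem)
    qed
    have same: "xs = ys" if "xs \<in> F" "ys \<in> F" "z \<in> set xs" "z \<in> set ys" for xs ys z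
      using disj[OF that(1,2)] that(3,4) by blast
    have inj: "inj_on p F" "inj_on q F"
      using same mem by (metis inj_onI)+
    have pq: "p ` F \<inter> q ` F = {}"
    proof (rule ccontr)
      assume "p ` F \<inter> q ` F \<noteq> {}"
      then obtain xs ys where xy: "xs \<in> F" "ys \<in> F" "p xs = q ys" by blast
      have "xs = ys" using same[OF xy(1,2) mem(1)[OF xy(1)]] mem(2)[OF xy(2)] xy(3) by simp
      then show False using gap[OF xy(1)] xy(3) LR by simp
    qed
    define l' where "l' j = l j + deg X j" for j
    have stX: "edge_weight l (X \<union> Y) = edge_weight l X + edge_weight l' Y" "card (X \<union> Y) = card X + card Y" if "Y \<subseteq> C" for Y
    proof -
      have "X \<inter> Y = {}" "finite Y" using that X C finite_subset by blast+
      then show "edge_weight l (X \<union> Y) = edge_weight l X + edge_weight l' Y" "card (X \<union> Y) = card X + card Y"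
        using Xfin unfolding l'_def by (auto intro: edge_weight_Un card_Un_disjoint)
    qed
    have "pr C (\<lambda>Y. balanced C C R Y \<and> E (X \<union> Y)) 
        = pr C (\<lambda>Y. card X + card Y = k \<and> balanced C C R Y \<and> \<bar>edge_weight l' Y - (y - edge_weight l X)\<bar> \<le> W)"
      by (intro pr_cong) (auto simp: E_def stX algebra_simps)
    also have "\<dots> \<le> \<beta> * pr C (\<lambda>Y. card X + card Y = k) + 2 * exp (- (real (card F) / 8))"
      unfolding \<beta>_def
    proof (rule paired_window[where p = p and q = q and \<kappa> = "\<lambda>c. card X + c = k"])
      show "finite C" "finite F" "F \<noteq> {}" "inj_on p F" "inj_on q F" "p ` F \<inter> q ` F = {}"
        "L > 0" "4 * R \<le> L" "W \<ge> 0" by fact+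
      show "p ` F \<subseteq> C" "q ` F \<subseteq> C" using mem tup(2) by blast+
      show "L \<le> l' (p xs) + deg C (p xs) / 2 - (l' (q xs) + deg C (q xs) / 2)" if "xs \<in> F" for xs
        using gap[OF that] by (simp add: c_def l'_def)
    qed
    also have "pr C (\<lambda>Y. card X + card Y = k) = pr C (\<lambda>Y. card (X \<union> Y) = k)"
      by (intro pr_cong) (simp add: stX)
    finally show ?thesis .
  qed
  have step: "pr C (\<lambda>Y. E (X \<union> Y)) \<le> of_bool (bad X) + (\<beta> * pr C (\<lambda>Y. card (X \<union> Y) = k) 
      + (2 * exp (- (real (card F) / 8)) + real (card C) * (2 * exp (- 2 * R\<^sup>2 / n))))" if X: "X \<subseteq> A" for X
  proof (cases "bad X")
    case True
    have "pr C (\<lambda>Y. E (X \<union> Y)) \<le> 1" using C by (intro pr_le_1)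
    moreover have "0 \<le> \<beta> * pr C (\<lambda>Y. card (X \<union> Y) = k)" using \<beta>0 by simp
    moreover have "0 \<le> 2 * exp (- (real (card F) / 8))" "0 \<le> real (card C) * (2 * exp (- 2 * R\<^sup>2 / n))" by auto
    moreover have "of_bool (bad X) = (1::real)" using True by simp
    ultimately show ?thesis by linarith
  next
    case False
    have "pr C (\<lambda>Y. E (X \<union> Y)) \<le> pr C (\<lambda>Y. balanced C C R Y \<and> E (X \<union> Y) \<or> \<not> balanced C C R Y)"
      by (rule pr_mono) blast
    also have "\<dots> \<le> pr C (\<lambda>Y. balanced C C R Y \<and> E (X \<union> Y)) + pr C (\<lambda>Y. \<not> balanced C C R Y)"
      by (rule pr_disj)
    finally show ?thesis using good[OF X False] pr_not_balanced[OF C(1) C(1,4) n LR(2)] False by simp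
  qed
  have bad: "pr A bad \<le> real (card F) * ((2 * L + 1) * sqrt (3 ^ s / M)) ^ s"
    unfolding bad_def
  proof (rule pr_Bex[OF F(1)])
    fix xs assume xs: "xs \<in> F"
    define e where "e u = (l (xs ! Suc u) + deg C (xs ! Suc u) / 2) - (l (xs ! 0) + deg C (xs ! 0) / 2)" for u
    have "c X (xs ! Suc u) - c X (xs ! 0) = (\<Sum>i\<in>X. a (xs ! Suc u) i - a (xs ! 0) i) + e u" for X u
      unfolding c_def e_def deg_def using sym by (simp add: sum_subtractf)
    then show "pr A (\<lambda>X. \<forall>u<s. \<bar>c X (xs ! Suc u) - c X (xs ! 0)\<bar> \<le> L) \<le> ((2 * L + 1) * sqrt (3 ^ s / M)) ^ s"
      using pr_all_close[OF A tup(3)[OF xs] tup(1)[OF xs] LR(5), of L e] LR(1) by simp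
  qed
  have AC: "finite (A \<union> C)" "A \<union> C \<noteq> {}" using A C by auto
  have "pr (A \<union> C) E = avg A (\<lambda>X. pr C (\<lambda>Y. E (X \<union> Y)))"
    unfolding pr_def by (rule avg_Un[OF A C(1,3)])
  also have "\<dots> \<le> avg A (\<lambda>X. of_bool (bad X) + (\<beta> * pr C (\<lambda>Y. card (X \<union> Y) = k) 
      + (2 * exp (- (real (card F) / 8)) + real (card C) * (2 * exp (- 2 * R\<^sup>2 / n)))))"
    by (rule avg_mono[OF step])
  also have "\<dots> = pr A bad + (\<beta> * pr (A \<union> C) (\<lambda>U. card U = k)
      + (2 * exp (- (real (card F) / 8)) + real (card C) * (2 * exp (- 2 * R\<^sup>2 / n))))"
    unfolding avg_add avg_cmult avg_const[OF A] pr_def avg_Un[OF A C(1,3)] ..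
  also have "\<dots> \<le> real (card F) * ((2 * L + 1) * sqrt (3 ^ s / M)) ^ s + (\<beta> * (1 / sqrt (real (card (A \<union> C))))
      + (2 * exp (- (real (card F) / 8)) + real (card C) * (2 * exp (- 2 * R\<^sup>2 / n))))"
    using pr_card_eq[OF AC] \<beta>0 by (intro add_mono bad mult_left_mono order_refl)
  finally show ?thesis by (simp add: E_def[abs_def] \<beta>_def)
qed

end

section \<open>Moments of the conditional point probability\<close>

text \<open>
  A family of subsets of \<open>B\<close> indexed by \<open>I\<close> is coded as one subset of \<open>B \<times> I\<close>, so that independent copies of a
  random subset are again a uniformly random subset.
\<close>

definition slice :: "nat \<Rightarrow> ('a \<times> nat) set \<Rightarrow> 'a set" where
  "slice t H = {j. (j, t) \<in> H}"

lemma slice_Un: "slice t (X \<union> Y) = slice t X \<union> slice t Y"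
  by (auto simp: slice_def)

lemma slice_subset: "H \<subseteq> B \<times> I \<Longrightarrow> slice t H \<subseteq> B"
  by (auto simp: slice_def)

lemma slice_outside: "H \<subseteq> B \<times> I \<Longrightarrow> t \<notin> I \<Longrightarrow> slice t H = {}"
  by (auto simp: slice_def)

lemma slice_copy: "slice t ((\<lambda>j. (j, t)) ` Z) = Z" "t \<noteq> t' \<Longrightarrow> slice t' ((\<lambda>j. (j, t)) ` Z) = {}"
  by (auto simp: slice_def)

lemma avg_split_copy:
  assumes "finite B" "finite I" "t \<notin> I"
  shows "avg (B \<times> insert t I) f = avg (B \<times> I) (\<lambda>X. avg B (\<lambda>Z. f (X \<union> (\<lambda>j. (j, t)) ` Z)))"
proof -
  have eq: "B \<times> insert t I = (B \<times> I) \<union> (\<lambda>j. (j, t)) ` B" by auto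
  have inj: "inj_on (\<lambda>j. (j, t)) B" by (auto simp: inj_on_def)
  have "avg (B \<times> insert t I) f = avg (B \<times> I) (\<lambda>X. avg ((\<lambda>j. (j, t)) ` B) (\<lambda>Y. f (X \<union> Y)))"
    unfolding eq using assms by (intro avg_Un) auto
  then show ?thesis unfolding avg_image[OF inj] .
qed

text \<open>
  Powers of a mean as a mean over independent copies.
\<close>

lemma avg_prod_slices:
  assumes "finite B"
  shows "avg (B \<times> {..<n}) (\<lambda>H. \<Prod>t<n. f (slice t H)) = avg B f ^ n"
proof (induction n)
  case (Suc n)
  have "avg (B \<times> {..<Suc n}) (\<lambda>H. \<Prod>t<Suc n. f (slice t H))
     = avg (B \<times> {..<n}) (\<lambda>X. avg B (\<lambda>Z. \<Prod>t<Suc n. f (slice t (X \<union> (\<lambda>j. (j, n)) ` Z))))"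
    unfolding lessThan_Suc using assms by (intro avg_split_copy) auto
  also have "\<dots> = avg (B \<times> {..<n}) (\<lambda>X. avg B (\<lambda>Z. (\<Prod>t<n. f (slice t X)) * f Z))"
  proof (intro avg_cong refl)
    fix X Z assume X: "X \<subseteq> B \<times> {..<n}"
    have "(\<Prod>t<n. f (slice t (X \<union> (\<lambda>j. (j, n)) ` Z))) = (\<Prod>t<n. f (slice t X))"
      by (intro prod.cong) (auto simp: slice_Un slice_copy)
    moreover have "slice n (X \<union> (\<lambda>j. (j, n)) ` Z) = Z"
      using slice_outside[OF X, of n] by (simp add: slice_Un slice_copy)
    ultimately show "(\<Prod>t<Suc n. f (slice t (X \<union> (\<lambda>j. (j, n)) ` Z))) = (\<Prod>t<n. f (slice t X)) * f Z"
      by simp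
  qed
  also have "\<dots> = avg B f ^ Suc n"
    unfolding avg_cmult avg_cmult_right Suc.IH by simp
  finally show ?case .
qed simp

context adjacency
begin

text \<open>
  The effect of vertex \<open>i\<close> on the differences between the weights of the copies \<open>1, ..., d\<close> and of the
  copy \<open>0\<close>, all of them joined to the same set outside \<open>B\<close>.
\<close>

definition diff_vec :: "nat \<Rightarrow> ('a \<times> nat) set \<Rightarrow> 'a \<Rightarrow> nat \<Rightarrow> real" where
  "diff_vec d H i = (\<lambda>t\<in>{..<d}. deg (slice (Suc t) H) i - deg (slice 0 H) i)"

text \<open>
  Some copy \<open>Suc t0\<close> enters the functional with a nonzero coefficient. If all the other copies are
  fixed, the event prescribes the degrees of all vertices of the tuple into this one copy, and
  \<open>joint_point_prob\<close> applies on \<open>B\<close>.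
\<close>

lemma pr_functional_vanishes:
  assumes B: "finite B" and rob: "robust m xs B" and m: "m > 0" and nz: "\<exists>t<d. l t \<noteq> 0"
  shows "pr (B \<times> {..<Suc d}) (\<lambda>H. \<forall>u<length xs. dot d l (diff_vec d H (xs ! u)) = 0)
     \<le> sqrt (2 ^ length xs / m) ^ length xs"
proof -
  define s where "s = length xs"
  obtain t0 where t0: "t0 < d" "l t0 \<noteq> 0" using nz by blast
  define I where "I = {..<Suc d} - {Suc t0}"
  have I: "{..<Suc d} = insert (Suc t0) I" "finite I" "Suc t0 \<notin> I" "0 \<in> I" using t0 by (auto simp: I_def)
  define v where "v j = (\<lambda>u\<in>{..<s}. a (xs ! u) j)" for j
  have "v ` B \<subseteq> (\<Pi>\<^sub>E u\<in>{..<s}. {0, 1})"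
  proof (rule image_subsetI)
    fix j
    have "a (xs ! u) j \<in> {0, 1}" for u using zero_one[of "xs ! u" j] by auto
    then show "v j \<in> (\<Pi>\<^sub>E u\<in>{..<s}. {0, 1})" by (simp add: v_def PiE_def)
  qed
  then have "card (v ` B) \<le> card (\<Pi>\<^sub>E u\<in>{..<s}. {0, 1::real})" by (intro card_mono finite_PiE) auto
  also have "\<dots> = 2 ^ s" by (simp add: card_PiE numeral_2_eq_2)
  finally have vcard: "real (card (v ` B)) \<le> 2 ^ s" by (metis of_nat_le_iff of_nat_numeral of_nat_power)
  have robv: "m \<le> card {j\<in>B. dot s (annihilator s ws) (v j) \<noteq> 0}" if ws: "length ws < s" for ws
  proof -
    have "\<exists>u<length xs. annihilator s ws u \<noteq> 0" using annihilator(1)[OF ws] by (simp add: s_def)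
    from rob[unfolded robust_def, rule_format, OF this]
    have "m \<le> card {j\<in>B. dot s (annihilator s ws) (\<lambda>u. a (xs ! u) j) \<noteq> 0}" unfolding s_def .
    moreover have "dot s (annihilator s ws) (\<lambda>u. a (xs ! u) j) = dot s (annihilator s ws) (v j)" for j
      by (rule dot_cong) (auto simp: v_def)
    ultimately show ?thesis by simp
  qed
  have point: "pr B (\<lambda>Z. \<forall>u<s. (\<Sum>j\<in>Z. v j u) = y u) \<le> sqrt (2 ^ s / m) ^ s" for y
    by (rule joint_point_prob[OF B vcard m robv])
  define P where "P H \<longleftrightarrow> (\<forall>u<s. dot d l (diff_vec d H (xs ! u)) = 0)" for H
  have cond: "pr B (\<lambda>Z. P (X \<union> (\<lambda>j. (j, Suc t0)) ` Z)) \<le> sqrt (2 ^ s / m) ^ s" if X: "X \<subseteq> B \<times> I" for X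
  proof -
    define K where "K u = (\<Sum>t\<in>{..<d} - {t0}. l t * deg (slice (Suc t) X) (xs ! u)) 
       - (\<Sum>t<d. l t) * deg (slice 0 X) (xs ! u)" for u
    have dot: "dot d l (diff_vec d (X \<union> (\<lambda>j. (j, Suc t0)) ` Z) (xs ! u)) = l t0 * deg Z (xs ! u) + K u" for Z u
    proof -
      define H where "H = X \<union> (\<lambda>j. (j, Suc t0)) ` Z"
      have sl: "slice (Suc t0) H = Z" "slice 0 H = slice 0 X" "\<And>t. t \<noteq> t0 \<Longrightarrow> slice (Suc t) H = slice (Suc t) X"
        using slice_outside[OF X I(3)] by (auto simp: H_def slice_Un slice_copy)
      have "dot d l (diff_vec d H (xs ! u))
         = (\<Sum>t<d. l t * deg (slice (Suc t) H) (xs ! u)) - (\<Sum>t<d. l t) * deg (slice 0 H) (xs ! u)"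
        by (simp add: dot_def diff_vec_def right_diff_distrib sum_subtractf sum_distrib_right)
      also have "(\<Sum>t<d. l t * deg (slice (Suc t) H) (xs ! u))
         = l t0 * deg (slice (Suc t0) H) (xs ! u) + (\<Sum>t\<in>{..<d} - {t0}. l t * deg (slice (Suc t) H) (xs ! u))"
        using t0 by (intro sum.remove) auto
      also have "(\<Sum>t\<in>{..<d} - {t0}. l t * deg (slice (Suc t) H) (xs ! u))
          = (\<Sum>t\<in>{..<d} - {t0}. l t * deg (slice (Suc t) X) (xs ! u))"
        by (intro sum.cong) (auto simp: sl)
      finally show ?thesis by (simp add: sl K_def flip: H_def)
    qed
    have "pr B (\<lambda>Z. P (X \<union> (\<lambda>j. (j, Suc t0)) ` Z)) \<le> pr B (\<lambda>Z. \<forall>u<s. (\<Sum>j\<in>Z. v j u) = - K u / l t0)"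
    proof (intro pr_mono allI impI)
      fix Z u assume P: "P (X \<union> (\<lambda>j. (j, Suc t0)) ` Z)" and u: "u < s"
      have "l t0 * deg Z (xs ! u) + K u = 0" using P u unfolding P_def dot by blast
      then have "deg Z (xs ! u) = - K u / l t0" using t0 by (simp add: field_simps)
      moreover have "deg Z (xs ! u) = (\<Sum>j\<in>Z. v j u)"
        using u sym by (simp add: deg_def v_def)
      ultimately show "(\<Sum>j\<in>Z. v j u) = - K u / l t0" by simp
    qed
    also note point
    finally show ?thesis .
  qed
  have "pr (B \<times> {..<Suc d}) P = avg (B \<times> I) (\<lambda>X. pr B (\<lambda>Z. P (X \<union> (\<lambda>j. (j, Suc t0)) ` Z)))"
    unfolding pr_def I(1) by (rule avg_split_copy[OF B I(2,3)])
  also have "\<dots> \<le> sqrt (2 ^ s / m) ^ s"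
    using B I(2) cond by (intro avg_le_const) auto
  finally show ?thesis by (simp add: P_def[abs_def] s_def)
qed

definition value_vectors :: "nat \<Rightarrow> nat \<Rightarrow> (nat \<Rightarrow> real) set" where
  "value_vectors b d = (\<Pi>\<^sub>E t\<in>{..<d}. of_int ` {- int b..int b})"

lemma value_vectors: "finite (value_vectors b d)" "card (value_vectors b d) = (2 * b + 1) ^ d"
proof -
  have "card (of_int ` {- int b..int b} :: real set) = card {- int b..int b}"
    by (rule card_image) (auto simp: inj_on_def)
  then show "card (value_vectors b d) = (2 * b + 1) ^ d"
    by (simp add: value_vectors_def card_PiE nat_add_distrib nat_mult_distrib)
  show "finite (value_vectors b d)" unfolding value_vectors_def by (intro finite_PiE) auto
qed

lemma diff_vec_in:
  assumes "finite B" "H \<subseteq> B \<times> I"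
  shows "diff_vec d H i \<in> value_vectors (card B) d"
proof -
  have "deg (slice t H) i - deg (slice 0 H) i \<in> of_int ` {- int (card B)..int (card B)}" for t
  proof -
    have b: "deg (slice t H) i \<in> \<int>" "0 \<le> deg (slice t H) i" "deg (slice t H) i \<le> card B" for t
    proof -
      have fin: "finite (slice t H)" "slice t H \<subseteq> B" using slice_subset[OF assms(2), of t] finite_subset[OF _ assms(1)] by auto
      show "deg (slice t H) i \<in> \<int>" unfolding deg_def by (intro Ints_sum Ints_a)
      show "0 \<le> deg (slice t H) i" unfolding deg_def using zero_one by (intro sum_nonneg) (metis order_refl zero_le_one)
      have "deg (slice t H) i \<le> (\<Sum>j\<in>slice t H. 1)" unfolding deg_def
        using abs_a_le_1 by (intro sum_mono) (metis abs_le_D1)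
      also have "\<dots> \<le> card B" using fin assms(1) by (simp add: card_mono)
      finally show "deg (slice t H) i \<le> card B" .
    qed
    have "deg (slice t H) i - deg (slice 0 H) i \<in> \<int>" using b(1) by (intro Ints_diff)
    then obtain k where k: "deg (slice t H) i - deg (slice 0 H) i = of_int k" by (elim Ints_cases)
    have "of_int k \<le> real (card B)" "- real (card B) \<le> of_int k"
      using b(2,3)[of t] b(2,3)[of 0] unfolding k[symmetric] by linarith+
    then have "k \<in> {- int (card B)..int (card B)}" by auto
    then show ?thesis unfolding k by blast
  qed
  then show ?thesis by (simp add: diff_vec_def value_vectors_def PiE_def)
qed

text \<open>
  The hypothesis under which \<open>joint_point_prob\<close> applies to the difference vectors of all vertices in the
  tuples \<open>F\<close>: since the tuples are disjoint, each functional is nonzero on at least \<open>card F\<close> of them.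
\<close>

definition generic :: "'a list set \<Rightarrow> nat \<Rightarrow> nat \<Rightarrow> ('a \<times> nat) set \<Rightarrow> bool" where
  "generic F b d H \<longleftrightarrow> (\<forall>ws. set ws \<subseteq> value_vectors b d \<longrightarrow> length ws < d \<longrightarrow>
     (\<forall>xs\<in>F. \<exists>u<length xs. dot d (annihilator d ws) (diff_vec d H (xs ! u)) \<noteq> 0))"

text \<open>
  A union bound over the functionals, determined by lists of fewer than \<open>d\<close> vectors, and over the tuples.
\<close>

lemma pr_not_generic:
  assumes B: "finite B" and F: "finite F" and rob: "\<And>xs. xs \<in> F \<Longrightarrow> length xs = s \<and> robust m xs B" and m: "m > 0"
  shows "pr (B \<times> {..<Suc d}) (\<lambda>H. \<not> generic F b d H)
    \<le> real (d * (2 * b + 1) ^ (d * d)) * (real (card F) * sqrt (2 ^ s / m) ^ s)"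
proof -
  define VV where "VV = value_vectors b d"
  define LL where "LL = {ws. set ws \<subseteq> VV \<and> length ws < d}"
  have LLsub: "LL \<subseteq> {ws. set ws \<subseteq> VV \<and> length ws \<le> d}" by (auto simp: LL_def)
  have "finite VV" unfolding VV_def by (rule value_vectors)
  then have finLL: "finite LL" by (rule finite_subset[OF LLsub finite_lists_length_le])
  have "LL = (\<Union>i<d. {ws. set ws \<subseteq> VV \<and> length ws = i})" by (auto simp: LL_def)
  then have "card LL \<le> (\<Sum>i<d. card {ws. set ws \<subseteq> VV \<and> length ws = i})" by (simp add: card_UN_le)
  also have "\<dots> = (\<Sum>i<d. ((2 * b + 1) ^ d) ^ i)"
    by (simp add: card_lists_length_eq value_vectors VV_def)
  also have "\<dots> \<le> (\<Sum>i<d. ((2 * b + 1) ^ d) ^ d)"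
    by (intro sum_mono power_increasing) auto
  also have "\<dots> = d * (2 * b + 1) ^ (d * d)" by (simp add: power_mult)
  finally have cLL: "real (card LL) \<le> real (d * (2 * b + 1) ^ (d * d))" by (rule of_nat_mono)
  define bad where "bad ws xs H \<longleftrightarrow> (\<forall>u<length xs. dot d (annihilator d ws) (diff_vec d H (xs ! u)) = 0)"
    for ws and xs :: "'a list" and H
  have one: "pr (B \<times> {..<Suc d}) (bad ws xs) \<le> sqrt (2 ^ s / m) ^ s" if "ws \<in> LL" "xs \<in> F" for ws xs
  proof -
    have "\<exists>t<d. annihilator d ws t \<noteq> 0" using that(1) by (intro annihilator) (simp add: LL_def)
    from pr_functional_vanishes[OF B _ m this, of xs] rob[OF that(2)]
    show ?thesis unfolding bad_def by simp
  qed
  have "pr (B \<times> {..<Suc d}) (\<lambda>H. \<not> generic F b d H) = pr (B \<times> {..<Suc d}) (\<lambda>H. \<exists>ws\<in>LL. \<exists>xs\<in>F. bad ws xs H)"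
    by (intro pr_cong) (auto simp: generic_def LL_def VV_def bad_def)
  also have "\<dots> \<le> real (card LL) * (real (card F) * sqrt (2 ^ s / m) ^ s)"
    by (rule pr_Bex[OF finLL], rule pr_Bex[OF F], rule one)
  also have "\<dots> \<le> real (d * (2 * b + 1) ^ (d * d)) * (real (card F) * sqrt (2 ^ s / m) ^ s)"
    using m by (intro mult_right_mono cLL) simp
  finally show ?thesis .
qed

lemma generic_point_prob:
  assumes A: "finite A" and B: "finite B" and H: "H \<subseteq> B \<times> I" and gen: "generic F (card B) d H"
    and F: "finite F" "F \<noteq> {}" "\<And>xs. xs \<in> F \<Longrightarrow> set xs \<subseteq> A"
    and disj: "\<And>xs ys. xs \<in> F \<Longrightarrow> ys \<in> F \<Longrightarrow> xs \<noteq> ys \<Longrightarrow> set xs \<inter> set ys = {}"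
  shows "pr A (\<lambda>X. \<forall>t<d. (\<Sum>i\<in>X. diff_vec d H i t) = y t) \<le> sqrt ((2 * real (card B) + 1) ^ d / real (card F)) ^ d"
proof (rule joint_point_prob[OF A])
  have sub: "diff_vec d H ` A \<subseteq> value_vectors (card B) d" using diff_vec_in[OF B H] by auto
  then have "card (diff_vec d H ` A) \<le> card (value_vectors (card B) d)"
    using value_vectors(1) by (intro card_mono)
  then have "real (card (diff_vec d H ` A)) \<le> real ((2 * card B + 1) ^ d)"
    unfolding value_vectors(2) by (rule of_nat_mono)
  then show "real (card (diff_vec d H ` A)) \<le> (2 * real (card B) + 1) ^ d" by (simp add: add.commute)
  show "real (card F) > 0" using F(1,2) by (simp add: card_gt_0_iff)
  fix ws assume ws: "set ws \<subseteq> diff_vec d H ` A" "length ws < d"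
  have "set ws \<subseteq> value_vectors (card B) d" using ws(1) sub by (rule order_trans)
  from gen[unfolded generic_def, rule_format, OF this ws(2)]
  have "\<forall>xs\<in>F. \<exists>u. u < length xs \<and> dot d (annihilator d ws) (diff_vec d H (xs ! u)) \<noteq> 0" by blast
  from bchoice[OF this] obtain \<upsilon> where
    \<upsilon>: "\<forall>xs\<in>F. \<upsilon> xs < length xs \<and> dot d (annihilator d ws) (diff_vec d H (xs ! \<upsilon> xs)) \<noteq> 0" ..
  have mem: "xs ! \<upsilon> xs \<in> set xs" if "xs \<in> F" for xs using \<upsilon> that by auto
  have inj: "inj_on (\<lambda>xs. xs ! \<upsilon> xs) F"
  proof (rule inj_onI)
    fix xs ys assume xy: "xs \<in> F" "ys \<in> F" "xs ! \<upsilon> xs = ys ! \<upsilon> ys"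
    show "xs = ys"
    proof (rule ccontr)
      assume "xs \<noteq> ys"
      from disj[OF xy(1,2) this] mem[OF xy(1)] mem[OF xy(2)] xy(3) show False
        by (metis disjoint_iff)
    qed
  qed
  have "card F = card ((\<lambda>xs. xs ! \<upsilon> xs) ` F)" using inj by (simp add: card_image)
  also have "\<dots> \<le> card {i\<in>A. dot d (annihilator d ws) (diff_vec d H i) \<noteq> 0}"
  proof (rule card_mono)
    show "finite {i\<in>A. dot d (annihilator d ws) (diff_vec d H i) \<noteq> 0}" using A by simp
    show "(\<lambda>xs. xs ! \<upsilon> xs) ` F \<subseteq> {i\<in>A. dot d (annihilator d ws) (diff_vec d H i) \<noteq> 0}"
    proof (rule image_subsetI, rule CollectI, rule conjI)
      fix xs assume xs: "xs \<in> F"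
      show "xs ! \<upsilon> xs \<in> A" using F(3)[OF xs] mem[OF xs] by (rule subsetD)
      show "dot d (annihilator d ws) (diff_vec d H (xs ! \<upsilon> xs)) \<noteq> 0" using \<upsilon>[rule_format, OF xs] by simp
    qed
  qed
  finally show "real (card F) \<le> real (card {i\<in>A. dot d (annihilator d ws) (diff_vec d H i) \<noteq> 0})" by simp
qed

text \<open>
  The power of the conditional probability is the probability that \<open>d + 1\<close> copies of the random subset of \<open>B\<close>
  all satisfy the condition. Nongeneric copies give the first summand. For generic ones the differences
  of the \<open>d + 1\<close> equations are linear in the subset of \<open>A\<close>, so \<open>generic_point_prob\<close> applies, while the
  conditions \<open>G\<close> contribute the factor \<open>pr B G ^ Suc d\<close>.
\<close>

lemma moment_bound:
  fixes G :: "'a set \<Rightarrow> bool"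
  assumes fin: "finite A" "finite B" "finite C" and dis: "A \<inter> C = {}" "(A \<union> C) \<inter> B = {}"
    and F: "finite F" "F \<noteq> {}" "\<And>xs. xs \<in> F \<Longrightarrow> set xs \<subseteq> A" "\<And>xs. xs \<in> F \<Longrightarrow> length xs = s \<and> robust m xs B"
    and disj: "\<And>xs ys. xs \<in> F \<Longrightarrow> ys \<in> F \<Longrightarrow> xs \<noteq> ys \<Longrightarrow> set xs \<inter> set ys = {}"
    and m: "m > 0"
  shows "avg (A \<union> C) (\<lambda>X. pr B (\<lambda>Y. G Y \<and> edge_weight l (X \<union> Y) = x) ^ Suc d)
    \<le> real (d * (2 * card B + 1) ^ (d * d)) * (real (card F) * sqrt (2 ^ s / m) ^ s)
      + pr B G ^ Suc d * sqrt ((2 * real (card B) + 1) ^ d / real (card F)) ^ d"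
proof -
  define \<sigma> where "\<sigma> = sqrt ((2 * real (card B) + 1) ^ d / real (card F)) ^ d"
  define BB where "BB = B \<times> {..<Suc d}"
  define S where "S X t H \<longleftrightarrow> edge_weight l (X \<union> slice t H) = x" for X t H
  have finD: "finite (A \<union> C)" using fin by simp
  have point: "pr (A \<union> C) (\<lambda>X. \<forall>t<Suc d. S X t H) \<le> \<sigma>" if H: "H \<subseteq> BB" and gen: "generic F (card B) d H" for H
  proof -
    have sl: "slice t H \<subseteq> B" "finite (slice t H)" for t
      using slice_subset[of H B "{..<Suc d}" t] H fin(2) finite_subset unfolding BB_def by auto
    have lin: "edge_weight l (X \<union> slice t H) = edge_weight l (slice t H) + edge_weight l X + (\<Sum>i\<in>X. deg (slice t H) i)"
      if X: "X \<subseteq> A \<union> C" for X t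
    proof -
      have d: "slice t H \<inter> X = {}" using sl(1)[of t] X dis(2) by blast
      have "finite X" using X finD finite_subset by blast
      from edge_weight_Un[OF sl(2)[of t] this d, of l] have "edge_weight l (X \<union> slice t H)
         = edge_weight l (slice t H) + edge_weight (\<lambda>j. l j + deg (slice t H) j) X" by (simp add: Un_commute)
      then show ?thesis by (simp add: edge_weight_def[of _ X] sum.distrib)
    qed
    have "pr A (\<lambda>X. \<forall>t<Suc d. S (Z \<union> X) t H) \<le> \<sigma>" if Z: "Z \<subseteq> C" for Z
    proof -
      define y where "y t = edge_weight l (slice 0 H) - edge_weight l (slice (Suc t) H) - (\<Sum>i\<in>Z. diff_vec d H i t)" for t
      have "pr A (\<lambda>X. \<forall>t<Suc d. S (Z \<union> X) t H) \<le> pr A (\<lambda>X. \<forall>t<d. (\<Sum>i\<in>X. diff_vec d H i t) = y t)"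
      proof (intro pr_mono allI impI)
        fix X t assume X: "X \<subseteq> A" and all: "\<forall>t<Suc d. S (Z \<union> X) t H" and t: "t < d"
        have ZX: "Z \<union> X \<subseteq> A \<union> C" using Z X by blast
        have f: "finite Z" "finite X" "Z \<inter> X = {}" using Z X fin dis(1) finite_subset by blast+
        have "S (Z \<union> X) (Suc t) H" "S (Z \<union> X) 0 H" using all t by auto
        then have "edge_weight l (slice (Suc t) H) + (\<Sum>i\<in>Z \<union> X. deg (slice (Suc t) H) i) 
            = edge_weight l (slice 0 H) + (\<Sum>i\<in>Z \<union> X. deg (slice 0 H) i)"
          unfolding S_def lin[OF ZX] by linarith
        moreover have "(\<Sum>i\<in>Z \<union> X. diff_vec d H i t)
            = (\<Sum>i\<in>Z \<union> X. deg (slice (Suc t) H) i) - (\<Sum>i\<in>Z \<union> X. deg (slice 0 H) i)"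
          using t by (simp add: diff_vec_def sum_subtractf)
        moreover have "(\<Sum>i\<in>Z \<union> X. diff_vec d H i t) = (\<Sum>i\<in>Z. diff_vec d H i t) + (\<Sum>i\<in>X. diff_vec d H i t)"
          by (rule sum.union_disjoint[OF f])
        ultimately show "(\<Sum>i\<in>X. diff_vec d H i t) = y t" unfolding y_def by linarith
      qed
      also have "\<dots> \<le> \<sigma>" unfolding \<sigma>_def
        by (rule generic_point_prob[OF fin(1,2) H[unfolded BB_def] gen F(1-3) disj])
      finally show ?thesis .
    qed
    then have "avg C (\<lambda>Z. pr A (\<lambda>X. \<forall>t<Suc d. S (Z \<union> X) t H)) \<le> \<sigma>"
      using fin(3) by (intro avg_le_const)
    moreover have "pr (C \<union> A) (\<lambda>X. \<forall>t<Suc d. S X t H) = avg C (\<lambda>Z. pr A (\<lambda>X. \<forall>t<Suc d. S (Z \<union> X) t H))"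
      unfolding pr_def using fin dis(1) by (intro avg_Un) auto
    ultimately show ?thesis by (simp add: Un_commute)
  qed
  have \<sigma>0: "\<sigma> \<ge> 0" by (simp add: \<sigma>_def)
  have bound: "avg (A \<union> C) (\<lambda>X. \<Prod>t<Suc d. of_bool (G (slice t H) \<and> S X t H))
     \<le> of_bool (\<not> generic F (card B) d H) + \<sigma> * (\<Prod>t<Suc d. of_bool (G (slice t H)))" if H: "H \<subseteq> BB" for H
  proof (cases "generic F (card B) d H")
    case False
    have "avg (A \<union> C) (\<lambda>X. \<Prod>t<Suc d. of_bool (G (slice t H) \<and> S X t H)) \<le> 1"
      using finD by (intro avg_le_const prod_le_1) auto
    moreover have "0 \<le> \<sigma> * (\<Prod>t<Suc d. of_bool (G (slice t H)))"
      using \<sigma>0 by (intro mult_nonneg_nonneg prod_nonneg) auto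
    moreover have "of_bool (\<not> generic F (card B) d H) = (1::real)" using False by simp
    ultimately show ?thesis by linarith
  next
    case True
    have prod_of_bool: "(\<Prod>t<n. of_bool (Q t)) = (of_bool (\<forall>t<n. Q t) :: real)" for n :: nat and Q
      by (induction n) (auto simp: less_Suc_eq)
    have "avg (A \<union> C) (\<lambda>X. \<Prod>t<Suc d. of_bool (G (slice t H) \<and> S X t H))
       = (\<Prod>t<Suc d. of_bool (G (slice t H))) * pr (A \<union> C) (\<lambda>X. \<forall>t<Suc d. S X t H)"
      unfolding pr_def avg_cmult[symmetric] prod_of_bool by (intro avg_cong) auto
    also have "\<dots> \<le> (\<Prod>t<Suc d. of_bool (G (slice t H))) * \<sigma>"
      by (intro mult_left_mono point H True prod_nonneg) auto
    finally show ?thesis using True by (simp add: mult.commute)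
  qed
  have "avg (A \<union> C) (\<lambda>X. pr B (\<lambda>Y. G Y \<and> edge_weight l (X \<union> Y) = x) ^ Suc d)
     = avg (A \<union> C) (\<lambda>X. avg BB (\<lambda>H. \<Prod>t<Suc d. of_bool (G (slice t H) \<and> S X t H)))"
    unfolding pr_def BB_def S_def avg_prod_slices[OF fin(2), symmetric] ..
  also have "\<dots> = avg BB (\<lambda>H. avg (A \<union> C) (\<lambda>X. \<Prod>t<Suc d. of_bool (G (slice t H) \<and> S X t H)))"
    by (rule avg_swap)
  also have "\<dots> \<le> avg BB (\<lambda>H. of_bool (\<not> generic F (card B) d H) + \<sigma> * (\<Prod>t<Suc d. of_bool (G (slice t H))))"
    by (rule avg_mono[OF bound])
  also have "\<dots> = pr BB (\<lambda>H. \<not> generic F (card B) d H) + \<sigma> * pr B G ^ Suc d"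
    by (simp only: avg_add avg_cmult pr_def BB_def avg_prod_slices[OF fin(2), of "Suc d" "\<lambda>Y. of_bool (G Y)"])
  also have "\<dots> \<le> real (d * (2 * card B + 1) ^ (d * d)) * (real (card F) * sqrt (2 ^ s / m) ^ s) + \<sigma> * pr B G ^ Suc d"
    unfolding BB_def by (intro add_mono order_refl pr_not_generic[OF fin(2) F(1) F(4) m])
  finally show ?thesis by (simp add: \<sigma>_def mult.commute)
qed

text \<open>
  Plays the role of Markov's inequality: it turns a bound for the moment of order \<open>d + 1\<close> of \<open>h\<close> into one
  for the mean of \<open>h\<close> over an event.
\<close>

lemma truncate_by_power:
  fixes h \<tau> :: real
  assumes "0 \<le> h" "0 < \<tau>"
  shows "h \<le> \<tau> + h ^ Suc d / \<tau> ^ d"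
proof (cases "h \<le> \<tau>")
  case False
  then have "\<tau> ^ d \<le> h ^ d" using assms by (intro power_mono) auto
  then have "h * \<tau> ^ d \<le> h * h ^ d" using assms by (intro mult_left_mono)
  then have "h \<le> h ^ Suc d / \<tau> ^ d" using assms by (simp add: field_simps)
  then show ?thesis using assms by linarith
qed (use assms in \<open>simp add: add_increasing2\<close>)

text \<open>
  Subsets \<open>Y\<close> of \<open>B\<close> are classified by a label: their cardinality, and their expected contribution \<open>g Y\<close> to the
  weight up to \<open>W\<close>. This is needed because the linear weights may make \<open>g\<close> vary much more than \<open>W\<close>. For a
  given label, total weight \<open>x\<close> forces the weight on \<open>D\<close> into an interval of length \<open>4 W\<close> and fixes the
  cardinality there, an event \<open>E\<close> of probability at most \<open>\<kappa>\<close>. On \<open>E\<close> the conditional probability \<open>h\<close>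
  is at most \<open>\<tau>\<close>, up to a correction governed by the moment bound. The threshold \<open>\<tau>\<close> is proportional to
  the probability \<open>P\<close> of the label, with the proportionality factor \<open>\<theta>\<close> as the desired conditional
  probability; since the \<open>P\<close> add up to \<open>1\<close>, the number of labels enters only through \<open>\<epsilon>\<close> and \<open>\<rho>\<close>.
\<close>

lemma point_prob_from_window_and_moment:
  assumes fin: "finite D" "finite B" and dis: "D \<inter> B = {}"
    and n: "real (card D) \<le> n" "n > 0" and Q: "Q \<ge> 0" and W: "W > 0" "real (card B) * Q + (real (card B))\<^sup>2 \<le> W"
    and coarse: "\<And>k y. pr D (\<lambda>U. card U = k \<and> \<bar>edge_weight l U - y\<bar> \<le> 2 * W) \<le> \<kappa>"
    and moment: "\<And>G. avg D (\<lambda>X. pr B (\<lambda>Y. G Y \<and> edge_weight l (X \<union> Y) = x) ^ Suc d) \<le> \<rho> + pr B G ^ Suc d * \<sigma>"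
    and pos: "\<theta> > 0" "\<epsilon> > 0" "\<rho> \<ge> 0" "\<sigma> \<ge> 0"
    and labels: "real (card ((\<lambda>Y. (\<lfloor>(\<Sum>j\<in>Y. l j + deg D j / 2) / W\<rfloor>, card Y)) ` Pow B)) \<le> nL"
  shows "pr (D \<union> B) (\<lambda>U. card U = k \<and> edge_weight l U = x)
    \<le> \<theta> * \<kappa> + nL * \<epsilon> * \<kappa> + \<sigma> / \<theta> ^ d + nL * \<rho> / \<epsilon> ^ d + real (card B) * (2 * exp (- 2 * Q\<^sup>2 / n))"
proof -
  define g where "g Y = (\<Sum>j\<in>Y. l j + deg D j / 2)" for Y
  define label where "label Y = (\<lfloor>g Y / W\<rfloor>, card Y)" for Y
  define Lab where "Lab = label ` Pow B"
  have Lab: "finite Lab" "real (card Lab) \<le> nL" using labels fin unfolding Lab_def label_def g_def by auto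
  define E where "E c X \<longleftrightarrow> card X + snd c = k \<and> \<bar>edge_weight l X - (x - of_int (fst c) * W)\<bar> \<le> 2 * W" for c X
  define h where "h c X = pr B (\<lambda>Y. label Y = c \<and> edge_weight l (X \<union> Y) = x)" for c X
  define P where "P c = pr B (\<lambda>Y. label Y = c)" for c
  define \<tau> where "\<tau> c = P c * \<theta> + \<epsilon>" for c
  have \<kappa>0: "\<kappa> \<ge> 0" using coarse[of 0 0] pr_nonneg by (rule order_trans[rotated])
  have P0: "P c \<ge> 0" for c by (simp add: P_def)
  have \<tau>: "\<tau> c > 0" "\<tau> c \<ge> P c * \<theta>" "\<tau> c \<ge> \<epsilon>" for c
    using P0[of c] pos by (auto simp: \<tau>_def intro!: add_nonneg_pos)
  have PrE: "pr D (E c) \<le> \<kappa>" for c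
  proof (cases "snd c \<le> k")
    case True
    have "pr D (E c) \<le> pr D (\<lambda>U. card U = k - snd c \<and> \<bar>edge_weight l U - (x - of_int (fst c) * W)\<bar> \<le> 2 * W)"
      by (rule pr_mono) (auto simp: E_def)
    also note coarse
    finally show ?thesis .
  next
    case False
    have "pr D (E c) \<le> pr D (\<lambda>U. card U = 0 \<and> \<bar>edge_weight l U - 0\<bar> \<le> 2 * W)"
      using False by (intro pr_mono) (auto simp: E_def)
    also note coarse
    finally show ?thesis .
  qed
  have sumP: "(\<Sum>c\<in>Lab. P c) = 1"
  proof -
    have "(\<Sum>c\<in>Lab. P c) = avg B (\<lambda>Y. \<Sum>c\<in>Lab. of_bool (label Y = c))"
      unfolding P_def pr_def avg_sum ..
    also have "\<dots> = avg B (\<lambda>Y. 1)"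
    proof (rule avg_cong[OF refl])
      fix Y assume "Y \<subseteq> B"
      then have "label Y \<in> Lab" by (auto simp: Lab_def)
      have "(\<Sum>c\<in>Lab. of_bool (label Y = c)) = (\<Sum>c\<in>Lab. if label Y = c then 1 else 0 :: real)"
        by (intro sum.cong) auto
      then show "(\<Sum>c\<in>Lab. of_bool (label Y = c)) = (1::real)"
        using Lab(1) \<open>label Y \<in> Lab\<close> by (simp add: sum.delta)
    qed
    finally show ?thesis using fin by simp
  qed
  have flat: "pr B (\<lambda>Y. card (X \<union> Y) = k \<and> edge_weight l (X \<union> Y) = x) \<le> (\<Sum>c\<in>Lab. of_bool (E c X) * h c X)"
    if X: "X \<subseteq> D" and bal: "balanced B D Q X" for X
  proof -
    have Xfin: "finite X" using X fin finite_subset by blast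
    have "of_bool (card (X \<union> Y) = k \<and> edge_weight l (X \<union> Y) = x)
        \<le> (\<Sum>c\<in>Lab. of_bool (E c X) * of_bool (label Y = c \<and> edge_weight l (X \<union> Y) = x) :: real)" if Y: "Y \<subseteq> B" for Y
    proof (cases "card (X \<union> Y) = k \<and> edge_weight l (X \<union> Y) = x")
      case True
      have Yfin: "finite Y" "X \<inter> Y = {}" using Y X fin dis finite_subset by blast+
      define b where "b = real (card B)"
      have cY: "real (card Y) \<le> b" using Y fin by (simp add: b_def card_mono)
      have "edge_weight l (X \<union> Y) = edge_weight l X + (\<Sum>j\<in>Y. l j + deg X j + deg Y j / 2)"
        using edge_weight_Un[OF Xfin Yfin, of l] by (simp add: edge_weight_def[of _ Y])
      also have "(\<Sum>j\<in>Y. l j + deg X j + deg Y j / 2) = g Y + (\<Sum>j\<in>Y. (deg X j - deg D j / 2) + deg Y j / 2)"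
        unfolding g_def by (simp add: sum.distrib sum_subtractf)
      finally have st: "edge_weight l (X \<union> Y) = edge_weight l X + g Y + (\<Sum>j\<in>Y. (deg X j - deg D j / 2) + deg Y j / 2)" by simp
      have "\<bar>\<Sum>j\<in>Y. (deg X j - deg D j / 2) + deg Y j / 2\<bar> \<le> (\<Sum>j\<in>Y. \<bar>(deg X j - deg D j / 2) + deg Y j / 2\<bar>)"
        by (rule sum_abs)
      also have "\<dots> \<le> (\<Sum>j\<in>Y. Q + b)"
      proof (rule sum_mono)
        fix j assume j: "j \<in> Y"
        have "\<bar>deg Y j\<bar> \<le> (\<Sum>i\<in>Y. \<bar>a i j\<bar>)" unfolding deg_def by (rule sum_abs)
        also have "\<dots> \<le> (\<Sum>i\<in>Y. 1)" by (rule sum_mono) (rule abs_a_le_1)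
        finally have "\<bar>deg Y j\<bar> \<le> b" using cY by simp
        moreover have "\<bar>deg X j - deg D j / 2\<bar> \<le> Q" using bal j Y unfolding balanced_def by blast
        ultimately show "\<bar>(deg X j - deg D j / 2) + deg Y j / 2\<bar> \<le> Q + b" by linarith
      qed
      also have "\<dots> \<le> b * (Q + b)" using cY Q by (simp add: mult_right_mono b_def)
      also have "\<dots> \<le> W" using W(2) by (simp add: b_def algebra_simps power2_eq_square)
      finally have e: "\<bar>\<Sum>j\<in>Y. (deg X j - deg D j / 2) + deg Y j / 2\<bar> \<le> W" .
      define f where "f = \<lfloor>g Y / W\<rfloor>"
      have "of_int f \<le> g Y / W" "g Y / W < of_int f + 1" unfolding f_def by linarith+
      then have "of_int f * W \<le> g Y" "g Y \<le> of_int f * W + W" using W(1) by (auto simp: field_simps)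
      then have "\<bar>edge_weight l X - (x - of_int f * W)\<bar> \<le> 2 * W"
        using st e True by linarith
      moreover have "card X + card Y = k" using True card_Un_disjoint[OF Xfin Yfin] by simp
      ultimately have E: "E (label Y) X" by (simp add: E_def label_def f_def)
      have "label Y \<in> Lab" using Y by (simp add: Lab_def)
      then have "of_bool (E (label Y) X) * of_bool (label Y = label Y \<and> edge_weight l (X \<union> Y) = x)
         \<le> (\<Sum>c\<in>Lab. of_bool (E c X) * of_bool (label Y = c \<and> edge_weight l (X \<union> Y) = x) :: real)"
        using Lab(1) by (intro member_le_sum[of "label Y" Lab "\<lambda>c. of_bool (E c X) * of_bool (label Y = c \<and> edge_weight l (X \<union> Y) = x)"]) auto
      then show ?thesis using E True by simp
    next
      case False
      then show ?thesis by (auto intro!: sum_nonneg)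
    qed
    then have "pr B (\<lambda>Y. card (X \<union> Y) = k \<and> edge_weight l (X \<union> Y) = x)
        \<le> avg B (\<lambda>Y. \<Sum>c\<in>Lab. of_bool (E c X) * of_bool (label Y = c \<and> edge_weight l (X \<union> Y) = x))"
      unfolding pr_def by (rule avg_mono)
    then show ?thesis by (simp only: avg_sum avg_cmult h_def pr_def)
  qed
  have step: "pr B (\<lambda>Y. card (X \<union> Y) = k \<and> edge_weight l (X \<union> Y) = x)
     \<le> of_bool (\<not> balanced B D Q X) + (\<Sum>c\<in>Lab. \<tau> c * of_bool (E c X) + 1 / \<tau> c ^ d * h c X ^ Suc d)"
    if X: "X \<subseteq> D" for X
  proof (cases "balanced B D Q X")
    case True
    note flat[OF X True]
    also have "(\<Sum>c\<in>Lab. of_bool (E c X) * h c X) \<le> (\<Sum>c\<in>Lab. \<tau> c * of_bool (E c X) + 1 / \<tau> c ^ d * h c X ^ Suc d)"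
    proof (rule sum_mono)
      fix c
      have h0: "0 \<le> h c X" by (simp add: h_def)
      have "0 \<le> 1 / \<tau> c ^ d * h c X ^ Suc d" using \<tau>(1)[of c] h0 by (intro mult_nonneg_nonneg) auto
      then show "of_bool (E c X) * h c X \<le> \<tau> c * of_bool (E c X) + 1 / \<tau> c ^ d * h c X ^ Suc d"
        using truncate_by_power[OF h0 \<tau>(1)[of c], of d] by (cases "E c X") auto
    qed
    finally show ?thesis using True by simp
  next
    case False
    have "pr B (\<lambda>Y. card (X \<union> Y) = k \<and> edge_weight l (X \<union> Y) = x) \<le> 1" using fin by (intro pr_le_1)
    moreover have "0 \<le> (\<Sum>c\<in>Lab. \<tau> c * of_bool (E c X) + 1 / \<tau> c ^ d * h c X ^ Suc d)"
      using \<tau>(1) by (intro sum_nonneg add_nonneg_nonneg mult_nonneg_nonneg) (auto simp: h_def less_imp_le)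
    moreover have "of_bool (\<not> balanced B D Q X) = (1::real)" using False by simp
    ultimately show ?thesis by linarith
  qed
  have mom: "1 / \<tau> c ^ d * avg D (\<lambda>X. h c X ^ Suc d) \<le> \<rho> / \<epsilon> ^ d + P c * (\<sigma> / \<theta> ^ d)" for c
  proof -
    have "1 / \<tau> c ^ d * avg D (\<lambda>X. h c X ^ Suc d) \<le> 1 / \<tau> c ^ d * (\<rho> + P c ^ Suc d * \<sigma>)"
      unfolding h_def P_def using \<tau>(1)[of c] by (intro mult_left_mono moment) simp
    also have "\<dots> = \<rho> / \<tau> c ^ d + P c * (P c ^ d * \<sigma> / \<tau> c ^ d)" by (simp add: field_simps add_divide_distrib)
    also have "\<dots> \<le> \<rho> / \<epsilon> ^ d + P c * (\<sigma> / \<theta> ^ d)"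
    proof (intro add_mono mult_left_mono P0)
      show "\<rho> / \<tau> c ^ d \<le> \<rho> / \<epsilon> ^ d" using pos \<tau>[of c]
        by (intro divide_left_mono power_mono) (auto intro!: mult_pos_pos)
      have "(P c * \<theta>) ^ d \<le> \<tau> c ^ d" using \<tau>[of c] P0[of c] pos by (intro power_mono) auto
      then have "P c ^ d * \<theta> ^ d * \<sigma> \<le> \<tau> c ^ d * \<sigma>" using pos by (simp add: power_mult_distrib mult_right_mono)
      then show "P c ^ d * \<sigma> / \<tau> c ^ d \<le> \<sigma> / \<theta> ^ d" using \<tau>(1)[of c] pos by (simp add: field_simps)
    qed
    finally show ?thesis .
  qed
  have "pr (D \<union> B) (\<lambda>U. card U = k \<and> edge_weight l U = x) 
      = avg D (\<lambda>X. pr B (\<lambda>Y. card (X \<union> Y) = k \<and> edge_weight l (X \<union> Y) = x))"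
    unfolding pr_def by (rule avg_Un[OF fin dis])
  also have "\<dots> \<le> avg D (\<lambda>X. of_bool (\<not> balanced B D Q X) + (\<Sum>c\<in>Lab. \<tau> c * of_bool (E c X) + 1 / \<tau> c ^ d * h c X ^ Suc d))"
    by (rule avg_mono[OF step])
  also have "\<dots> = pr D (\<lambda>X. \<not> balanced B D Q X) 
      + (\<Sum>c\<in>Lab. \<tau> c * pr D (E c) + 1 / \<tau> c ^ d * avg D (\<lambda>X. h c X ^ Suc d))"
    unfolding avg_add avg_sum avg_cmult pr_def ..
  also have "\<dots> \<le> real (card B) * (2 * exp (- 2 * Q\<^sup>2 / n))
      + (\<Sum>c\<in>Lab. \<tau> c * \<kappa> + (\<rho> / \<epsilon> ^ d + P c * (\<sigma> / \<theta> ^ d)))"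
    by (intro add_mono sum_mono mult_left_mono PrE mom pr_not_balanced[OF fin(2,1) n Q] less_imp_le[OF \<tau>(1)])
  also have "(\<Sum>c\<in>Lab. \<tau> c * \<kappa> + (\<rho> / \<epsilon> ^ d + P c * (\<sigma> / \<theta> ^ d)))
     = (\<Sum>c\<in>Lab. P c) * (\<theta> * \<kappa>) + real (card Lab) * (\<epsilon> * \<kappa>) + real (card Lab) * (\<rho> / \<epsilon> ^ d) + (\<Sum>c\<in>Lab. P c) * (\<sigma> / \<theta> ^ d)"
    unfolding \<tau>_def distrib_right sum.distrib sum_distrib_right mult.assoc by simp
  also have "\<dots> \<le> 1 * (\<theta> * \<kappa>) + nL * (\<epsilon> * \<kappa>) + nL * (\<rho> / \<epsilon> ^ d) + 1 * (\<sigma> / \<theta> ^ d)"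
    unfolding sumP using Lab(2) pos \<kappa>0
    by (intro add_mono order_refl mult_right_mono) auto
  finally show ?thesis by simp
qed

lemma card_window_labels:
  assumes B: "finite B" and D: "finite D" and W: "W \<ge> 1" and l: "\<And>j. \<bar>l j\<bar> \<le> \<Lambda>"
  shows "real (card ((\<lambda>Y. (\<lfloor>(\<Sum>j\<in>Y. l j + deg D j / 2) / W\<rfloor>, card Y)) ` Pow B))
     \<le> (2 * real (card B) * (\<Lambda> + real (card D)) + 3) * (real (card B) + 1)"
proof -
  define g where "g Y = (\<Sum>j\<in>Y. l j + deg D j / 2)" for Y
  define \<Gamma> where "\<Gamma> = real (card B) * (\<Lambda> + real (card D))"
  have L0: "\<Lambda> \<ge> 0" using l[of undefined] by linarith
  have gb: "\<bar>g Y / W\<bar> \<le> \<Gamma>" if Y: "Y \<subseteq> B" for Y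
  proof -
    have "\<bar>g Y\<bar> \<le> (\<Sum>j\<in>Y. \<bar>l j + deg D j / 2\<bar>)" unfolding g_def by (rule sum_abs)
    also have "\<dots> \<le> (\<Sum>j\<in>Y. \<Lambda> + real (card D))"
    proof (rule sum_mono)
      fix j
      have "\<bar>deg D j\<bar> \<le> (\<Sum>i\<in>D. \<bar>a i j\<bar>)" unfolding deg_def by (rule sum_abs)
      also have "\<dots> \<le> (\<Sum>i\<in>D. 1)" by (rule sum_mono) (rule abs_a_le_1)
      finally have "\<bar>deg D j\<bar> \<le> real (card D)" by simp
      then show "\<bar>l j + deg D j / 2\<bar> \<le> \<Lambda> + real (card D)" using l[of j] by linarith
    qed
    also have "\<dots> \<le> \<Gamma>" unfolding \<Gamma>_def using L0 card_mono[OF B Y] by (simp add: mult_right_mono)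
    finally have g: "\<bar>g Y\<bar> \<le> \<Gamma>" .
    have "\<bar>g Y / W\<bar> = \<bar>g Y\<bar> / W" using W by (simp add: abs_divide)
    also have "\<dots> \<le> \<bar>g Y\<bar> / 1" using W by (intro divide_left_mono) auto
    finally show ?thesis using g by simp
  qed
  have "(\<lambda>Y. (\<lfloor>g Y / W\<rfloor>, card Y)) ` Pow B \<subseteq> {\<lfloor>- \<Gamma>\<rfloor>..\<lfloor>\<Gamma>\<rfloor>} \<times> {..card B}"
  proof (rule image_subsetI)
    fix Y assume "Y \<in> Pow B"
    then have "- \<Gamma> \<le> g Y / W" "g Y / W \<le> \<Gamma>" "card Y \<le> card B"
      using gb[of Y] card_mono[OF B, of Y] abs_le_D1 abs_le_D2 by (auto dest: abs_le_D1 abs_le_D2 simp del: abs_divide)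
    then show "(\<lfloor>g Y / W\<rfloor>, card Y) \<in> {\<lfloor>- \<Gamma>\<rfloor>..\<lfloor>\<Gamma>\<rfloor>} \<times> {..card B}"
      by (auto intro: floor_mono)
  qed
  then have "card ((\<lambda>Y. (\<lfloor>g Y / W\<rfloor>, card Y)) ` Pow B) \<le> card ({\<lfloor>- \<Gamma>\<rfloor>..\<lfloor>\<Gamma>\<rfloor>} \<times> {..card B})"
    by (intro card_mono) auto
  also have "\<dots> = nat (\<lfloor>\<Gamma>\<rfloor> - \<lfloor>- \<Gamma>\<rfloor> + 1) * (card B + 1)" by (simp add: card_cartesian_product)
  finally have "real (card ((\<lambda>Y. (\<lfloor>g Y / W\<rfloor>, card Y)) ` Pow B)) \<le> real (nat (\<lfloor>\<Gamma>\<rfloor> - \<lfloor>- \<Gamma>\<rfloor> + 1)) * (real (card B) + 1)"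
    by (metis of_nat_1 of_nat_add of_nat_le_iff of_nat_mult)
  also have "\<dots> \<le> (2 * \<Gamma> + 3) * (real (card B) + 1)"
  proof (intro mult_right_mono)
    have "0 \<le> \<Gamma>" using L0 by (simp add: \<Gamma>_def)
    then have "0 \<le> \<lfloor>\<Gamma>\<rfloor> - \<lfloor>- \<Gamma>\<rfloor> + 1" by linarith
    then have "real (nat (\<lfloor>\<Gamma>\<rfloor> - \<lfloor>- \<Gamma>\<rfloor> + 1)) = of_int (\<lfloor>\<Gamma>\<rfloor> - \<lfloor>- \<Gamma>\<rfloor> + 1)" by (rule of_nat_nat)
    also have "\<dots> \<le> 2 * \<Gamma> + 3" unfolding of_int_add of_int_diff of_int_1 by linarith
    finally show "real (nat (\<lfloor>\<Gamma>\<rfloor> - \<lfloor>- \<Gamma>\<rfloor> + 1)) \<le> 2 * \<Gamma> + 3" .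
  qed auto
  finally show ?thesis by (simp add: g_def \<Gamma>_def mult.assoc)
qed

end

section \<open>Choice of scales\<close>

text \<open>
  All quantities are measured in powers of \<open>q\<close>, where \<open>q ^ (2 g)\<close> is the number of vertices; so \<open>q ^ g\<close> is
  its square root. The loss in the final estimate is \<open>q\<close> to a multiple of \<open>d\<close>, and \<open>g = d * d\<close> makes it
  negligible. The tuples have length \<open>s + 1\<close>; their length determines the exponent \<open>e\<close> in the
  probability of exceptional events and has to beat the polynomial losses caused by \<open>\<epsilon>\<close> in the second
  stage. The bound in \<open>hom\<close> makes \<open>extend_robust\<close> applicable with \<open>M = q powr (2 g - 1)\<close>.
\<close>

locale scaled_graph = adjacency a for a :: "'a \<Rightarrow> 'a \<Rightarrow> real" +
  fixes V :: "'a set" and q :: real and d g e s :: nat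
  assumes g: "g = d * d" and e: "e = (7 * g + 10) * d + 14 * g + 11" and s: "s = 4 * e" and d: "d \<ge> 3"
    and finV: "finite V" and cardV: "real (card V) = q powr (2 * real g)"
    and big: "q \<ge> 1000 * 16 ^ Suc s" and power_le_exp_q: "q powr (4 * real g + 10) \<le> exp q"
    and hom: "\<And>U. U \<subseteq> V \<Longrightarrow> homogeneous U \<Longrightarrow> real (card U) < q / (8 * (2 ^ Suc s * 2 ^ 2 ^ Suc s))"
begin

lemma g9: "g \<ge> 9"
proof -
  have "3 * 3 \<le> d * d" using d by (intro mult_mono) auto
  then show ?thesis by (simp add: g)
qed

lemma q1000: "q \<ge> 1000"
proof -
  have "(1000::real) * 1 \<le> 1000 * 16 ^ Suc s" by (intro mult_left_mono one_le_power) auto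
  then show ?thesis using big by linarith
qed

lemma q_pos [simp]: "q > 0" "q \<ge> 0" "q \<ge> 1" "q \<noteq> 0"
  using q1000 by auto

lemma q_powr_mono: "x \<le> y \<Longrightarrow> q powr x \<le> q powr y"
  by (simp add: powr_mono)

lemma q_powr_add: "q powr x * q powr y = q powr (x + y)"
  by (simp add: powr_add)

lemma q_powr_diff: "q powr x / q powr y = q powr (x - y)"
  by (simp add: powr_diff)

lemma q_powr_power: "(q powr x) ^ n = q powr (real n * x)"
  by (simp add: powr_realpow[symmetric] powr_powr mult.commute)

lemma q_powr_sqrt: "sqrt (q powr x) = q powr (x / 2)"
  by (simp add: powr_half_sqrt[symmetric] powr_powr)

text \<open>
  A constant factor costs at most one power of \<open>q\<close>.
\<close>

lemma q_powr_absorb: "c \<le> q \<Longrightarrow> x + 1 \<le> y \<Longrightarrow> c * q powr x \<le> q powr y"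
proof -
  assume c: "c \<le> q" and xy: "x + 1 \<le> y"
  have "c * q powr x \<le> q powr 1 * q powr x" using c by (intro mult_right_mono) auto
  also have "\<dots> = q powr (1 + x)" by (simp only: q_powr_add)
  also have "\<dots> \<le> q powr y" using xy by (intro q_powr_mono) simp
  finally show ?thesis .
qed

lemma one_le_q_powr: "x \<ge> 0 \<Longrightarrow> 1 \<le> q powr x"
  using q_powr_mono[of 0 x] by simp

lemma q_le_q_powr: "x \<ge> 1 \<Longrightarrow> q \<le> q powr x"
  using q_powr_mono[of 1 x] by simp

lemma exp_q_le: "exp (- q) \<le> q powr (- (4 * real g + 10))"
proof -
  have "inverse (exp q) \<le> inverse (q powr (4 * real g + 10))"
    using power_le_exp_q by (intro le_imp_inverse_le) auto
  then show ?thesis by (simp only: exp_minus powr_minus)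
qed

lemma q_powers: "4 * real (Suc s) \<le> q" "2 ^ Suc s \<le> q" "1000 * 16 ^ Suc s \<le> q" "8 * 2 ^ Suc s \<le> q"
   "1000 * 9 ^ Suc s \<le> q" "4 ^ Suc s \<le> q" "real d \<le> q"
proof -
  define p :: real where "p = 16 ^ Suc s"
  have p: "1000 * p \<le> q" unfolding p_def by (rule big)
  have p1: "p \<ge> 1" unfolding p_def by (rule one_le_power) simp
  have "real (Suc s) \<le> 2 ^ Suc s" using less_exp[of "Suc s"] by (metis less_imp_le of_nat_le_iff of_nat_numeral of_nat_power)
  moreover have two: "(2::real) ^ Suc s \<le> p" unfolding p_def by (rule power_mono) auto
  ultimately have ss: "real (Suc s) \<le> p" by linarith
  have four: "(4::real) ^ Suc s \<le> p" and nine: "(9::real) ^ Suc s \<le> p" unfolding p_def by (rule power_mono; simp)+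
  have "1 * d \<le> (7 * g + 10) * d" by (rule mult_right_mono) auto
  then have "d \<le> Suc s" using s e by linarith
  then have "real d \<le> real (Suc s)" by (rule of_nat_mono)
  then show "real d \<le> q" using ss p p1 by linarith
  have "4 * real (Suc s) \<le> 4 * p" by (rule mult_left_mono[OF ss]) simp
  also have "\<dots> \<le> q" using p p1 by linarith
  finally show "4 * real (Suc s) \<le> q" .
  show "2 ^ Suc s \<le> q" "8 * 2 ^ Suc s \<le> q" using mult_left_mono[OF two, of 8] two p p1 by linarith+
  show "4 ^ Suc s \<le> q" using four p p1 by linarith
  show "1000 * 9 ^ Suc s \<le> q" using mult_left_mono[OF nine, of 1000] p by linarith
  show "1000 * 16 ^ Suc s \<le> q" by (rule big)
qed

lemma tuples_exist:
  "\<exists>F. finite F \<and> card F \<le> card V \<and> q powr (2 * g) / (2 * real (Suc s)) \<le> card F \<and>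
     (\<forall>xs\<in>F. length xs = Suc s \<and> distinct xs \<and> set xs \<subseteq> V \<and> robust (q powr (2 * real g - 1)) xs V) \<and>
     (\<forall>xs\<in>F. \<forall>ys\<in>F. xs \<noteq> ys \<longrightarrow> set xs \<inter> set ys = {})"
proof -
  define K :: real where "K = 2 ^ Suc s * 2 ^ 2 ^ Suc s"
  have K: "K \<ge> 1" unfolding K_def by (intro mult_ge1_I one_le_power) auto
  define M where "M = q powr (2 * real g - 1)"
  have M1: "M \<ge> 1" unfolding M_def using g9 by (intro one_le_q_powr) simp
  have "q / (8 * K) * (M + 1) * K = q / 8 * (M + 1)" using K by simp
  also have "\<dots> \<le> q / 8 * (2 * M)" using M1 by (intro mult_left_mono) auto
  also have "\<dots> = (q powr 1 * q powr (2 * real g - 1)) / 4" by (simp add: M_def)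
  also have "\<dots> = q powr (2 * real g) / 4" unfolding q_powr_add by simp
  finally have 1: "q / (8 * K) * (M + 1) * K \<le> q powr (2 * real g) / 4" .
  have "4 * real (Suc s) \<le> q powr (2 * real g)"
    using q_powers(1) q_le_q_powr[of "2 * real g"] g9 by simp
  then have "real (Suc s) \<le> q powr (2 * real g) / 4" by simp
  with 1 have b: "q / (8 * K) * (M + 1) * K + real (Suc s) \<le> real (card V) / 2" unfolding cardV by linarith
  have "\<exists>F. finite F \<and> real (card V) / (2 * real (Suc s)) \<le> real (card F) \<and>
     (\<forall>xs\<in>F. length xs = Suc s \<and> distinct xs \<and> set xs \<subseteq> V \<and> robust M xs V) \<and>
     (\<forall>xs\<in>F. \<forall>ys\<in>F. xs \<noteq> ys \<longrightarrow> set xs \<inter> set ys = {})"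
  proof (rule disjoint_robust_tuples[OF finV])
    show "0 \<le> M" "0 < Suc s" using M1 by auto
    show "0 < q / (8 * K)" using K by (intro divide_pos_pos) auto
    show "real (card U) < q / (8 * K)" if "U \<subseteq> V" "homogeneous U" for U
      using hom[OF that] unfolding K_def .
    show "q / (8 * K) * (M + 1) * (2 ^ Suc s * 2 ^ 2 ^ Suc s) + real (Suc s) \<le> real (card V) / 2"
      using b unfolding K_def .
  qed
  then obtain F where F: "finite F" "real (card V) / (2 * real (Suc s)) \<le> real (card F)"
     and Ft: "\<forall>xs\<in>F. length xs = Suc s \<and> distinct xs \<and> set xs \<subseteq> V \<and> robust M xs V"
     and Fd: "\<forall>xs\<in>F. \<forall>ys\<in>F. xs \<noteq> ys \<longrightarrow> set xs \<inter> set ys = {}" by (elim exE conjE)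
  have hd: "xs ! 0 \<in> set xs" if "xs \<in> F" for xs using Ft[rule_format, OF that] by auto
  have "inj_on (\<lambda>xs. xs ! 0) F"
  proof (rule inj_onI, rule ccontr)
    fix xs ys assume xy: "xs \<in> F" "ys \<in> F" "xs ! 0 = ys ! 0" "xs \<noteq> ys"
    have "xs ! 0 \<in> set xs \<inter> set ys" using hd[OF xy(1)] hd[OF xy(2)] unfolding xy(3) by (rule IntI)
    then show False unfolding Fd[rule_format, OF xy(1,2,4)] by (rule emptyE)
  qed
  moreover have "(\<lambda>xs. xs ! 0) ` F \<subseteq> V"
  proof (rule image_subsetI)
    fix xs assume xs: "xs \<in> F"
    have "set xs \<subseteq> V" using Ft[rule_format, OF xs] by simp
    then show "xs ! 0 \<in> V" using hd[OF xs] by (rule subsetD)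
  qed
  ultimately have 1: "card F \<le> card V" using finV by (rule card_inj_on_le)
  have 2: "q powr (2 * g) / (2 * real (Suc s)) \<le> real (card F)" using F(2) unfolding cardV by simp
  show ?thesis
    by (rule exI[where x=F], rule conjI[OF F(1) conjI[OF 1 conjI[OF 2 conjI[OF Ft[unfolded M_def] Fd]]]])
qed

text \<open>
  A random set of about \<open>q\<^sup>3\<close> vertices meets each trace class with at least \<open>q powr (2 g - 1) / 2 ^ Suc s\<close>
  members in about \<open>q\<^sup>2\<close> vertices, up to a constant factor; that is more than \<open>q\<close>.
\<close>

lemma sample_exists:
  assumes F: "finite F" "card F \<le> card V"
    "\<And>xs. xs \<in> F \<Longrightarrow> length xs = Suc s \<and> robust (q powr (2 * real g - 1)) xs V"
  shows "\<exists>B\<subseteq>V. real (card B) \<le> q powr 4 \<and> (\<forall>xs\<in>F. robust q xs B)"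
proof -
  define M where "M = q powr (2 * real g - 1)"
  have M0: "M > 0" by (simp add: M_def)
  define cls where "cls p = {j\<in>V. trace (fst p) j = snd p}" for p
  define \<F> where "\<F> = cls ` {p \<in> F \<times> Pow {..<Suc s}. M / 2 ^ Suc s \<le> real (card (cls p))}"
  \<comment> \<open>Colour classes have about \<open>q powr 3\<close> elements.\<close>
  define r where "r = nat \<lfloor>q powr (2 * real g - 3)\<rfloor>"
  define m where "m = nat \<lceil>q\<rceil>"
  define \<beta> where "\<beta> = nat \<lfloor>q powr 4\<rfloor>"
  have r1: "real r \<le> q powr (2 * real g - 3)" unfolding r_def by simp
  have r2: "q powr (2 * real g - 3) \<le> 2 * real r"
  proof -
    have "1 \<le> q powr (2 * real g - 3)" using g9 by (intro one_le_q_powr) simp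
    then have "1 \<le> \<lfloor>q powr (2 * real g - 3)\<rfloor>" by linarith
    then show ?thesis unfolding r_def by linarith
  qed
  have r0: "r > 0"
  proof (rule ccontr)
    assume "\<not> r > 0"
    then show False using r2 powr_gt_zero[of q "2 * real g - 3"] by simp
  qed
  have m: "q \<le> real m" "real m \<le> 2 * q" unfolding m_def using q1000 by linarith+
  have \<beta>: "real \<beta> \<le> q powr 4" "q powr 4 - 1 \<le> real \<beta>" unfolding \<beta>_def by (simp, linarith)
  have fin: "finite \<F>" unfolding \<F>_def using F(1) by simp
  have card\<F>: "real (card \<F>) \<le> q powr (2 * real g + 1)"
  proof -
    have "card \<F> \<le> card (F \<times> Pow {..<Suc s})"
      unfolding \<F>_def using F(1) by (intro order_trans[OF card_image_le card_mono]) auto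
    also have "\<dots> = card F * 2 ^ Suc s" by (simp add: card_cartesian_product card_Pow)
    also have "\<dots> \<le> card V * 2 ^ Suc s" using F(2) by simp
    finally have "card \<F> \<le> card V * 2 ^ Suc s" .
    from of_nat_mono[OF this, where ?'a = real] have "real (card \<F>) \<le> real (card V) * 2 ^ Suc s"
      by simp
    also have "\<dots> = 2 ^ Suc s * q powr (2 * real g)" unfolding cardV by simp
    also have "\<dots> \<le> q powr (2 * real g + 1)" by (rule q_powr_absorb[OF q_powers(2)]) simp
    finally show ?thesis .
  qed
  have two_exp: "(2::real) ^ k \<le> exp (real k)" for k
  proof -
    have "(2::real) ^ k \<le> exp 1 ^ k" using exp_ge_add_one_self[of 1] by (intro power_mono) auto
    then show ?thesis by (simp flip: exp_of_nat_mult)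
  qed
  have exp_two: "exp (real k / 2) \<le> (2::real) ^ k" for k
  proof -
    have "exp (1/2) ^ 2 = exp (1::real)" by (simp flip: exp_of_nat_mult)
    also have "\<dots> \<le> 2 ^ 2" using exp_le by simp
    finally have "exp (1/2) \<le> (2::real)" by (rule power2_le_imp_le) simp
    then have "exp (1/2) ^ k \<le> (2::real) ^ k" by (intro power_mono) auto
    then show ?thesis by (simp flip: exp_of_nat_mult)
  qed
  define \<sigma> where "\<sigma> = M / 2 ^ Suc s"
  have first: "real (card \<F>) * (2 ^ m * exp (- \<sigma> / (2 * real r))) < 1 / 2"
  proof -
    have "4 * q \<le> \<sigma> / (2 * real r)"
    proof -
      have "4 * q * (2 * real r) * 2 ^ Suc s \<le> 4 * q * (2 * q powr (2 * real g - 3)) * 2 ^ Suc s"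
        using r1 by (intro mult_right_mono mult_left_mono) auto
      also have "\<dots> = (8 * 2 ^ Suc s) * (q powr 1 * q powr (2 * real g - 3))" by simp
      also have "\<dots> \<le> M" unfolding q_powr_add M_def by (rule q_powr_absorb[OF q_powers(4)]) simp
      finally have "4 * q * (2 * real r) \<le> \<sigma>" unfolding \<sigma>_def by (simp add: pos_le_divide_eq)
      then show ?thesis using r0 by (simp add: pos_le_divide_eq)
    qed
    then have "2 ^ m * exp (- \<sigma> / (2 * real r)) \<le> exp (2 * q) * exp (- (4 * q))"
      using two_exp[of m] m(2) by (intro mult_mono) (auto intro: order_trans)
    also have "\<dots> = exp (- q) * exp (- q)" by (simp flip: exp_add)
    also have "\<dots> \<le> q powr (- (4 * real g + 10)) * 1" by (intro mult_mono exp_q_le) auto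
    finally have "real (card \<F>) * (2 ^ m * exp (- \<sigma> / (2 * real r)))
        \<le> q powr (2 * real g + 1) * q powr (- (4 * real g + 10))"
      using card\<F> by (intro mult_mono) auto
    also have "\<dots> = q powr (- 2 * real g - 9)" unfolding q_powr_add by simp
    also have "\<dots> \<le> q powr (-1)" by (intro q_powr_mono) simp
    also have "\<dots> < 1 / 2" using q1000 by (simp add: powr_minus field_simps)
    finally show ?thesis .
  qed
  have second: "exp (real (card V) / real r) / 2 ^ \<beta> \<le> 1 / 2"
  proof -
    have "real (card V) \<le> 2 * q powr 3 * real r"
    proof -
      have "real (card V) = q powr 3 * q powr (2 * real g - 3)" unfolding cardV q_powr_add by simp
      also have "\<dots> \<le> q powr 3 * (2 * real r)" using r2 by (intro mult_left_mono) auto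
      finally show ?thesis by simp
    qed
    then have 1: "real (card V) / real r \<le> 2 * q powr 3" using r0 by (simp add: pos_divide_le_eq)
    have "1000 * q powr 3 \<le> q powr 4" using q1000 by (intro q_powr_absorb) auto
    moreover have "1 \<le> q powr 3" by (intro one_le_q_powr) simp
    ultimately have "real (card V) / real r \<le> real \<beta> / 2 + (- 1)" using 1 \<beta>(2) by linarith
    then have "exp (real (card V) / real r) \<le> exp (real \<beta> / 2) * exp (- 1)"
      by (simp flip: exp_add)
    also have "\<dots> \<le> 2 ^ \<beta> * (1 / 2)"
    proof (intro mult_mono exp_two)
      have "2 \<le> exp (1::real)" using exp_ge_add_one_self[of 1] by simp
      then show "exp (- 1) \<le> 1 / (2::real)" by (simp add: exp_minus field_simps)
    qed auto
    finally show ?thesis by (simp add: pos_divide_le_eq)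
  qed
  have "\<exists>B\<subseteq>V. card B \<le> \<beta> \<and> (\<forall>S\<in>\<F>. m \<le> card (B \<inter> S))"
  proof (rule exists_sample[OF finV r0 fin])
    show "S \<subseteq> V \<and> \<sigma> \<le> real (card S)" if "S \<in> \<F>" for S
      using that by (auto simp: \<F>_def \<sigma>_def cls_def)
    show "real (card \<F>) * (2 ^ m * exp (- \<sigma> / (2 * real r))) + exp (real (card V) / real r) / 2 ^ \<beta> < 1"
      using first second by linarith
  qed
  then obtain B where B: "B \<subseteq> V" "card B \<le> \<beta>" "\<And>S. S \<in> \<F> \<Longrightarrow> m \<le> card (B \<inter> S)" by blast
  have "robust q xs B" if xs: "xs \<in> F" for xs
  proof (rule robust_sample)
    have len: "length xs = Suc s" using F(3)[OF xs] by simp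
    show "robust M xs V" using F(3)[OF xs] unfolding M_def by simp
    show "finite V" by (rule finV)
    show "B \<subseteq> V" by (rule B(1))
    show "M > 0" by (rule M0)
    fix \<theta> assume th: "\<theta> \<subseteq> {..<length xs}" "M / 2 ^ length xs \<le> real (card {j\<in>V. trace xs j = \<theta>})"
    then have "cls (xs, \<theta>) \<in> \<F>" using xs unfolding \<F>_def len cls_def by (intro imageI) auto
    then have "m \<le> card (B \<inter> cls (xs, \<theta>))" by (rule B(3))
    moreover have "B \<inter> cls (xs, \<theta>) = {j\<in>B. trace xs j = \<theta>}" using B(1) by (auto simp: cls_def)
    ultimately have "real m \<le> real (card {j\<in>B. trace xs j = \<theta>})" by simp
    then show "q \<le> real (card {j\<in>B. trace xs j = \<theta>})" using m(1) by linarith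
  qed
  moreover have "real (card B) \<le> q powr 4" using B(2) \<beta>(1) by linarith
  ultimately show ?thesis using B(1) by blast
qed

text \<open>
  Disjoint robust tuples that avoid \<open>B\<close> are divided: about \<open>q powr (2 g - 8)\<close> of them make up \<open>C\<close>, the others
  lie in \<open>A\<close>. The set \<open>C\<close> has to be sufficiently smaller than \<open>V\<close>, so that the degrees inside \<open>C\<close>
  fluctuate less than the degrees into \<open>A\<close> and the tuples in \<open>C\<close> remain robust on \<open>A\<close>.
\<close>

lemma decomposition:
  obtains A B C FC FA where
    "finite A" "finite B" "finite C" "V = (A \<union> C) \<union> B" "A \<inter> C = {}" "(A \<union> C) \<inter> B = {}"
    "real (card B) \<le> q powr 4" "C \<noteq> {}" "real (card C) \<le> q powr (2 * real g - 7)"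
    "finite FC" "FC \<noteq> {}" "q powr (2 * real g - 8) \<le> real (card FC)" "real (card FC) \<le> 2 * q powr (2 * real g - 8)"
    "finite FA" "FA \<noteq> {}" "q powr (2 * real g - 1) \<le> real (card FA)" "real (card FA) \<le> q powr (2 * real g)"
    "\<And>xs. xs \<in> FC \<Longrightarrow> length xs = Suc s" "\<And>xs. xs \<in> FC \<Longrightarrow> set xs \<subseteq> C"
    "\<And>xs. xs \<in> FC \<Longrightarrow> robust (q powr (2 * real g - 1) / 2) xs A"
    "\<And>xs. xs \<in> FA \<Longrightarrow> set xs \<subseteq> A" "\<And>xs. xs \<in> FA \<Longrightarrow> length xs = Suc s \<and> robust q xs B"
    "\<And>xs ys. xs \<in> FC \<Longrightarrow> ys \<in> FC \<Longrightarrow> xs \<noteq> ys \<Longrightarrow> set xs \<inter> set ys = {}"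
    "\<And>xs ys. xs \<in> FA \<Longrightarrow> ys \<in> FA \<Longrightarrow> xs \<noteq> ys \<Longrightarrow> set xs \<inter> set ys = {}"
proof -
  define M where "M = q powr (2 * real g - 1)"
  from tuples_exist
  obtain F where F: "finite F" "card F \<le> card V" "q powr (2 * g) / (2 * real (Suc s)) \<le> card F"
     and Ft': "\<forall>xs\<in>F. length xs = Suc s \<and> distinct xs \<and> set xs \<subseteq> V \<and> robust (q powr (2 * real g - 1)) xs V"
     and Fd': "\<forall>xs\<in>F. \<forall>ys\<in>F. xs \<noteq> ys \<longrightarrow> set xs \<inter> set ys = {}"
    by (elim exE conjE)
  have Flen: "length xs = Suc s" and Fsub: "set xs \<subseteq> V" and Frob: "robust M xs V" if "xs \<in> F" for xs
    using Ft'[rule_format, OF that] unfolding M_def by simp_all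
  note Fd = Fd'[rule_format]
  have "\<exists>B\<subseteq>V. real (card B) \<le> q powr 4 \<and> (\<forall>xs\<in>F. robust q xs B)"
    by (rule sample_exists[OF F(1,2)]) (use Flen Frob in \<open>simp add: M_def\<close>)
  then obtain B where B: "B \<subseteq> V" "real (card B) \<le> q powr 4" "\<forall>xs\<in>F. robust q xs B" by (elim exE conjE)
  have finB: "finite B" using B(1) finV finite_subset by blast
  define F1 where "F1 = {xs\<in>F. set xs \<inter> B = {}}"
  define F2 where "F2 = {xs\<in>F. set xs \<inter> B \<noteq> {}}"
  have F12: "F = F1 \<union> F2" "F1 \<inter> F2 = {}" "finite F1" "finite F2" using F(1) by (auto simp: F1_def F2_def)
  have "card F2 \<le> card B"
  proof -
    have "\<forall>xs\<in>F2. \<exists>b. b \<in> set xs \<and> b \<in> B" by (auto simp: F2_def)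
    from bchoice[OF this] obtain f where f: "\<forall>xs\<in>F2. f xs \<in> set xs \<and> f xs \<in> B" ..
    have "inj_on f F2"
    proof (rule inj_onI, rule ccontr)
      fix xs ys assume xy: "xs \<in> F2" "ys \<in> F2" "f xs = f ys" "xs \<noteq> ys"
      then have "xs \<in> F" "ys \<in> F" by (auto simp: F2_def)
      note Fd[OF this xy(4)]
      moreover have "f xs \<in> set xs \<inter> set ys"
        using f[rule_format, OF xy(1)] f[rule_format, OF xy(2)] unfolding xy(3) by (intro IntI) simp_all
      ultimately show False by simp
    qed
    moreover have "f ` F2 \<subseteq> B" using f by blast
    ultimately show ?thesis using finB by (rule card_inj_on_le)
  qed
  then have cF1: "real (card F) - q powr 4 \<le> real (card F1)"
    using card_Un_disjoint[OF F12(3,4,2)] F12(1) B(2) by simp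
  have cF: "2 * M \<le> real (card F)"
  proof -
    have "(2 * (2 * real (Suc s))) * q powr (2 * real g - 1) \<le> q powr (2 * real g)"
      using q_powers(1) by (intro q_powr_absorb) auto
    then have "2 * M * (2 * real (Suc s)) \<le> q powr (2 * real g)" unfolding M_def by (simp only: mult_ac)
    then have "2 * M \<le> q powr (2 * g) / (2 * real (Suc s))" by (subst pos_le_divide_eq) simp_all
    then show ?thesis using F(3) by linarith
  qed
  define n where "n = nat \<lceil>q powr (2 * real g - 8)\<rceil>"
  have one: "1 \<le> q powr (2 * real g - 8)" using g9 by (intro one_le_q_powr) simp
  have n: "q powr (2 * real g - 8) \<le> real n" "real n \<le> 2 * q powr (2 * real g - 8)"
    unfolding n_def using one by linarith+
  have q4: "q powr 4 \<le> M / 1000" 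
    using q_powr_absorb[of 1000 4 "2 * real g - 1"] q1000 g9 by (simp add: M_def)
  have q8: "q powr (2 * real g - 8) \<le> M / 1000"
    using q_powr_absorb[of 1000 "2 * real g - 8" "2 * real g - 1"] q1000 by (simp add: M_def)
  have M0: "M > 0" by (simp add: M_def)
  have "real n \<le> real (card F1)" using cF1 cF q4 q8 n(2) M0 by linarith
  then have "n \<le> card F1" by simp
  then obtain FC where FC: "FC \<subseteq> F1" "card FC = n" "finite FC" by (rule obtain_subset_with_card_n)
  define FA where "FA = F1 - FC"
  define C where "C = (\<Union>xs\<in>FC. set xs)"
  define A where "A = V - B - C"
  have FCF: "FC \<subseteq> F" "FA \<subseteq> F" using FC(1) F12(1) by (auto simp: FA_def)
  have CV: "C \<subseteq> V - B" unfolding C_def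
  proof (rule UN_least)
    fix xs assume "xs \<in> FC"
    then have "xs \<in> F" "set xs \<inter> B = {}" using FC(1) by (auto simp: F1_def)
    then show "set xs \<subseteq> V - B" using Fsub[of xs] by (simp add: disjoint_iff subset_iff)
  qed
  have finC: "finite C" using FC(3) by (simp add: C_def)
  have cFA: "M \<le> real (card FA)"
  proof -
    have "real (card FA) = real (card F1) - real n"
      unfolding FA_def using FC F12(3) \<open>n \<le> card F1\<close> by (simp add: card_Diff_subset of_nat_diff)
    then show ?thesis using cF1 cF q4 q8 n(2) M0 by linarith
  qed
  have cC: "real (card C) \<le> q powr (2 * real g - 7)"
  proof -
    have "card C \<le> (\<Sum>xs\<in>FC. card (set xs))" unfolding C_def using FC(3) by (intro card_UN_le)
    also have "\<dots> \<le> (\<Sum>xs\<in>FC. Suc s)"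
    proof (rule sum_mono)
      fix xs assume "xs \<in> FC"
      then have "length xs = Suc s" using FCF(1) Flen by blast
      then show "card (set xs) \<le> Suc s" using card_length[of xs] by simp
    qed
    also have "\<dots> = n * Suc s" using FC(2) by simp
    finally have "real (card C) \<le> real n * real (Suc s)" by (metis of_nat_le_iff of_nat_mult)
    also have "\<dots> \<le> (2 * q powr (2 * real g - 8)) * real (Suc s)" using n(2) by (intro mult_right_mono) auto
    also have "\<dots> = (2 * real (Suc s)) * q powr (2 * real g - 8)" by simp
    also have "\<dots> \<le> q powr (2 * real g - 7)" using q_powers(1) by (intro q_powr_absorb) auto
    finally show ?thesis .
  qed
  have robA: "robust (M / 2) xs A" if "xs \<in> FC" for xs
  proof -
    have "robust M xs V" by (rule Frob) (use that FCF in blast)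
    moreover have "B \<union> C \<subseteq> V" using B(1) CV by blast
    moreover have "M / 2 + real (card (B \<union> C)) \<le> M"
    proof -
      have "real (card (B \<union> C)) \<le> real (card B) + real (card C)" using card_Un_le[of B C] by linarith
      moreover have "1000 * q powr (2 * real g - 7) \<le> M" unfolding M_def using q1000 by (intro q_powr_absorb) auto
      ultimately show ?thesis using B(2) cC q4 M0 by linarith
    qed
    ultimately have "robust (M / 2) xs (V - (B \<union> C))" using finV by (intro robust_Diff)
    then show ?thesis by (simp add: A_def Diff_Diff_Int Diff_eq Int_assoc)
  qed
  have setA: "set xs \<subseteq> A" if xs: "xs \<in> FA" for xs
  proof -
    have "xs \<in> F" "xs \<in> F1" "xs \<notin> FC" using xs FCF by (auto simp: FA_def)
    moreover have "set xs \<inter> C = {}"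
    proof -
      have "set xs \<inter> set ys = {}" if "ys \<in> FC" for ys
      proof (rule Fd)
        show "xs \<in> F" "ys \<in> F" using \<open>xs \<in> F\<close> that FCF by auto
        show "xs \<noteq> ys" using \<open>xs \<notin> FC\<close> that by blast
      qed
      then show ?thesis unfolding C_def by blast
    qed
    moreover have "set xs \<inter> B = {}" using \<open>xs \<in> F1\<close> by (simp add: F1_def)
    ultimately show ?thesis using Fsub[OF \<open>xs \<in> F\<close>] unfolding A_def by (simp add: disjoint_iff subset_iff)
  qed
  show ?thesis
  proof (rule that[of A B C FC FA])
    show "finite A" "finite B" "finite C" using finV finB finC by (auto simp: A_def)
    show "V = (A \<union> C) \<union> B" using B(1) CV by (auto simp: A_def)
    show "A \<inter> C = {}" "(A \<union> C) \<inter> B = {}" using CV by (auto simp: A_def)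
    show "real (card B) \<le> q powr 4" "real (card C) \<le> q powr (2 * real g - 7)" by fact+
    show FCne: "FC \<noteq> {}" using n(1) one FC(2) by auto
    show "C \<noteq> {}"
    proof -
      obtain xs where xs: "xs \<in> FC" using FCne by blast
      then have "length xs = Suc s" using FCF(1) Flen by blast
      then have ne: "set xs \<noteq> {}" by auto
      have "set xs \<subseteq> C" unfolding C_def using xs by (rule UN_upper)
      then show ?thesis using ne subset_empty by (metis (no_types))
    qed
    show "finite FC" "finite FA" using FC F12(3) by (auto simp: FA_def)
    show "q powr (2 * real g - 8) \<le> real (card FC)" "real (card FC) \<le> 2 * q powr (2 * real g - 8)"
      using n FC(2) by auto
    show "FA \<noteq> {}" using cFA M0 by auto
    show "q powr (2 * real g - 1) \<le> real (card FA)" using cFA by (simp add: M_def)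
    show "real (card FA) \<le> q powr (2 * real g)"
    proof -
      have "card FA \<le> card F" using FCF F(1) by (intro card_mono)
      then show ?thesis using F(2) cardV by linarith
    qed
    show "length xs = Suc s" "set xs \<subseteq> C" "robust (q powr (2 * real g - 1) / 2) xs A" if "xs \<in> FC" for xs
    proof -
      show "length xs = Suc s" by (rule Flen) (use that FCF in blast)
      show "set xs \<subseteq> C" unfolding C_def using that by (rule UN_upper)
      show "robust (q powr (2 * real g - 1) / 2) xs A" using robA[OF that] by (simp add: M_def)
    qed
    show "set xs \<subseteq> A" if "xs \<in> FA" for xs using setA[OF that] .
    show "length xs = Suc s \<and> robust q xs B" if "xs \<in> FA" for xs
      using Flen B(3) that FCF(2) by (simp add: subset_iff)
    show "set xs \<inter> set ys = {}" if "xs \<in> FC" "ys \<in> FC" "xs \<noteq> ys" for xs ys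
      by (rule Fd) (use that FCF in blast)+
    show "set xs \<inter> set ys = {}" if "xs \<in> FA" "ys \<in> FA" "xs \<noteq> ys" for xs ys
      by (rule Fd) (use that FCF in blast)+
  qed
qed

end

section \<open>The point probability at the chosen scales\<close>

context scaled_graph
begin

lemma exponents: "real e = (7 * real g + 10) * real d + 14 * real g + 11" "real g = real d * real d"
  "real g \<ge> 9" "real d \<ge> 3"
proof -
  show "real e = (7 * real g + 10) * real d + 14 * real g + 11" by (simp add: e)
  show "real g = real d * real d" by (simp add: g)
  show "real g \<ge> 9" "real d \<ge> 3" using g9 d by linarith+
qed

lemma sqrt_power_4: "x \<ge> 0 \<Longrightarrow> sqrt x ^ 4 = x\<^sup>2"
  using real_sqrt_pow2[of x] by (simp add: power4_eq_xxxx power2_eq_square)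

text \<open>
  The factor \<open>4\<close> in \<open>s = 4 * e\<close> absorbs that the base is only known to be below \<open>q powr (- 1 / 4)\<close>.
\<close>

lemma power_s_le:
  assumes "x \<ge> 0" "x ^ 4 \<le> q powr (-1)"
  shows "x ^ s \<le> q powr (- real e)"
proof -
  have "x ^ s = (x ^ 4) ^ e" by (simp add: s power_mult)
  also have "\<dots> \<le> (q powr (-1)) ^ e" using assms by (intro power_mono) auto
  finally show ?thesis unfolding q_powr_power by simp
qed

text \<open>
  The window has length about \<open>q powr (g + 6)\<close>. Degree gaps \<open>L\<close> are just below the standard deviation
  \<open>q powr g\<close> of the degrees into \<open>A\<close>, while \<open>R\<close> exceeds the standard deviation of the degrees inside \<open>C\<close>.
\<close>

lemma coarse_scale:
  assumes fin: "finite A" "finite C" and dis: "A \<inter> C = {}" and AC: "q powr (2 * real g) \<le> 4 * real (card (A \<union> C))"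
    and C: "C \<noteq> {}" "real (card C) \<le> q powr (2 * real g - 7)"
    and FC: "finite FC" "FC \<noteq> {}" "q powr (2 * real g - 8) \<le> real (card FC)" "real (card FC) \<le> 2 * q powr (2 * real g - 8)"
    and tup: "\<And>xs. xs \<in> FC \<Longrightarrow> length xs = Suc s" "\<And>xs. xs \<in> FC \<Longrightarrow> set xs \<subseteq> C"
      "\<And>xs. xs \<in> FC \<Longrightarrow> robust (q powr (2 * real g - 1) / 2) xs A"
    and disj: "\<And>xs ys. xs \<in> FC \<Longrightarrow> ys \<in> FC \<Longrightarrow> xs \<noteq> ys \<Longrightarrow> set xs \<inter> set ys = {}"
  shows "pr (A \<union> C) (\<lambda>U. card U = k \<and> \<bar>edge_weight l U - y\<bar> \<le> 2 * q powr (real g + 6)) \<le> q powr (12 - 2 * real g)"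
proof -
  define W where "W = 2 * q powr (real g + 6)"
  define L where "L = q powr (real g - 1)"
  define R where "R = q powr (real g - 2)"
  define M where "M = q powr (2 * real g - 1) / 2"
  define n where "n = q powr (2 * real g - 6)"
  have pos: "L > 0" "R \<ge> 0" "W \<ge> 0" "M > 0" "n > 0" by (simp_all add: L_def R_def W_def M_def n_def)
  have RL: "4 * R \<le> L" unfolding R_def L_def using q1000 by (intro q_powr_absorb) auto
  have Cn: "real (card C) \<le> n" unfolding n_def using C(2) by (rule order_trans) (intro q_powr_mono, simp)
  have T1: "(4 * W / L + 1) / sqrt (real (card FC) / 4) / sqrt (real (card (A \<union> C))) \<le> 36 * q powr (11 - 2 * real g)"
  proof -
    have "4 * W / L = 8 * (q powr (real g + 6) / q powr (real g - 1))" by (simp add: W_def L_def)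
    also have "\<dots> = 8 * q powr 7" unfolding q_powr_diff by simp
    finally have num: "4 * W / L + 1 \<le> 9 * q powr 7" using one_le_q_powr[of 7] by linarith
    have "sqrt (q powr (2 * real g - 8) / 4) \<le> sqrt (real (card FC) / 4)" using FC(3) by (intro real_sqrt_le_mono) simp
    then have d1: "q powr (real g - 4) / 2 \<le> sqrt (real (card FC) / 4)"
      unfolding real_sqrt_divide q_powr_sqrt by (simp add: diff_divide_distrib)
    have "sqrt (q powr (2 * real g) / 4) \<le> sqrt (real (card (A \<union> C)))" using AC by (intro real_sqrt_le_mono) simp
    then have d2: "q powr real g / 2 \<le> sqrt (real (card (A \<union> C)))"
      unfolding real_sqrt_divide q_powr_sqrt by simp
    have step: "(4 * W / L + 1) / sqrt (real (card FC) / 4) \<le> 9 * q powr 7 / (q powr (real g - 4) / 2)"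
    proof (rule frac_le)
      show "0 \<le> 9 * q powr 7" "0 < q powr (real g - 4) / 2" by simp_all
    qed (rule num, rule d1)
    have "(4 * W / L + 1) / sqrt (real (card FC) / 4) / sqrt (real (card (A \<union> C)))
       \<le> 9 * q powr 7 / (q powr (real g - 4) / 2) / (q powr real g / 2)"
    proof (rule frac_le)
      show "0 \<le> 9 * q powr 7 / (q powr (real g - 4) / 2)" "0 < q powr real g / 2" by simp_all
    qed (rule step, rule d2)
    also have "\<dots> = 36 * (q powr 7 / q powr (real g - 4) / q powr real g)" by simp
    also have "\<dots> = 36 * q powr (11 - 2 * real g)" unfolding q_powr_diff by (simp add: algebra_simps)
    finally show ?thesis .
  qed
  have expq': "exp (- z) \<le> q powr (- (4 * real g + 10))" if "q \<le> z" for z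
    using exp_q_le that by (smt (verit) exp_le_cancel_iff)
  have T2: "2 * exp (- (real (card FC) / 8)) \<le> 2 * q powr (11 - 2 * real g)"
  proof -
    have "8 * q powr 1 \<le> q powr (2 * real g - 8)" using q1000 g9 by (intro q_powr_absorb) auto
    then have "q \<le> real (card FC) / 8" using FC(3) by simp
    from expq'[OF this] have "exp (- (real (card FC) / 8)) \<le> q powr (11 - 2 * real g)"
      by (rule order_trans) (intro q_powr_mono, simp)
    then show ?thesis by simp
  qed
  have T3: "real (card C) * (2 * exp (- 2 * R\<^sup>2 / n)) \<le> 2 * q powr (11 - 2 * real g)"
  proof -
    have "R\<^sup>2 / n = q powr (2 * (real g - 2)) / q powr (2 * real g - 6)" unfolding R_def n_def q_powr_power by simp
    also have "\<dots> = q powr 2" unfolding q_powr_diff by simp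
    finally have "2 * R\<^sup>2 / n = 2 * q powr 2" by (simp only: times_divide_eq_right[symmetric])
    moreover have "q \<le> q powr 2" by (rule q_le_q_powr) simp
    ultimately have "q \<le> 2 * R\<^sup>2 / n" using q1000 by linarith
    from expq'[OF this] have "real (card C) * (2 * exp (- 2 * R\<^sup>2 / n)) \<le> q powr (2 * real g - 7) * (2 * q powr (- (4 * real g + 10)))"
      using C(2) by (intro mult_mono) auto
    also have "\<dots> = 2 * (q powr (2 * real g - 7) * q powr (- (4 * real g + 10)))" by simp
    also have "\<dots> \<le> 2 * q powr (11 - 2 * real g)" unfolding q_powr_add by (intro mult_left_mono q_powr_mono) auto
    finally show ?thesis .
  qed
  have T4: "real (card FC) * ((2 * L + 1) * sqrt (3 ^ s / M)) ^ s \<le> 2 * q powr (11 - 2 * real g)"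
  proof -
    define z where "z = (2 * L + 1) * sqrt (3 ^ s / M)"
    have z0: "z \<ge> 0" using pos by (simp add: z_def)
    have L1: "1 \<le> L" unfolding L_def using g9 by (intro one_le_q_powr) simp
    have "z ^ 4 = (2 * L + 1) ^ 4 * (3 ^ s / M)\<^sup>2"
      using pos by (simp add: z_def power_mult_distrib sqrt_power_4)
    also have "\<dots> \<le> (3 * L) ^ 4 * (3 ^ s / M)\<^sup>2"
      using L1 by (intro mult_right_mono power_mono) auto
    also have "\<dots> = (324 * 9 ^ s) * (L ^ 4 / (q powr (2 * real g - 1))\<^sup>2)"
    proof -
      have "(3 ^ s)\<^sup>2 = (9::real) ^ s" by (simp add: power2_eq_square flip: power_mult_distrib)
      then show ?thesis unfolding M_def by (simp add: power_mult_distrib power_divide)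
    qed
    also have "L ^ 4 / (q powr (2 * real g - 1))\<^sup>2 = q powr (-2)" unfolding L_def q_powr_power q_powr_diff by simp
    also have "(324 * 9 ^ s) * q powr (-2) \<le> q powr (-1)"
    proof (rule q_powr_absorb)
      have "(324::real) * 9 ^ s \<le> 1000 * 9 ^ Suc s" by simp
      then show "324 * 9 ^ s \<le> q" using q_powers(5) by linarith
    qed simp
    finally have "z ^ s \<le> q powr (- real e)" using z0 by (intro power_s_le)
    then have "real (card FC) * z ^ s \<le> 2 * q powr (2 * real g - 8) * q powr (- real e)"
      using FC(4) z0 by (intro mult_mono) auto
    also have "\<dots> = 2 * (q powr (2 * real g - 8) * q powr (- real e))" by simp
    also have "\<dots> \<le> 2 * q powr (11 - 2 * real g)" unfolding q_powr_add
    proof (intro mult_left_mono q_powr_mono)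
      have "0 \<le> (7 * real g + 10) * real d" by simp
      then show "2 * real g - 8 + - real e \<le> 11 - 2 * real g" unfolding exponents(1) using exponents(3) by linarith
    qed auto
    finally show ?thesis by (simp add: z_def)
  qed
  have "pr (A \<union> C) (\<lambda>U. card U = k \<and> \<bar>edge_weight l U - y\<bar> \<le> W)
    \<le> (4 * W / L + 1) / sqrt (real (card FC) / 4) / sqrt (real (card (A \<union> C)))
      + 2 * exp (- (real (card FC) / 8)) + real (card C) * (2 * exp (- 2 * R\<^sup>2 / n))
      + real (card FC) * ((2 * L + 1) * sqrt (3 ^ s / M)) ^ s"
    by (rule coarse_anticoncentration[OF fin C(1) dis Cn FC(1,2) tup(1,2) tup(3)[folded M_def] disj pos(1,2) RL pos(3,4)])
  also have "\<dots> \<le> 42 * q powr (11 - 2 * real g)" using T1 T2 T3 T4 by linarith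
  also have "\<dots> \<le> q powr (12 - 2 * real g)" using q1000 by (intro q_powr_absorb) auto
  finally show ?thesis by (simp add: W_def)
qed

text \<open>
  The two stages contribute \<open>\<kappa> = q powr (12 - 2 g)\<close> and \<open>\<theta> = q powr (6 d + 1 - g)\<close>. The factor \<open>q powr (6 d + 1)\<close>
  in \<open>\<theta>\<close> is chosen such that \<open>\<sigma> / \<theta> ^ d\<close> is below \<open>q powr (- 3 g)\<close>.
\<close>

lemma slice_point_prob:
  assumes l: "\<And>j. \<bar>l j\<bar> \<le> q powr (4 * real g)"
  shows "pr V (\<lambda>U. card U = k \<and> edge_weight l U = x) \<le> q powr (6 * real d + 14 - 3 * real g)"
proof -
  obtain A B C FC FA where fin: "finite A" "finite B" "finite C" and V: "V = (A \<union> C) \<union> B"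
    and dis: "A \<inter> C = {}" "(A \<union> C) \<inter> B = {}"
    and cB: "real (card B) \<le> q powr 4" and C: "C \<noteq> {}" "real (card C) \<le> q powr (2 * real g - 7)"
    and FC: "finite FC" "FC \<noteq> {}" "q powr (2 * real g - 8) \<le> real (card FC)" "real (card FC) \<le> 2 * q powr (2 * real g - 8)"
    and FA: "finite FA" "FA \<noteq> {}" "q powr (2 * real g - 1) \<le> real (card FA)" "real (card FA) \<le> q powr (2 * real g)"
    and FCt: "\<And>xs. xs \<in> FC \<Longrightarrow> length xs = Suc s" "\<And>xs. xs \<in> FC \<Longrightarrow> set xs \<subseteq> C"
      "\<And>xs. xs \<in> FC \<Longrightarrow> robust (q powr (2 * real g - 1) / 2) xs A"
    and FAt: "\<And>xs. xs \<in> FA \<Longrightarrow> set xs \<subseteq> A" "\<And>xs. xs \<in> FA \<Longrightarrow> length xs = Suc s \<and> robust q xs B"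
    and FCd: "\<And>xs ys. xs \<in> FC \<Longrightarrow> ys \<in> FC \<Longrightarrow> xs \<noteq> ys \<Longrightarrow> set xs \<inter> set ys = {}"
    and FAd: "\<And>xs ys. xs \<in> FA \<Longrightarrow> ys \<in> FA \<Longrightarrow> xs \<noteq> ys \<Longrightarrow> set xs \<inter> set ys = {}"
    by (rule decomposition, rule that)
  define D where "D = A \<union> C"
  define \<gamma> where "\<gamma> = real g"
  have \<gamma>: "\<gamma> \<ge> 9" "\<gamma> = real d * real d" using exponents by (auto simp: \<gamma>_def)
  have finD: "finite D" using fin by (simp add: D_def)
  have disD: "D \<inter> B = {}" using dis by (simp add: D_def)
  have cV: "real (card D) + real (card B) = q powr (2 * \<gamma>)"
    using cardV card_Un_disjoint[OF finD fin(2) disD] unfolding V D_def \<gamma>_def by simp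
  have cD: "real (card D) \<le> q powr (2 * \<gamma>)" using cV by linarith
  have AC: "q powr (2 * \<gamma>) \<le> 4 * real (card D)"
  proof -
    have "2 * q powr 4 \<le> q powr (2 * \<gamma>)" using q1000 \<gamma> by (intro q_powr_absorb) auto
    then show ?thesis using cV cB by linarith
  qed
  define \<kappa> where "\<kappa> = q powr (12 - 2 * \<gamma>)"
  define W where "W = q powr (\<gamma> + 6)"
  define Q where "Q = q powr (\<gamma> + 1)"
  define \<rho> where "\<rho> = q powr (7 * \<gamma> + 1 - real e)"
  define \<sigma> where "\<sigma> = q powr (real d * ((5 * real d - (2 * \<gamma> - 1)) / 2))"
  define \<theta> where "\<theta> = q powr (6 * real d + 1 - \<gamma>)"
  define \<epsilon> where "\<epsilon> = q powr (- (7 * \<gamma> + 10))"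
  define nL where "nL = q powr (4 * \<gamma> + 10)"
  have W1: "W \<ge> 1" unfolding W_def using \<gamma> by (intro one_le_q_powr) simp
  have coarse: "pr D (\<lambda>U. card U = k \<and> \<bar>edge_weight l U - y\<bar> \<le> 2 * W) \<le> \<kappa>" for k y
    unfolding D_def W_def \<kappa>_def \<gamma>_def
    by (rule coarse_scale[OF fin(1,3) dis(1) AC[unfolded D_def \<gamma>_def] C FC FCt FCd])
  have b1: "2 * real (card B) + 1 \<le> q powr 5"
  proof -
    have "2 * real (card B) + 1 \<le> 3 * q powr 4" using cB one_le_q_powr[of 4] by linarith
    also have "\<dots> \<le> q powr 5" using q1000 by (intro q_powr_absorb) auto
    finally show ?thesis .
  qed
  have \<rho>': "real (d * (2 * card B + 1) ^ (d * d)) * (real (card FA) * sqrt (2 ^ Suc s / q) ^ Suc s) \<le> \<rho>"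
  proof -
    define z where "z = sqrt (2 ^ Suc s / q)"
    have z0: "z \<ge> 0" by (simp add: z_def)
    have z1: "z \<le> 1" unfolding z_def using q_powers(2) by simp
    have "z ^ 4 = (2 ^ Suc s)\<^sup>2 / q\<^sup>2" unfolding z_def by (subst sqrt_power_4) (simp_all add: power_divide)
    also have "(2 ^ Suc s)\<^sup>2 = (4::real) ^ Suc s" by (simp only: power2_eq_square power_mult_distrib[symmetric]) simp
    also have "4 ^ Suc s / q\<^sup>2 \<le> q / q\<^sup>2" using q_powers(6) by (intro divide_right_mono) auto
    also have "\<dots> = q powr (-1)" by (simp add: powr_minus power2_eq_square field_simps)
    finally have zs: "z ^ s \<le> q powr (- real e)" using z0 by (intro power_s_le)
    have "z ^ Suc s \<le> 1 * z ^ s" using z0 z1 by (simp add: mult_left_le_one_le)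
    then have zS: "z ^ Suc s \<le> q powr (- real e)" using zs by simp
    have "real (d * (2 * card B + 1) ^ (d * d)) = real d * (2 * real (card B) + 1) ^ (d * d)" by (simp add: add.commute)
    also have "\<dots> \<le> q powr 1 * (q powr 5) ^ (d * d)"
      using q_powers(7) b1 by (intro mult_mono power_mono) auto
    finally have "real (d * (2 * card B + 1) ^ (d * d)) * (real (card FA) * z ^ Suc s)
       \<le> (q powr 1 * (q powr 5) ^ (d * d)) * (q powr (2 * \<gamma>) * q powr (- real e))"
      using FA(4) zS z0 unfolding \<gamma>_def by (intro mult_mono) auto
    also have "\<dots> = \<rho>" unfolding q_powr_power q_powr_add \<rho>_def \<gamma>(2) by (simp add: algebra_simps)
    finally show ?thesis by (simp add: z_def)
  qed
  have \<sigma>': "sqrt ((2 * real (card B) + 1) ^ d / real (card FA)) ^ d \<le> \<sigma>"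
  proof -
    have "(2 * real (card B) + 1) ^ d / real (card FA) \<le> (q powr 5) ^ d / q powr (2 * \<gamma> - 1)"
      using b1 FA(3) unfolding \<gamma>_def by (intro frac_le power_mono) auto
    also have "\<dots> = q powr (5 * real d - (2 * \<gamma> - 1))" unfolding q_powr_power q_powr_diff by (simp add: mult.commute)
    finally have "sqrt ((2 * real (card B) + 1) ^ d / real (card FA)) \<le> q powr ((5 * real d - (2 * \<gamma> - 1)) / 2)"
      unfolding q_powr_sqrt[symmetric] by (rule real_sqrt_le_mono)
    then have "sqrt ((2 * real (card B) + 1) ^ d / real (card FA)) ^ d \<le> (q powr ((5 * real d - (2 * \<gamma> - 1)) / 2)) ^ d"
      by (intro power_mono) auto
    then show ?thesis unfolding q_powr_power \<sigma>_def .
  qed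
  have moment: "avg D (\<lambda>X. pr B (\<lambda>Y. G Y \<and> edge_weight l (X \<union> Y) = x) ^ Suc d) \<le> \<rho> + pr B G ^ Suc d * \<sigma>" for G
  proof -
    have "avg D (\<lambda>X. pr B (\<lambda>Y. G Y \<and> edge_weight l (X \<union> Y) = x) ^ Suc d)
      \<le> real (d * (2 * card B + 1) ^ (d * d)) * (real (card FA) * sqrt (2 ^ Suc s / q) ^ Suc s)
      + pr B G ^ Suc d * sqrt ((2 * real (card B) + 1) ^ d / real (card FA)) ^ d"
      unfolding D_def by (rule moment_bound[OF fin dis FA(1,2) FAt FAd q_pos(1)])
    also have "\<dots> \<le> \<rho> + pr B G ^ Suc d * \<sigma>"
      by (intro add_mono \<rho>' mult_left_mono \<sigma>') simp
    finally show ?thesis .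
  qed
  have labels: "real (card ((\<lambda>Y. (\<lfloor>(\<Sum>j\<in>Y. l j + deg D j / 2) / W\<rfloor>, card Y)) ` Pow B)) \<le> nL"
  proof -
    have "real (card ((\<lambda>Y. (\<lfloor>(\<Sum>j\<in>Y. l j + deg D j / 2) / W\<rfloor>, card Y)) ` Pow B))
      \<le> (2 * real (card B) * (q powr (4 * \<gamma>) + real (card D)) + 3) * (real (card B) + 1)"
      unfolding \<gamma>_def by (rule card_window_labels[OF fin(2) finD W1 l])
    also have "\<dots> \<le> q powr (4 * \<gamma> + 5) * q powr 5"
    proof (rule mult_mono)
      have "q powr (2 * \<gamma>) \<le> q powr (4 * \<gamma>)" using \<gamma> by (intro q_powr_mono) simp
      then have "2 * real (card B) * (q powr (4 * \<gamma>) + real (card D)) \<le> 2 * q powr 4 * (2 * q powr (4 * \<gamma>))"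
        using cB cD by (intro mult_mono) auto
      also have "\<dots> = 4 * q powr (4 * \<gamma> + 4)" by (simp add: powr_add)
      finally have "2 * real (card B) * (q powr (4 * \<gamma>) + real (card D)) + 3 \<le> 7 * q powr (4 * \<gamma> + 4)"
        using one_le_q_powr[of "4 * \<gamma> + 4"] \<gamma> by linarith
      also have "\<dots> \<le> q powr (4 * \<gamma> + 5)" using q1000 by (intro q_powr_absorb) auto
      finally show "2 * real (card B) * (q powr (4 * \<gamma>) + real (card D)) + 3 \<le> q powr (4 * \<gamma> + 5)" .
      show "real (card B) + 1 \<le> q powr 5" using b1 by linarith
    qed auto
    also have "\<dots> = nL" unfolding q_powr_add nL_def by (simp add: add.commute)
    finally show ?thesis .
  qed
  have WQ: "real (card B) * Q + (real (card B))\<^sup>2 \<le> W"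
  proof -
    have "real (card B) * Q \<le> q powr 4 * q powr (\<gamma> + 1)" using cB unfolding Q_def by (intro mult_right_mono) auto
    moreover have "(real (card B))\<^sup>2 \<le> (q powr 4)\<^sup>2" using cB by (intro power_mono) auto
    moreover have "(q powr 4)\<^sup>2 \<le> q powr (\<gamma> + 5)" unfolding q_powr_power using \<gamma> by (intro q_powr_mono) simp
    moreover have "q powr 4 * q powr (\<gamma> + 1) = q powr (\<gamma> + 5)" unfolding q_powr_add by (simp add: add.commute)
    moreover have "2 * q powr (\<gamma> + 5) \<le> W" unfolding W_def using q1000 by (intro q_powr_absorb) auto
    ultimately show ?thesis by linarith
  qed
  have pos: "\<theta> > 0" "\<epsilon> > 0" "\<rho> \<ge> 0" "\<sigma> \<ge> 0" "Q \<ge> 0" "W > 0" "q powr (2 * \<gamma>) > 0"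
    by (simp_all add: \<theta>_def \<epsilon>_def \<rho>_def \<sigma>_def Q_def W_def)
  define t where "t = 6 * real d + 13 - 3 * \<gamma>"
  have "pr V (\<lambda>U. card U = k \<and> edge_weight l U = x)
    \<le> \<theta> * \<kappa> + nL * \<epsilon> * \<kappa> + \<sigma> / \<theta> ^ d + nL * \<rho> / \<epsilon> ^ d + real (card B) * (2 * exp (- 2 * Q\<^sup>2 / q powr (2 * \<gamma>)))"
    unfolding V D_def[symmetric]
    by (rule point_prob_from_window_and_moment[OF finD fin(2) disD cD pos(7,5,6) WQ coarse moment pos(1-4) labels])
  also have "\<dots> \<le> q powr t + q powr t + q powr t + q powr t + 2 * q powr t"
  proof (intro add_mono)
    show "\<theta> * \<kappa> \<le> q powr t" unfolding \<theta>_def \<kappa>_def q_powr_add t_def by (intro q_powr_mono) simp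
    show "nL * \<epsilon> * \<kappa> \<le> q powr t" unfolding nL_def \<epsilon>_def \<kappa>_def q_powr_add t_def using \<gamma> by (intro q_powr_mono) simp
    show "\<sigma> / \<theta> ^ d \<le> q powr t" unfolding \<sigma>_def \<theta>_def q_powr_power q_powr_diff t_def
    proof (intro q_powr_mono)
      have "real d * ((5 * real d - (2 * \<gamma> - 1)) / 2) - real d * (6 * real d + 1 - \<gamma>)
         = - (7/2) * (real d * real d) - real d / 2" by (simp add: field_simps)
      then show "real d * ((5 * real d - (2 * \<gamma> - 1)) / 2) - real d * (6 * real d + 1 - \<gamma>) \<le> 6 * real d + 13 - 3 * \<gamma>"
        unfolding \<gamma>(2) using \<gamma> by simp
    qed
    show "nL * \<rho> / \<epsilon> ^ d \<le> q powr t" unfolding nL_def \<rho>_def \<epsilon>_def q_powr_power q_powr_add q_powr_diff t_def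
      using exponents(1) by (intro q_powr_mono) (simp add: \<gamma>_def algebra_simps)
    show "real (card B) * (2 * exp (- 2 * Q\<^sup>2 / q powr (2 * \<gamma>))) \<le> 2 * q powr t"
    proof -
      have "Q\<^sup>2 / q powr (2 * \<gamma>) = q powr 2" unfolding Q_def q_powr_power q_powr_diff by simp
      then have "- 2 * Q\<^sup>2 / q powr (2 * \<gamma>) = - 2 * q powr 2" by simp
      also have "\<dots> \<le> - q"
      proof -
        have "q \<le> q powr 2" by (rule q_le_q_powr) simp
        then show ?thesis using q1000 by linarith
      qed
      finally have "exp (- 2 * Q\<^sup>2 / q powr (2 * \<gamma>)) \<le> q powr (- (4 * \<gamma> + 10))"
        using exp_q_le unfolding \<gamma>_def by (meson exp_le_cancel_iff order_trans)
      then have "real (card B) * (2 * exp (- 2 * Q\<^sup>2 / q powr (2 * \<gamma>))) \<le> q powr 4 * (2 * q powr (- (4 * \<gamma> + 10)))"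
        using cB by (intro mult_mono) auto
      also have "\<dots> = 2 * (q powr 4 * q powr (- (4 * \<gamma> + 10)))" by simp
      also have "\<dots> \<le> 2 * q powr t" unfolding q_powr_add t_def using \<gamma> by (intro mult_left_mono q_powr_mono) auto
      finally show ?thesis .
    qed
  qed
  also have "\<dots> = 6 * q powr t" by simp
  also have "\<dots> \<le> q powr (6 * real d + 14 - 3 * real g)"
    using q1000 by (intro q_powr_absorb) (auto simp: t_def \<gamma>_def)
  finally show ?thesis .
qed

end

section \<open>From Ramsey graphs to the theorem\<close>

definition adj :: "'a set set \<Rightarrow> 'a \<Rightarrow> 'a \<Rightarrow> real" where
  "adj E i j = of_bool (i \<noteq> j \<and> {i, j} \<in> E)"

interpretation adj: adjacency "adj E" for E :: "'a set set"
proof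
  fix i j :: 'a
  have "{i, j} = {j, i}" by (rule insert_commute)
  then show "adj E i j = adj E j i" unfolding adj_def by (simp only: eq_commute[of i j])
  show "adj E i i = 0" unfolding adj_def by simp
  show "adj E i j = 0 \<or> adj E i j = 1" unfolding adj_def of_bool_def by (cases "i \<noteq> j \<and> {i, j} \<in> E") simp_all
qed

lemma homogeneous_adj: "adj.homogeneous E U \<Longrightarrow> clique U E \<or> indep U E"
proof -
  assume "adj.homogeneous E U"
  then obtain c where hom: "\<forall>i\<in>U. \<forall>j\<in>U. i \<noteq> j \<longrightarrow> adj E i j = c"
    unfolding adj.homogeneous_def by (rule exE)
  have c: "adj E i j = c" if "i \<in> U" "j \<in> U" "i \<noteq> j" for i j
    using hom[rule_format, OF that] .
  show ?thesis
  proof (cases "c = 1")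
    case True
    have "{i, j} \<in> E" if "i \<in> U" "j \<in> U" "i \<noteq> j" for i j
      using c[OF that] True unfolding adj_def by (simp split: if_splits add: of_bool_def)
    then have "clique U E" unfolding clique_def by (intro ballI impI)
    then show ?thesis ..
  next
    case False
    have "{i, j} \<notin> E" if "i \<in> U" "j \<in> U" "i \<noteq> j" for i j
    proof
      assume "{i, j} \<in> E"
      then have "adj E i j = 1" using that(3) by (simp add: adj_def)
      then show False using c[OF that] False by simp
    qed
    then have "indep U E" unfolding indep_def by (intro ballI impI)
    then show ?thesis ..
  qed
qed

text \<open>
  Adding a vertex \<open>x\<close> to \<open>U\<close> adds \<open>deg U x\<close> edges.
\<close>

lemma card_induced_edges:
  assumes G: "finite_simple_graph V E" and U: "U \<subseteq> V"
  shows "real (card (induced_edges E U)) = adj.edge_weight E (\<lambda>_. 0) U"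
proof -
  have finV: "finite V" and EV: "E \<subseteq> [V]\<^bsup>2\<^esup>" using G by (auto simp: finite_simple_graph_def)
  have "finite U" using finV U finite_subset by blast
  then show ?thesis using U
  proof (induction U)
    case empty
    have "induced_edges E {} = {}"
      using EV by (auto simp: induced_edges_def nsets_def)
    then show ?case by (simp add: adj.edge_weight_def)
  next
    case (insert x U)
    define N where "N = {y\<in>U. {x, y} \<in> E}"
    have two: "\<exists>y z. f = {y, z} \<and> y \<noteq> z" if "f \<in> E" for f
    proof -
      have "card f = 2" using that EV by (auto simp: nsets_def)
      then show ?thesis by (auto simp: card_2_iff)
    qed
    have split: "induced_edges E (insert x U) = induced_edges E U \<union> (\<lambda>y. {x, y}) ` N"
    proof (intro equalityI subsetI)
      fix f assume f: "f \<in> induced_edges E (insert x U)"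
      show "f \<in> induced_edges E U \<union> (\<lambda>y. {x, y}) ` N"
      proof (cases "x \<in> f")
        case False
        then show ?thesis using f by (auto simp: induced_edges_def)
      next
        case True
        have fE: "f \<in> E" "f \<subseteq> insert x U" using f by (simp_all add: induced_edges_def)
        from two[OF fE(1)] obtain y z where yz: "f = {y, z}" "y \<noteq> z" by (elim exE conjE)
        have "\<exists>w. f = {x, w} \<and> w \<noteq> x"
        proof (cases "x = y")
          case True
          then show ?thesis using yz by (intro exI[of _ z]) simp
        next
          case False
          then have "x = z" using \<open>x \<in> f\<close> yz by simp
          then show ?thesis using yz by (intro exI[of _ y]) (simp add: insert_commute)
        qed
        then obtain w where w: "f = {x, w}" "w \<noteq> x" by (elim exE conjE)
        then have "w \<in> N" using fE by (simp add: N_def)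
        then show ?thesis unfolding w(1) by (intro UnI2 imageI)
      qed
    qed (auto simp: induced_edges_def N_def)
    have "finite (induced_edges E U)"
    proof (rule finite_subset)
      show "induced_edges E U \<subseteq> Pow U" by (auto simp: induced_edges_def)
    qed (use insert in simp)
    moreover have "induced_edges E U \<inter> (\<lambda>y. {x, y}) ` N = {}" using insert by (auto simp: induced_edges_def)
    moreover have "finite N" using insert by (simp add: N_def)
    moreover have "inj_on (\<lambda>y. {x, y}) N" using insert by (auto simp: inj_on_def N_def doubleton_eq_iff)
    ultimately have "card (induced_edges E (insert x U)) = card (induced_edges E U) + card N"
      unfolding split by (simp add: card_Un_disjoint card_image)
    moreover have "real (card N) = adj.deg E U x"
    proof -
      have "adj.deg E U x = (\<Sum>y\<in>U. if {x, y} \<in> E then 1 else 0)"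
        unfolding adj.deg_def using insert by (intro sum.cong) (auto simp: adj_def insert_commute)
      also have "\<dots> = real (card N)" using insert by (simp add: N_def sum.If_cases Int_def)
      finally show ?thesis by simp
    qed
    moreover have "adj.edge_weight E (\<lambda>_. 0) (U \<union> {x}) = adj.edge_weight E (\<lambda>_. 0) U + adj.edge_weight E (\<lambda>j. 0 + adj.deg E U j) {x}"
      using insert by (intro adj.edge_weight_Un) auto
    moreover have "adj.edge_weight E (\<lambda>j. 0 + adj.deg E U j) {x} = adj.deg E U x"
      by (simp add: adj.edge_weight_def adj.deg_def adj.irrefl)
    ultimately show ?case using insert by simp
  qed
qed

lemma eventually_scale_ok:
  fixes K Q :: real
  assumes "C > 0" "c > 0" "K > 0" "\<alpha> > 0"
  shows "\<forall>\<^sub>F n in sequentially. Q \<le> (2 * c * real n) powr \<alpha> \<and> C * log 2 (real n) < (2 * c * real n) powr \<alpha> / K"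
proof (rule eventually_conj)
  show "\<forall>\<^sub>F n in sequentially. Q \<le> (2 * c * real n) powr \<alpha>"
    using assms by real_asymp
  show "\<forall>\<^sub>F n in sequentially. C * log 2 (real n) < (2 * c * real n) powr \<alpha> / K"
    using assms by real_asymp
qed

lemma eventually_powr_le_exp:
  fixes b :: real
  shows "\<forall>\<^sub>F q in at_top. (q::real) powr b \<le> exp q"
  by real_asymp

text \<open>
  With \<open>q = N powr (1 / (2 g))\<close> for \<open>N = 2 m\<close>, a graph with logarithmic homogeneous sets only satisfies the
  assumptions on the scales once \<open>n\<close> is large. Division by the probability of \<open>card U = m\<close>, of order
  \<open>q powr - g\<close>, leaves \<open>q powr (6 d + 15) / N\<close>, and \<open>d \<ge> 11 / \<eta>\<close> bounds the numerator by \<open>n powr (\<eta> / 2)\<close>.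
  The weights \<open>l\<close> later express vertices that are already known to be chosen.
\<close>

lemma card_slice_bound:
  fixes C c \<eta> :: real
  assumes C: "C > 0" and c: "c > 0" and eta: "\<eta> > 0"
  shows "\<exists>n0::nat. \<forall>n\<ge>n0. \<forall>(V::'a set) E T m l x. card V = n \<longrightarrow> Ramsey_graph C V E \<longrightarrow> T \<subseteq> V \<longrightarrow>
     card T = 2 * m \<longrightarrow> c * real n \<le> real m \<longrightarrow> (\<forall>j. \<bar>l j\<bar> \<le> real n) \<longrightarrow>
     real (card {U. U \<subseteq> T \<and> card U = m \<and> adj.edge_weight E l U = x}) \<le> real n powr (- 1 + \<eta>) * real ((2 * m) choose m)"
proof -
  define d where "d = nat \<lceil>11 / \<eta>\<rceil> + 3"
  define g where "g = d * d"
  define e where "e = (7 * g + 10) * d + 14 * g + 11"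
  define s where "s = 4 * e"
  define K :: real where "K = 8 * (2 ^ Suc s * 2 ^ 2 ^ Suc s)"
  have d3: "d \<ge> 3" by (simp add: d_def)
  have g0: "real g > 0" using d3 by (simp add: g_def)
  have K0: "K > 0" unfolding K_def by (intro mult_pos_pos zero_less_power) auto
  define \<alpha> where "\<alpha> = 1 / (2 * real g)"
  have \<alpha>0: "\<alpha> > 0" using g0 by (simp add: \<alpha>_def)
  obtain Q1 where Q1: "\<And>q. q \<ge> Q1 \<Longrightarrow> q powr (4 * real g + 10) \<le> exp q"
    using eventually_powr_le_exp[of "4 * real g + 10"] unfolding eventually_at_top_linorder by blast
  \<comment> \<open>Beyond this value of \<open>q\<close> all constants are absorbed.\<close>
  define Q where "Q = max Q1 (1000 * 16 ^ Suc s)"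
  have "\<forall>\<^sub>F n in sequentially. 1 / (2 * c) \<le> 2 * c * real n \<and> 1 / (2 * c) \<le> real n powr (\<eta> / 2) \<and> 1 \<le> real n"
    using c eta by (intro eventually_conj) real_asymp+
  from eventually_conj[OF this eventually_scale_ok[OF C c K0 \<alpha>0, of Q]]
  obtain n0 where n0: "\<And>n. n \<ge> n0 \<Longrightarrow> (1 / (2 * c) \<le> 2 * c * real n \<and> 1 / (2 * c) \<le> real n powr (\<eta> / 2) \<and> 1 \<le> real n)
     \<and> Q \<le> (2 * c * real n) powr \<alpha> \<and> C * log 2 (real n) < (2 * c * real n) powr \<alpha> / K"
    unfolding eventually_sequentially by blast
  have main: "real (card {U. U \<subseteq> T \<and> card U = m \<and> adj.edge_weight E l U = x}) \<le> real n powr (- 1 + \<eta>) * real ((2 * m) choose m)"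
    if n: "n \<ge> n0" and V: "card V = n" "Ramsey_graph C V E" and T: "T \<subseteq> V" "card T = 2 * m"
      and m: "c * real n \<le> real m" and l: "\<forall>j. \<bar>l j\<bar> \<le> real n"
    for n and V T :: "'a set" and E m l x
  proof -
    define N where "N = real (card T)"
    define q where "q = N powr \<alpha>"
    have finV: "finite V" using V(2) by (simp add: Ramsey_graph_def finite_simple_graph_def)
    have finT: "finite T" using T(1) finV finite_subset by blast
    have n1: "1 / (2 * c) \<le> 2 * c * real n" "1 / (2 * c) \<le> real n powr (\<eta> / 2)" "1 \<le> real n"
      "Q \<le> (2 * c * real n) powr \<alpha>" "C * log 2 (real n) < (2 * c * real n) powr \<alpha> / K"
      using n0[OF n] by auto
    have Nlow: "2 * c * real n \<le> N" using m T(2) by (simp add: N_def)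
    have Nn: "N \<le> real n" using card_mono[OF finV T(1)] V(1) by (simp add: N_def)
    have cn0: "2 * c * real n > 0" using c n1(3) by simp
    have N0: "N > 0" using Nlow cn0 by linarith
    have Ncard: "N = 2 * real m" "m > 0" using T(2) N0 by (auto simp: N_def)
    have qlow: "(2 * c * real n) powr \<alpha> \<le> q" unfolding q_def using Nlow cn0 \<alpha>0 by (intro powr_mono2) auto
    have qN: "q powr (2 * real g) = N" unfolding q_def \<alpha>_def using g0 N0 by (simp add: powr_powr)
    interpret sg: scaled_graph "adj E" T q d g e s
    proof unfold_locales
      show "g = d * d" "e = (7 * g + 10) * d + 14 * g + 11" "s = 4 * e" "3 \<le> d" "finite T"
        using d3 finT by (simp_all add: g_def e_def s_def)
      show "real (card T) = q powr (2 * real g)" using qN by (simp add: N_def)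
      show "1000 * 16 ^ Suc s \<le> q" using n1(4) qlow unfolding Q_def by linarith
      show "q powr (4 * real g + 10) \<le> exp q" using n1(4) qlow unfolding Q_def by (intro Q1) linarith
      fix U assume U: "U \<subseteq> T" "adj.homogeneous E U"
      have "\<not> C * log 2 (real (card V)) \<le> real (card U)"
        using V(2) U(1) T(1) homogeneous_adj[OF U(2)] unfolding Ramsey_graph_def by blast
      then have "real (card U) < (2 * c * real n) powr \<alpha> / K" using n1(5) unfolding V(1) by linarith
      also have "\<dots> \<le> q / K" using qlow K0 by (intro divide_right_mono) auto
      finally show "real (card U) < q / (8 * (2 ^ Suc s * 2 ^ 2 ^ Suc s))" by (simp add: K_def)
    qed
    have lq: "\<bar>l j\<bar> \<le> q powr (4 * real g)" for j
    proof -
      have "real n * 1 = (2 * c * real n) * (1 / (2 * c))" using c by simp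
      also have "\<dots> \<le> N * N" using Nlow n1(1) cn0 c by (intro mult_mono) auto
      also have "\<dots> = q powr (4 * real g)" using qN sg.q_powr_add[of "2 * real g" "2 * real g"] by simp
      finally have "real n \<le> q powr (4 * real g)" by simp
      with l[rule_format, of j] show ?thesis by (rule order_trans)
    qed
    define p where "p = q powr (6 * real d + 14 - 3 * real g)"
    have "pr T (\<lambda>U. card U = m \<and> adj.edge_weight E l U = x) \<le> p"
      unfolding p_def by (rule sg.slice_point_prob[OF lq])
    then have "real (card {U. U \<subseteq> T \<and> card U = m \<and> adj.edge_weight E l U = x}) \<le> p * 2 ^ card T"
      by (simp add: pr_card[OF finT] pos_divide_le_eq)
    also have "\<dots> = p * 4 ^ m" by (simp add: T(2) power_mult)
    also have "\<dots> \<le> p * (real ((2 * m) choose m) * (2 * sqrt (real m)))"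
      using central_binomial_lower[OF Ncard(2)] by (intro mult_left_mono) (auto simp: p_def)
    also have "\<dots> = (p * (2 * sqrt (real m))) * real ((2 * m) choose m)" by simp
    also have "\<dots> \<le> real n powr (- 1 + \<eta>) * real ((2 * m) choose m)"
    proof (rule mult_right_mono)
      have "2 * sqrt (real m) \<le> q * sqrt N"
      proof -
        have "2 * sqrt (real m) \<le> 2 * sqrt N" using Ncard by simp
        also have "\<dots> \<le> q * sqrt N" using sg.q1000 N0 by (intro mult_right_mono) auto
        finally show ?thesis .
      qed
      also have "\<dots> = q powr 1 * q powr real g" unfolding qN[symmetric] sg.q_powr_sqrt by simp
      finally have "p * (2 * sqrt (real m)) \<le> p * (q powr 1 * q powr real g)"
        by (intro mult_left_mono) (simp_all add: p_def)
      also have "\<dots> = q powr (6 * real d + 15 - 2 * real g)" unfolding p_def sg.q_powr_add by (simp add: algebra_simps)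
      also have "\<dots> = q powr (6 * real d + 15) / N" by (simp only: qN[symmetric] sg.q_powr_diff)
      also have "\<dots> \<le> real n powr (\<eta> / 2) / (2 * c * real n)"
      proof (rule frac_le)
        have "q powr (6 * real d + 15) = N powr (\<alpha> * (6 * real d + 15))" unfolding q_def by (simp add: powr_powr)
        also have "\<dots> \<le> N powr (\<eta> / 2)"
        proof (rule powr_mono)
          show "1 \<le> N" using N0 Ncard by linarith
          have d\<eta>: "11 \<le> \<eta> * real d"
          proof -
            have "11 / \<eta> \<le> real d" unfolding d_def by linarith
            then show ?thesis using eta by (simp add: pos_divide_le_eq mult.commute)
          qed
          have "6 * real d + 15 \<le> 11 * real d" using d3 by simp
          also have "\<dots> \<le> (\<eta> * real d) * real d" using d\<eta> by (intro mult_right_mono) auto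
          also have "\<dots> = \<eta> / 2 * (2 * real g)" by (simp add: g_def)
          finally show "\<alpha> * (6 * real d + 15) \<le> \<eta> / 2" unfolding \<alpha>_def using g0 by (simp add: pos_divide_le_eq)
        qed
        also have "\<dots> \<le> real n powr (\<eta> / 2)" using Nn N0 eta by (intro powr_mono2) auto
        finally show "q powr (6 * real d + 15) \<le> real n powr (\<eta> / 2)" .
      qed (use Nlow cn0 in simp_all)
      also have "\<dots> = (1 / (2 * c)) * (real n powr (\<eta> / 2) / real n)" by simp
      also have "\<dots> \<le> real n powr (\<eta> / 2) * (real n powr (\<eta> / 2) / real n)"
        using n1(2,3) by (intro mult_right_mono) auto
      also have "\<dots> = real n powr (- 1 + \<eta>)"
      proof -
        have "real n powr (- 1 + \<eta>) = real n powr (\<eta> / 2 + \<eta> / 2 - 1)" by (simp add: add.commute)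
        also have "\<dots> = real n powr (\<eta> / 2) * real n powr (\<eta> / 2) / real n powr 1"
          by (simp only: powr_diff powr_add)
        finally show ?thesis using n1(3) by simp
      qed
      finally show "p * (2 * sqrt (real m)) \<le> real n powr (- 1 + \<eta>)" .
    qed simp
    finally show ?thesis .
  qed
  show ?thesis
    by (intro exI[of _ n0] allI impI) (rule main)
qed

lemma double_counting_bound:
  assumes "finite A" "finite B"
    and "\<And>T. T \<in> A \<Longrightarrow> real (card {U\<in>B. R T U}) \<le> b" and "\<And>U. U \<in> B \<Longrightarrow> card {T\<in>A. R T U} = r"
  shows "real (card B) * real r \<le> real (card A) * b"
proof -
  have "real (card B) * real r = (\<Sum>U\<in>B. real (card {T\<in>A. R T U}))" using assms(4) by simp
  also have "\<dots> = (\<Sum>U\<in>B. \<Sum>T | T \<in> A \<and> R T U. 1)" by simp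
  also have "\<dots> = (\<Sum>T\<in>A. \<Sum>U | U \<in> B \<and> R T U. 1)" by (rule sum.swap_restrict[OF assms(2,1)])
  also have "\<dots> = (\<Sum>T\<in>A. real (card {U\<in>B. R T U}))" by simp
  also have "\<dots> \<le> real (card A) * b" by (rule sum_bounded_above) (rule assms(3))
  finally show ?thesis .
qed

lemma card_supersets:
  assumes "finite V" "U \<subseteq> V" "card U \<le> j"
  shows "card {T. T \<subseteq> V \<and> card T = j \<and> U \<subseteq> T} = (card V - card U) choose (j - card U)"
proof -
  have finU: "finite U" using assms finite_subset by blast
  have "card {T. T \<subseteq> V \<and> card T = j \<and> U \<subseteq> T} = card {Y. Y \<subseteq> V - U \<and> card Y = j - card U}"
  proof (rule bij_betw_same_card[of "\<lambda>T. T - U"], rule bij_betwI[where g = "\<lambda>Y. Y \<union> U"])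
    show "(\<lambda>T. T - U) \<in> {T. T \<subseteq> V \<and> card T = j \<and> U \<subseteq> T} \<rightarrow> {Y. Y \<subseteq> V - U \<and> card Y = j - card U}"
      using finU by (auto simp: card_Diff_subset)
    show "(\<lambda>Y. Y \<union> U) \<in> {Y. Y \<subseteq> V - U \<and> card Y = j - card U} \<rightarrow> {T. T \<subseteq> V \<and> card T = j \<and> U \<subseteq> T}"
    proof (rule funcsetI)
      fix Y assume Y: "Y \<in> {Y. Y \<subseteq> V - U \<and> card Y = j - card U}"
      then have "finite Y" "Y \<inter> U = {}" using assms(1) finite_subset by blast+
      then have "card (Y \<union> U) = card Y + card U" using finU by (intro card_Un_disjoint)
      then show "Y \<union> U \<in> {T. T \<subseteq> V \<and> card T = j \<and> U \<subseteq> T}" using Y assms(2,3) by auto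
    qed
  qed auto
  also have "\<dots> = (card V - card U) choose (j - card U)"
    using assms finU by (simp add: n_subsets card_Diff_subset)
  finally show ?thesis .
qed

theorem theorem1p3:
  fixes C c :: real
  assumes "C > 0" and "c > 0"
  shows "\<forall>\<eta>>0. \<exists>n0::nat. \<forall>n\<ge>n0. \<forall>(V :: 'a set) E. \<forall>k::nat. \<forall>x::int.
           card V = n \<longrightarrow> Ramsey_graph C V E \<longrightarrow>
           c * real n \<le> real k \<longrightarrow> real k \<le> (1 - c) * real n \<longrightarrow>
           measure_pmf.prob (induced_edge_count_pmf V E k) {X. X = x} \<le> real n powr (- 1 + \<eta>)"
proof (intro allI impI)
  fix \<eta> :: real assume eta: "\<eta> > 0"
  from card_slice_bound[OF assms eta, where ?'a = 'a] obtain n0 where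
    n0: "\<forall>n\<ge>n0. \<forall>(V::'a set) E T m l x. card V = n \<longrightarrow> Ramsey_graph C V E \<longrightarrow> T \<subseteq> V \<longrightarrow>
     card T = 2 * m \<longrightarrow> c * real n \<le> real m \<longrightarrow> (\<forall>j. \<bar>l j\<bar> \<le> real n) \<longrightarrow>
     real (card {U. U \<subseteq> T \<and> card U = m \<and> adj.edge_weight E l U = x}) \<le> real n powr (- 1 + \<eta>) * real ((2 * m) choose m)" ..
  show "\<exists>n0::nat. \<forall>n\<ge>n0. \<forall>(V :: 'a set) E. \<forall>k::nat. \<forall>x::int.
           card V = n \<longrightarrow> Ramsey_graph C V E \<longrightarrow>
           c * real n \<le> real k \<longrightarrow> real k \<le> (1 - c) * real n \<longrightarrow>
           measure_pmf.prob (induced_edge_count_pmf V E k) {X. X = x} \<le> real n powr (- 1 + \<eta>)"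
  proof (intro exI[of _ n0] allI impI)
    fix n k :: nat and V :: "'a set" and E and x :: int
    assume n: "n0 \<le> n" and V: "card V = n" and ram: "Ramsey_graph C V E"
      and k: "c * real n \<le> real k" "real k \<le> (1 - c) * real n"
    have G: "finite_simple_graph V E" and finV: "finite V"
      using ram by (auto simp: Ramsey_graph_def finite_simple_graph_def)
    have kn: "k \<le> n"
    proof -
      have "0 \<le> c * real n" using assms by simp
      then have "real k \<le> real n" using k(2) by (simp add: left_diff_distrib)
      then show ?thesis by simp
    qed
    define p where "p = real n powr (- 1 + \<eta>)"
    define S where "S = {U. U \<subseteq> V \<and> card U = k \<and> adj.edge_weight E (\<lambda>_. 0) U = of_int x}"
    have finS: "finite S" using finV by (simp add: S_def)
    have slice: "real (card {U. U \<subseteq> T \<and> card U = m \<and> adj.edge_weight E l U = y}) \<le> p * real ((2 * m) choose m)"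
      if "T \<subseteq> V" "card T = 2 * m" "c * real n \<le> real m" "\<And>j. \<bar>l j\<bar> \<le> real n" for T m l y
      using n0[rule_format, OF n V ram that] unfolding p_def .
    have Sbound: "real (card S) \<le> p * real (n choose k)"
    proof (cases "2 * k \<le> n")
      case True
      define A where "A = {T. T \<subseteq> V \<and> card T = 2 * k}"
      have "real (card S) * real ((n - k) choose k) \<le> real (card A) * (p * real ((2 * k) choose k))"
      proof (rule double_counting_bound[where R = "\<lambda>T U. U \<subseteq> T"])
        show "finite A" "finite S" using finV finS by (simp_all add: A_def)
        fix T assume T: "T \<in> A"
        have "{U\<in>S. U \<subseteq> T} = {U. U \<subseteq> T \<and> card U = k \<and> adj.edge_weight E (\<lambda>_. 0) U = of_int x}"
          using T by (auto simp: A_def S_def)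
        then show "real (card {U\<in>S. U \<subseteq> T}) \<le> p * real ((2 * k) choose k)"
          using T k(1) slice[of T k "\<lambda>_. 0"] by (simp add: A_def)
      next
        fix U assume U: "U \<in> S"
        then have "card {T. T \<subseteq> V \<and> card T = 2 * k \<and> U \<subseteq> T} = (card V - card U) choose (2 * k - card U)"
          using finV by (intro card_supersets) (auto simp: S_def)
        then show "card {T\<in>A. U \<subseteq> T} = (n - k) choose k" using U V by (simp add: A_def S_def)
      qed
      also have "real (card A) = real (n choose (2 * k))" using finV V by (simp add: A_def n_subsets)
      also have "real (n choose (2 * k)) * (p * real ((2 * k) choose k)) = p * real ((n choose (2 * k)) * ((2 * k) choose k))"
        by simp
      also have "(n choose (2 * k)) * ((2 * k) choose k) = (n choose k) * ((n - k) choose k)"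
        using choose_mult[of k "2 * k" n] True by simp
      finally have "real (card S) * real ((n - k) choose k) \<le> (p * real (n choose k)) * real ((n - k) choose k)"
        by simp
      moreover have "real ((n - k) choose k) > 0" using True by simp
      ultimately show ?thesis by (rule mult_right_le_imp_le)
    next
      case False
      \<comment> \<open>The vertices of \<open>W\<close> are in \<open>U\<close> from the outset; the rest of \<open>U\<close> is half of the remaining \<open>2 m\<close> vertices.\<close>
      define w where "w = 2 * k - n"
      define m where "m = n - k"
      have wk: "w \<le> k" "k - w = m" "n - w = 2 * m" using kn False by (auto simp: w_def m_def)
      have cm: "c * real n \<le> real m" using k(2) kn by (simp add: m_def of_nat_diff left_diff_distrib)
      define A where "A = {W. W \<subseteq> V \<and> card W = w}"
      have "real (card S) * real (k choose w) \<le> real (card A) * (p * real ((2 * m) choose m))"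
      proof (rule double_counting_bound[where R = "\<lambda>W U. W \<subseteq> U"])
        show "finite A" "finite S" using finV finS by (simp_all add: A_def)
        fix W assume W: "W \<in> A"
        then have WV: "W \<subseteq> V" "card W = w" by (auto simp: A_def)
        have finW: "finite W" using WV finV finite_subset by blast
        define l where "l j = adj.deg E W j" for j
        have lb: "\<bar>l j\<bar> \<le> real n" for j
        proof -
          have "\<bar>l j\<bar> \<le> (\<Sum>i\<in>W. \<bar>adj E i j\<bar>)" unfolding l_def adj.deg_def by (rule sum_abs)
          also have "\<dots> \<le> (\<Sum>i\<in>W. 1)" by (rule sum_mono) (rule adj.abs_a_le_1)
          also have "\<dots> \<le> real n" using card_mono[OF finV WV(1)] V by simp
          finally show ?thesis .
        qed
        define Z where "Z = {Y. Y \<subseteq> V - W \<and> card Y = m \<and> adj.edge_weight E l Y = of_int x - adj.edge_weight E (\<lambda>_. 0) W}"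
        have "{U\<in>S. W \<subseteq> U} \<subseteq> (\<lambda>Y. W \<union> Y) ` Z"
        proof
          fix U assume U: "U \<in> {U\<in>S. W \<subseteq> U}"
          then have US: "U \<subseteq> V" "card U = k" "adj.edge_weight E (\<lambda>_. 0) U = of_int x" "W \<subseteq> U" by (auto simp: S_def)
          have finU: "finite U" using US(1) finV finite_subset by blast
          have UW: "U = W \<union> (U - W)" using US(4) by blast
          have "adj.edge_weight E (\<lambda>_. 0) (W \<union> (U - W)) = adj.edge_weight E (\<lambda>_. 0) W + adj.edge_weight E (\<lambda>j. 0 + adj.deg E W j) (U - W)"
            using finU finW by (intro adj.edge_weight_Un) auto
          then have "adj.edge_weight E l (U - W) = of_int x - adj.edge_weight E (\<lambda>_. 0) W"
            using US(3) UW by (simp add: l_def[abs_def])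
          moreover have "card (U - W) = m" using US WV finW wk by (simp add: card_Diff_subset)
          ultimately have "U - W \<in> Z" using US(1) by (auto simp: Z_def)
          then show "U \<in> (\<lambda>Y. W \<union> Y) ` Z" using UW by blast
        qed
        moreover have finZ: "finite Z" using finV by (simp add: Z_def)
        ultimately have "card {U\<in>S. W \<subseteq> U} \<le> card Z"
          by (meson card_image_le card_mono finite_imageI order_trans)
        also have "real (card Z) \<le> p * real ((2 * m) choose m)"
          unfolding Z_def
        proof (rule slice)
          show "card (V - W) = 2 * m" using WV finW V wk by (simp add: card_Diff_subset)
        qed (use cm lb in auto)
        finally show "real (card {U\<in>S. W \<subseteq> U}) \<le> p * real ((2 * m) choose m)" by simp
      next
        fix U assume U: "U \<in> S"
        then have US: "U \<subseteq> V" "card U = k" by (auto simp: S_def)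
        have "{W\<in>A. W \<subseteq> U} = {W. W \<subseteq> U \<and> card W = w}" using US by (auto simp: A_def)
        then show "card {W\<in>A. W \<subseteq> U} = k choose w"
          using US finV finite_subset[of U V] by (simp add: n_subsets)
      qed
      also have "real (card A) = real (n choose w)" using finV V by (simp add: A_def n_subsets)
      also have "real (n choose w) * (p * real ((2 * m) choose m)) = p * real ((n choose w) * ((2 * m) choose m))"
        by simp
      also have "(n choose w) * ((2 * m) choose m) = (n choose k) * (k choose w)"
        using choose_mult[of w k n] wk kn by simp
      finally have "real (card S) * real (k choose w) \<le> (p * real (n choose k)) * real (k choose w)"
        by simp
      moreover have "real (k choose w) > 0" using wk by simp
      ultimately show ?thesis by (rule mult_right_le_imp_le)
    qed
    have nsets: "[V]\<^bsup>k\<^esup> = {U. U \<subseteq> V \<and> card U = k}"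
      using finV finite_subset by (auto simp: nsets_def)
    have cn: "card ([V]\<^bsup>k\<^esup>) = n choose k" using finV V by (simp add: nsets n_subsets)
    have fin: "finite ([V]\<^bsup>k\<^esup>)" using finV by (simp add: nsets)
    have npos: "n choose k > 0" using kn by simp
    have ne: "[V]\<^bsup>k\<^esup> \<noteq> {}"
    proof
      assume "[V]\<^bsup>k\<^esup> = {}"
      then have "card ([V]\<^bsup>k\<^esup>) = 0" by (simp only: card.empty)
      then show False unfolding cn using npos by simp
    qed
    have "measure_pmf.prob (induced_edge_count_pmf V E k) {X. X = x}
       = real (card ([V]\<^bsup>k\<^esup> \<inter> (\<lambda>U. int (card (induced_edges E U))) -` {X. X = x})) / real (card ([V]\<^bsup>k\<^esup>))"
      unfolding induced_edge_count_pmf_def measure_map_pmf by (rule measure_pmf_of_set[OF ne fin])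
    also have "[V]\<^bsup>k\<^esup> \<inter> (\<lambda>U. int (card (induced_edges E U))) -` {X. X = x} = S"
    proof -
      have "(int (card (induced_edges E U)) = x) = (adj.edge_weight E (\<lambda>_. 0) U = of_int x)" if "U \<subseteq> V" for U
        unfolding card_induced_edges[OF G that, symmetric] by (metis of_int_eq_iff of_int_of_nat_eq)
      then show ?thesis unfolding nsets S_def by auto
    qed
    also have "real (card S) / real (card ([V]\<^bsup>k\<^esup>)) \<le> p"
      using Sbound npos unfolding cn by (simp add: pos_divide_le_eq)
    finally show "measure_pmf.prob (induced_edge_count_pmf V E k) {X. X = x} \<le> real n powr (- 1 + \<eta>)"
      unfolding p_def .
  qed
qed

end
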